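(* Let $\frac{1}{3}<H<\frac{1}{2}$, $T>0$, and let $B_t=(B^1_t,B^2_t)$, $t\in[0,T]$, be a two-dimensional fractional Brownian motion with Hurst parameter $H$. For $m\ge 1$ let $B_m=((B^1_m),(B^2_m))$ be the $m$-th dyadic approximation of $B$, define \[ (A_m)_t:=\frac12\left[\int_0^t (B^1_m)_s\,d(B^2_m)_s-\int_0^t (B^2_m)_s\,d(B^1_m)_s\right], \] and let $A_t:=\lim_{m\to\infty}(A_m)_t$ (almost sure limit). Define the $\mathbb{R}^3$-valued process $Y_0=0$, $Y_t=(B_t,A_t)$ for $t\in(0,T]$. Then for every $t\in(0,T]$, the law of $Y_t$ has a density with respect to Lebesgue measure on $\mathbb{R}^3$, and this density is $C^\infty$.
   Context: A one-dimensional fractional Brownian motion with Hurst parameter $H$ is a centered continuous Gaussian process with covariance $R(s,t)=\frac12(s^{2H}+t^{2H}-|t-s|^{2H})$; a two-dimensional one consists of two independent copies. With $D_m=\{k2^{-m}T: k=0,\dots,2^m\}$, the $m$-th dyadic approximation of a path $f$ is the piecewise linear path agreeing with $f$ on $D_m$ and linear between consecutive points of $D_m$: $(B_m)_t=B_{t_-}+(t-t_-)2^m T^{-1}\cdot T\,[B_{t_+}-B_{t_-}]/T$, i.e. linear interpolation between $t_-=\max\{s\in D_m:s\le t\}$ and $t_+=\min\{s\in D_m:s\ge t\}$. The integrals defining $A_m$ are ordinary Riemann–Stieltjes integrals of piecewise linear paths; the almost sure limit $A_t$ exists. *)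

theory Defs
  imports "HOL-Probability.Probability"
begin

definition fbm_cov :: "real \<Rightarrow> real \<Rightarrow> real \<Rightarrow> real" where
  "fbm_cov H s t = (s powr (2*H) + t powr (2*H) - \<bar>t - s\<bar> powr (2*H)) / 2"

definition centered_normal_rv :: "'a measure \<Rightarrow> ('a \<Rightarrow> real) \<Rightarrow> real \<Rightarrow> bool" where
  "centered_normal_rv M X v \<longleftrightarrow>
     X \<in> borel_measurable M \<and>
     (if v = 0 then (AE \<omega> in M. X \<omega> = 0)
      else v > 0 \<and> distributed M lborel X (\<lambda>x. ennreal (normal_density 0 (sqrt v) x)))"

text \<open>(B1,B2) is a two-dimensional fractional Brownian motion on [0,T] with Hurst
  parameter H: two independent centered Gaussian processes with covariance fbm_cov H
  and continuous paths.  Joint Gaussianity and independence of the components are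
  expressed by requiring every finite linear combination of the values to be
  centered normal with the corresponding variance.\<close>
definition fbm2 :: "'a measure \<Rightarrow> real \<Rightarrow> real \<Rightarrow> (real \<Rightarrow> 'a \<Rightarrow> real) \<Rightarrow> (real \<Rightarrow> 'a \<Rightarrow> real) \<Rightarrow> bool" where
  "fbm2 M H T B1 B2 \<longleftrightarrow>
     prob_space M \<and>
     (\<forall>t\<in>{0..T}. B1 t \<in> borel_measurable M \<and> B2 t \<in> borel_measurable M) \<and>
     (\<forall>\<omega>\<in>space M. continuous_on {0..T} (\<lambda>t. B1 t \<omega>) \<and> continuous_on {0..T} (\<lambda>t. B2 t \<omega>)) \<and>
     (\<forall>S a b. finite S \<longrightarrow> S \<subseteq> {0..T} \<longrightarrow>
        centered_normal_rv M (\<lambda>\<omega>. \<Sum>t\<in>S. a t * B1 t \<omega> + b t * B2 t \<omega>)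
          (\<Sum>s\<in>S. \<Sum>t\<in>S. (a s * a t + b s * b t) * fbm_cov H s t))"

definition dyad_idx :: "real \<Rightarrow> nat \<Rightarrow> real \<Rightarrow> nat" where
  "dyad_idx T m t = min (nat \<lfloor>t / (T / 2^m)\<rfloor>) (2^m - 1)"

definition dyad_approx :: "real \<Rightarrow> nat \<Rightarrow> (real \<Rightarrow> real) \<Rightarrow> real \<Rightarrow> real" where
  "dyad_approx T m f t =
     (let h = T / 2^m; k = real (dyad_idx T m t)
      in f (k*h) + (t - k*h) / h * (f ((k+1)*h) - f (k*h)))"

definition dyad_slope :: "real \<Rightarrow> nat \<Rightarrow> (real \<Rightarrow> real) \<Rightarrow> real \<Rightarrow> real" where
  "dyad_slope T m f t =
     (let h = T / 2^m; k = real (dyad_idx T m t)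
      in (f ((k+1)*h) - f (k*h)) / h)"

text \<open>Riemann--Stieltjes integral of the piecewise linear path dyad_approx f against
  the piecewise linear path dyad_approx g over [0,t]: since the integrator is
  piecewise linear, it equals the integral of f_m times g_m'.\<close>
definition dyad_rs_integral :: "real \<Rightarrow> nat \<Rightarrow> (real \<Rightarrow> real) \<Rightarrow> (real \<Rightarrow> real) \<Rightarrow> real \<Rightarrow> real" where
  "dyad_rs_integral T m f g t =
     integral {0..t} (\<lambda>s. dyad_approx T m f s * dyad_slope T m g s)"

definition levy_area_approx :: "real \<Rightarrow> nat \<Rightarrow> (real \<Rightarrow> real) \<Rightarrow> (real \<Rightarrow> real) \<Rightarrow> real \<Rightarrow> real" where
  "levy_area_approx T m f g t =
     (dyad_rs_integral T m f g t - dyad_rs_integral T m g f t) / 2"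

coinductive smooth_fun :: "('b::real_normed_vector \<Rightarrow> real) \<Rightarrow> bool" where
  "(\<And>x. (f has_derivative D x) (at x)) \<Longrightarrow> (\<And>v. smooth_fun (\<lambda>x. D x v)) \<Longrightarrow> smooth_fun f"

end

theory Submission
  imports Defs "HOL-Real_Asymp.Real_Asymp"
begin

text \<open>The characteristic function of \<open>(B\<^sub>t, A\<^sub>t)\<close> decays faster than every power, so Fourier inversion
  gives a smooth density. For \<open>H < 1/2\<close> the increments of fractional Brownian motion over a grid of
  mesh \<open>h\<close> are negatively correlated and have row sums at least \<open>2 H T powr (2 H - 1) * h\<close>, so by
  diagonal dominance their covariance matrix dominates that of \<open>c\<close> times a Brownian motion.
  The dyadic area is bilinear in the increments \<open>\<xi>\<close>, \<open>\<eta>\<close> of the two components; integrating out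
  \<open>\<xi>\<close> bounds the characteristic function at \<open>(u, v, w)\<close> by the mean of
  \<open>exp (- c h \<bar>u \<theta> + (w/2) J \<eta>\<bar>\<^sup>2 / 2)\<close>. Testing the vector against Haar functions on \<open>N\<close> disjoint
  blocks, whose images under the antisymmetric matrix \<open>J\<close> again have disjoint supports, gives the
  factor \<open>(1 + a w\<^sup>2) powr (- N/2)\<close>; testing it against a constant vector gives
  \<open>exp (- b u\<^sup>2 / (1 + d w\<^sup>2))\<close>. Exchanging the components gives the decay in \<open>v\<close>. All constants
  are independent of the dyadic level, and the bounds pass to the limit.\<close>

text \<open>Two points carry the argument. First, neither decay bound suffices alone: the area bound
  ignores \<open>u\<close> and \<open>v\<close>, and the endpoint bound weakens as \<open>w\<close>
  grows. They are matched by comparing \<open>max \<bar>u\<bar> \<bar>v\<bar>\<close> with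
  \<open>w\<^sup>2\<close>. Second, the mesh must cancel. Coercivity of the increments holds with a
  constant of order \<open>h\<close> and is spent twice, once when \<xi> is integrated out and once
  on the covariance of \<eta>, so a factor \<open>h\<^sup>2\<close> has to be recovered. A Haar
  function of half-length \<open>l\<close> has squared norm \<open>2 * l\<close>, while its image
  under \<open>J\<close> is a tent of squared norm of order \<open>l ^ 3\<close>; the quotient
  \<open>l\<^sup>2\<close> restores \<open>(h * l)\<^sup>2\<close>, the square of a length fixed in
  advance. Haar functions sum to zero, so the shift by \<open>u\<close> drops out at the same time.
  The number of blocks is arbitrary but their length shrinks with it, so \<open>a\<close> depends on
  the power of decay asked for. Finally, \<open>fbm2\<close> speaks only of laws of linear
  combinations; integrating over \<xi> for fixed \<eta> therefore rests on a multivariate uniqueness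
  theorem, derived from the one-dimensional one coordinate by coordinate.\<close>

subsection \<open>Joint laws and characteristic functions\<close>

text \<open>The weighted characteristic functions agree at 0, so both weights have the same mass
  \<open>c\<close>. Dividing by \<open>c\<close> gives two probability laws, to which Levy's
  uniqueness theorem applies; if \<open>c = 0\<close>, both weights vanish almost everywhere.
  Nonnegativity is what makes the weights densities.\<close>

lemma law_eq_of_weighted_char_eq:
  fixes X g :: "'a \<Rightarrow> real" and X' g' :: "'b \<Rightarrow> real"
  assumes "prob_space M" "prob_space M'"
    and [measurable]: "X \<in> borel_measurable M" "g \<in> borel_measurable M"
      "X' \<in> borel_measurable M'" "g' \<in> borel_measurable M'"
    and g: "\<And>\<omega>. 0 \<le> g \<omega>" "\<And>\<omega>. g \<omega> \<le> b" and g': "\<And>\<omega>. 0 \<le> g' \<omega>" "\<And>\<omega>. g' \<omega> \<le> b"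
    and char_eq: "\<And>s. (CLINT \<omega>|M. g \<omega> * iexp (s * X \<omega>)) = (CLINT \<omega>|M'. g' \<omega> * iexp (s * X' \<omega>))"
    and A: "A \<in> sets borel"
  shows "(LINT \<omega>|M. g \<omega> * indicator A (X \<omega>)) = (LINT \<omega>|M'. g' \<omega> * indicator A (X' \<omega>))"
proof -
  interpret M: prob_space M by fact
  interpret M': prob_space M' by fact
  define c where "c = (LINT \<omega>|M. g \<omega>)"
  have int: "integrable M g" "integrable M' g'"
    using g g' by (auto intro!: M.integrable_const_bound[where B=b] M'.integrable_const_bound[where B=b])
  have c': "(LINT \<omega>|M'. g' \<omega>) = c"
    using char_eq[of 0] by (simp add: c_def)
  have "c \<ge> 0" using g by (simp add: c_def)
  show ?thesis
  proof (cases "c = 0")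
    case True
    have "AE \<omega> in M. g \<omega> = 0" "AE \<omega> in M'. g' \<omega> = 0"
      using True c' int g g' integral_nonneg_eq_0_iff_AE[of M g] integral_nonneg_eq_0_iff_AE[of M' g']
      by (auto simp: c_def)
    then have "(LINT \<omega>|M. g \<omega> * indicator A (X \<omega>)) = 0"
      "(LINT \<omega>|M'. g' \<omega> * indicator A (X' \<omega>)) = 0"
      by (auto intro!: integral_eq_zero_AE)
    then show ?thesis by simp
  next
    case False
    then have c: "c > 0" using \<open>c \<ge> 0\<close> by simp
    have law: "real_distribution (distr (density N (\<lambda>\<omega>. ennreal (k \<omega> / c))) borel Y)"
      "char (distr (density N (\<lambda>\<omega>. ennreal (k \<omega> / c))) borel Y) s = (CLINT \<omega>|N. k \<omega> * iexp (s * Y \<omega>)) / c"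
      "measure (distr (density N (\<lambda>\<omega>. ennreal (k \<omega> / c))) borel Y) A = (LINT \<omega>|N. k \<omega> * indicator A (Y \<omega>)) / c"
      if [measurable]: "Y \<in> borel_measurable N" "k \<in> borel_measurable N"
        and k: "\<And>\<omega>. 0 \<le> k \<omega>" and ik: "integrable N k" "(LINT \<omega>|N. k \<omega>) = c"
      for Y k :: "'c \<Rightarrow> real" and N s
    proof -
      have "(\<integral>\<^sup>+\<omega>. ennreal (k \<omega> / c) \<partial>N) = ennreal (LINT \<omega>|N. k \<omega> / c)"
        using k c ik by (intro nn_integral_eq_integral) auto
      then have "prob_space (density N (\<lambda>\<omega>. ennreal (k \<omega> / c)))"
        using ik c by (intro prob_spaceI) (simp add: emeasure_density cong: nn_integral_cong)
      then interpret P: prob_space "density N (\<lambda>\<omega>. ennreal (k \<omega> / c))" .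
      interpret D: prob_space "distr (density N (\<lambda>\<omega>. ennreal (k \<omega> / c))) borel Y"
        by (rule P.prob_space_distr) simp
      show "real_distribution (distr (density N (\<lambda>\<omega>. ennreal (k \<omega> / c))) borel Y)"
        by standard auto
      show "char (distr (density N (\<lambda>\<omega>. ennreal (k \<omega> / c))) borel Y) s = (CLINT \<omega>|N. k \<omega> * iexp (s * Y \<omega>)) / c"
        using k c by (simp add: char_def integral_distr integral_density scaleR_conv_of_real flip: integral_divide_zero)
      have "measure (distr (density N (\<lambda>\<omega>. ennreal (k \<omega> / c))) borel Y) A
          = (LINT x|distr (density N (\<lambda>\<omega>. ennreal (k \<omega> / c))) borel Y. indicator A x)"
        using A by simp
      also have "\<dots> = (LINT \<omega>|N. k \<omega> * indicator A (Y \<omega>)) / c"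
        using k c A by (subst integral_distr) (auto simp: integral_density simp flip: integral_divide_zero)
      finally show "measure (distr (density N (\<lambda>\<omega>. ennreal (k \<omega> / c))) borel Y) A
          = (LINT \<omega>|N. k \<omega> * indicator A (Y \<omega>)) / c" .
    qed
    note L = law[of X M g] law[of X' M' g']
    have "distr (density M (\<lambda>\<omega>. ennreal (g \<omega> / c))) borel X
        = distr (density M' (\<lambda>\<omega>. ennreal (g' \<omega> / c))) borel X'"
      by (rule Levy_uniqueness) (auto intro!: law ext simp: g g' int c' L char_eq c_def[symmetric] simp del: of_real_mult)
    then show ?thesis
      using law(3)[of X M g] law(3)[of X' M' g'] c
      by (simp add: g g' int c' c_def[symmetric])
  qed
qed

lemma cos_conv_iexp: "complex_of_real (cos y) = (iexp y + iexp (- y)) / 2"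
  by (simp add: cos_of_real[symmetric] cos_exp_eq)

lemma iexp_conv_cos: "iexp y = complex_of_real (cos y) + \<i> * complex_of_real (cos (y + - pi/2))"
  by (simp add: exp_Euler cos_of_real sin_of_real cos_diff)

text \<open>The weight \<open>1 + cos (\<Theta> + c)\<close> is nonnegative, so the uniqueness theorem for positive measures
  applies; the choices \<open>c = 0\<close> and \<open>c = - pi/2\<close> recover the complex weight \<open>exp (i \<Theta>)\<close>.\<close>

lemma weighted_iexp_indicator_eq:
  fixes X g \<Theta> :: "'a \<Rightarrow> real" and X' g' \<Theta>' :: "'b \<Rightarrow> real"
  assumes "prob_space M" "prob_space M'"
    and [measurable]: "X \<in> borel_measurable M" "g \<in> borel_measurable M" "\<Theta> \<in> borel_measurable M"
      "X' \<in> borel_measurable M'" "g' \<in> borel_measurable M'" "\<Theta>' \<in> borel_measurable M'"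
    and g: "\<And>\<omega>. 0 \<le> g \<omega>" "\<And>\<omega>. g \<omega> \<le> 1" and g': "\<And>\<omega>. 0 \<le> g' \<omega>" "\<And>\<omega>. g' \<omega> \<le> 1"
    and char_eq: "\<And>r s. (CLINT \<omega>|M. g \<omega> * iexp (r * \<Theta> \<omega> + s * X \<omega>)) = (CLINT \<omega>|M'. g' \<omega> * iexp (r * \<Theta>' \<omega> + s * X' \<omega>))"
    and A: "A \<in> sets borel"
  shows "(CLINT \<omega>|M. (g \<omega> * indicator A (X \<omega>)) * iexp (\<Theta> \<omega>)) = (CLINT \<omega>|M'. (g' \<omega> * indicator A (X' \<omega>)) * iexp (\<Theta>' \<omega>))"
proof -
  interpret M: prob_space M by fact
  interpret M': prob_space M' by fact
  \<comment> \<open>By Euler's formula the weight \<open>1 + cos\<close> contributes the frequencies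
    0, 1 and -1 of \<Phi>, so the weighted transform is a combination of three values of the
    transform in \<open>char_eq\<close>.\<close>
  have expand: "(CLINT \<omega>|N. (k \<omega> * (1 + cos (\<Phi> \<omega> + c))) * iexp (s * Y \<omega>))
      = (CLINT \<omega>|N. k \<omega> * iexp (0 * \<Phi> \<omega> + s * Y \<omega>))
      + (iexp c * (CLINT \<omega>|N. k \<omega> * iexp (1 * \<Phi> \<omega> + s * Y \<omega>))
        + iexp (- c) * (CLINT \<omega>|N. k \<omega> * iexp (-1 * \<Phi> \<omega> + s * Y \<omega>))) / 2"
    if "prob_space N" and [measurable]: "k \<in> borel_measurable N" "\<Phi> \<in> borel_measurable N" "Y \<in> borel_measurable N"
      and k: "\<And>\<omega>. 0 \<le> k \<omega>" "\<And>\<omega>. k \<omega> \<le> 1"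
    for N :: "'c measure" and k \<Phi> Y :: "'c \<Rightarrow> real" and c s
  proof -
    interpret N: prob_space N by fact
    have i: "complex_integrable N (\<lambda>\<omega>. k \<omega> * iexp (r * \<Phi> \<omega> + s * Y \<omega>))" for r s
      using k by (intro N.integrable_const_bound[where B=1]) (auto simp: norm_mult simp flip: of_real_mult of_real_add)
    have "complex_of_real (k \<omega> * (1 + cos (\<Phi> \<omega> + c))) * iexp (s * Y \<omega>)
        = k \<omega> * iexp (0 * \<Phi> \<omega> + s * Y \<omega>) + (iexp c * (k \<omega> * iexp (1 * \<Phi> \<omega> + s * Y \<omega>))
           + iexp (- c) * (k \<omega> * iexp (-1 * \<Phi> \<omega> + s * Y \<omega>))) / 2" for \<omega>
      unfolding of_real_mult of_real_add cos_conv_iexp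
      by (simp add: exp_add[symmetric] field_simps exp_minus)
    then show ?thesis using i[of 0 s] i[of 1 s] i[of "-1" s] by simp
  qed
  have nn: "0 \<le> 1 + cos y" for y :: real
    using cos_ge_minus_one[of y] by linarith
  have E: "(LINT \<omega>|M. (g \<omega> * (1 + cos (r * \<Theta> \<omega> + c))) * indicator A (X \<omega>))
      = (LINT \<omega>|M'. (g' \<omega> * (1 + cos (r * \<Theta>' \<omega> + c))) * indicator A (X' \<omega>))" for r c
  proof (rule law_eq_of_weighted_char_eq[where b=2])
    fix \<omega>
    have "g \<omega> * (1 + cos (r * \<Theta> \<omega> + c)) \<le> 1 * (1 + 1)" by (intro mult_mono g cos_le_one add_mono nn) auto
    then show "g \<omega> * (1 + cos (r * \<Theta> \<omega> + c)) \<le> 2" by simp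
  next
    fix \<omega>
    have "g' \<omega> * (1 + cos (r * \<Theta>' \<omega> + c)) \<le> 1 * (1 + 1)" by (intro mult_mono g' cos_le_one add_mono nn) auto
    then show "g' \<omega> * (1 + cos (r * \<Theta>' \<omega> + c)) \<le> 2" by simp
  next
    fix s
    show "(CLINT \<omega>|M. (g \<omega> * (1 + cos (r * \<Theta> \<omega> + c))) * iexp (s * X \<omega>)) =
         (CLINT \<omega>|M'. (g' \<omega> * (1 + cos (r * \<Theta>' \<omega> + c))) * iexp (s * X' \<omega>))"
      using char_eq[of 0 s] char_eq[of r s] char_eq[of "-r" s]
      by (subst (1 2) expand) (simp_all add: assms g g')
  next
    show "0 \<le> g \<omega> * (1 + cos (r * \<Theta> \<omega> + c))" for \<omega>
      using g nn by (metis mult_nonneg_nonneg)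
    show "0 \<le> g' \<omega> * (1 + cos (r * \<Theta>' \<omega> + c))" for \<omega>
      using g' nn by (metis mult_nonneg_nonneg)
  qed (use assms in auto)
  have iM: "integrable M (\<lambda>\<omega>. g \<omega> * indicator A (X \<omega>))" "integrable M' (\<lambda>\<omega>. g' \<omega> * indicator A (X' \<omega>))"
    using A g g' by (auto intro!: M.integrable_const_bound[where B=1] M'.integrable_const_bound[where B=1] simp: indicator_def)
  have icM: "integrable M (\<lambda>\<omega>. g \<omega> * indicator A (X \<omega>) * cos (\<Theta> \<omega> + c))"
    "integrable M' (\<lambda>\<omega>. g' \<omega> * indicator A (X' \<omega>) * cos (\<Theta>' \<omega> + c))" for c
    using A g g' by (auto intro!: M.integrable_const_bound[where B=1] M'.integrable_const_bound[where B=1] AE_I2 mult_le_one simp: indicator_def abs_mult)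
  \<comment> \<open>At \<open>r = 0\<close>, \<open>c = 0\<close> the weight \<open>1 + cos\<close>
    is the constant 2. The resulting identity without cosine is subtracted in \<open>Ec\<close> to
    isolate the cosine.\<close>
  have E1: "(LINT \<omega>|M. g \<omega> * indicator A (X \<omega>)) = (LINT \<omega>|M'. g' \<omega> * indicator A (X' \<omega>))"
  proof -
    have e: "(k * (1 + cos (0 * y + 0))) * i = 2 * (k * i)" for k y i :: real by simp
    show ?thesis using E[of 0 0] unfolding e by simp
  qed
  have Ec: "(LINT \<omega>|M. g \<omega> * indicator A (X \<omega>) * cos (\<Theta> \<omega> + c)) = (LINT \<omega>|M'. g' \<omega> * indicator A (X' \<omega>) * cos (\<Theta>' \<omega> + c))" for c
  proof -
    have "(LINT \<omega>|M. g \<omega> * indicator A (X \<omega>) + g \<omega> * indicator A (X \<omega>) * cos (\<Theta> \<omega> + c))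
       = (LINT \<omega>|M'. g' \<omega> * indicator A (X' \<omega>) + g' \<omega> * indicator A (X' \<omega>) * cos (\<Theta>' \<omega> + c))"
      using E[of 1 c] by (simp add: algebra_simps)
    then show ?thesis using iM icM E1 by simp
  qed
  have S: "complex_of_real (k * i) * iexp y = complex_of_real (k * i * cos (y + 0)) + \<i> * complex_of_real (k * i * cos (y + - pi / 2))" for k i y :: real
    unfolding iexp_conv_cos[of y] by (simp add: algebra_simps)
  have R: "(CLINT \<omega>|N. complex_of_real (f \<omega>) + \<i> * complex_of_real (h \<omega>)) = complex_of_real (LINT \<omega>|N. f \<omega>) + \<i> * complex_of_real (LINT \<omega>|N. h \<omega>)"
    if "integrable N f" "integrable N h" for N :: "'c measure" and f h
    using that by simp
  show ?thesis
    unfolding S R[OF icM(1) icM(1)] R[OF icM(2) icM(2)] Ec ..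
qed

text \<open>Frequencies are traded for indicators one coordinate at a time: on the coordinates in
  \<open>J\<close> the complex exponential has been replaced by an indicator, while the remaining
  frequencies survive as a phase. At \<open>J = I\<close> only probabilities of rectangles are left,
  and these determine the law.\<close>

lemma joint_law_eq_of_char_eq:
  fixes X :: "'i \<Rightarrow> 'a \<Rightarrow> real" and X' :: "'i \<Rightarrow> 'b \<Rightarrow> real"
  assumes "prob_space M" "prob_space M'" and I: "finite I"
    and X: "\<And>i. i \<in> I \<Longrightarrow> X i \<in> borel_measurable M"
    and X': "\<And>i. i \<in> I \<Longrightarrow> X' i \<in> borel_measurable M'"
    and char_eq: "\<And>a. (CLINT \<omega>|M. iexp (\<Sum>i\<in>I. a i * X i \<omega>)) = (CLINT \<omega>|M'. iexp (\<Sum>i\<in>I. a i * X' i \<omega>))"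
  shows "distr M (\<Pi>\<^sub>M i\<in>I. borel) (\<lambda>\<omega>. \<lambda>i\<in>I. X i \<omega>) = distr M' (\<Pi>\<^sub>M i\<in>I. borel) (\<lambda>\<omega>. \<lambda>i\<in>I. X' i \<omega>)"
proof -
  interpret M: prob_space M by fact
  interpret M': prob_space M' by fact
  note [measurable] = X X'
  have *: "(CLINT \<omega>|M. (\<Prod>j\<in>J. indicator (A j) (X j \<omega>) :: real) * iexp (\<Sum>i\<in>I-J. a i * X i \<omega>))
       = (CLINT \<omega>|M'. (\<Prod>j\<in>J. indicator (A j) (X' j \<omega>) :: real) * iexp (\<Sum>i\<in>I-J. a i * X' i \<omega>))"
    if J: "finite J" "J \<subseteq> I" and A: "\<And>j. j \<in> J \<Longrightarrow> A j \<in> sets borel" for J A a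
    using J A
  proof (induction J arbitrary: a rule: finite_subset_induct')
    case empty
    then show ?case using char_eq by simp
  next
    case (insert k J)
    have A[measurable]: "A k \<in> sets borel" "\<And>j. j \<in> J \<Longrightarrow> A j \<in> sets borel" using insert by auto
    have meas[measurable]: "X j \<in> borel_measurable M" "X' j \<in> borel_measurable M'" if "j \<in> J" for j
      using that insert by auto
    \<comment> \<open>This frequency vector isolates coordinate \<open>k\<close> and scales the
      others by \<open>r\<close>. The induction hypothesis holds for every \<open>a\<close>, so it
      covers all pairs \<open>r\<close>, \<open>s\<close> that
      \<open>weighted_iexp_indicator_eq\<close> asks for.\<close>
    have split: "(\<Sum>i\<in>I-J. (if i = k then s else r * a i) * Y i) = r * (\<Sum>i\<in>I-insert k J. a i * Y i) + s * Y k" for r s and Y :: "'i \<Rightarrow> real"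
    proof -
      have e: "I - J = insert k (I - insert k J)" using insert by auto
      have "(\<Sum>i\<in>I-J. (if i = k then s else r * a i) * Y i) = s * Y k + (\<Sum>i\<in>I-insert k J. (if i = k then s else r * a i) * Y i)"
        unfolding e using I by (subst sum.insert) auto
      also have "(\<Sum>i\<in>I-insert k J. (if i = k then s else r * a i) * Y i) = (\<Sum>i\<in>I-insert k J. r * (a i * Y i))"
        by (intro sum.cong) auto
      finally show ?thesis by (simp add: sum_distrib_left)
    qed
    have pb: "0 \<le> (\<Prod>j\<in>J. indicator (A j) (Y j) :: real)" "(\<Prod>j\<in>J. indicator (A j) (Y j) :: real) \<le> 1" for Y
      by (auto intro!: prod_nonneg prod_le_1)
    have "(CLINT \<omega>|M. ((\<Prod>j\<in>J. indicator (A j) (X j \<omega>)) * indicator (A k) (X k \<omega>) :: real) * iexp (\<Sum>i\<in>I-insert k J. a i * X i \<omega>))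
      = (CLINT \<omega>|M'. ((\<Prod>j\<in>J. indicator (A j) (X' j \<omega>)) * indicator (A k) (X' k \<omega>) :: real) * iexp (\<Sum>i\<in>I-insert k J. a i * X' i \<omega>))"
    proof (rule weighted_iexp_indicator_eq)
      fix r s
      show "(CLINT \<omega>|M. (\<Prod>j\<in>J. indicator (A j) (X j \<omega>)::real) * iexp (r * (\<Sum>i\<in>I-insert k J. a i * X i \<omega>) + s * X k \<omega>)) =
        (CLINT \<omega>|M'. (\<Prod>j\<in>J. indicator (A j) (X' j \<omega>)::real) * iexp (r * (\<Sum>i\<in>I-insert k J. a i * X' i \<omega>) + s * X' k \<omega>))"
        using insert.IH[of "\<lambda>i. if i = k then s else r * a i"] A unfolding split by simp
    qed (use assms insert.hyps pb in auto)
    then show ?case using insert.hyps by (simp add: ac_simps)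
  qed
  have fin: "finite_measure (distr M (\<Pi>\<^sub>M i\<in>I. borel) (\<lambda>\<omega>. \<lambda>i\<in>I. X i \<omega>))"
    by (intro prob_space.finite_measure M.prob_space_distr) measurable
  show ?thesis
  proof (rule measure_eqI_PiM_finite[where A="\<lambda>_::nat. space (\<Pi>\<^sub>M i\<in>I. borel)"])
    fix A :: "'i \<Rightarrow> real set" assume A[measurable]: "\<And>i. i \<in> I \<Longrightarrow> A i \<in> sets borel"
    have meas: "emeasure (distr N (\<Pi>\<^sub>M i\<in>I. borel) (\<lambda>\<omega>. \<lambda>i\<in>I. Y i \<omega>)) (Pi\<^sub>E I A)
       = ennreal (LINT \<omega>|N. (\<Prod>j\<in>I. indicator (A j) (Y j \<omega>)))"
      if "prob_space N" and [measurable]: "\<And>i. i \<in> I \<Longrightarrow> Y i \<in> borel_measurable N" for N :: "'c measure" and Y :: "'i \<Rightarrow> 'c \<Rightarrow> real"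
    proof -
      interpret N: prob_space N by fact
      have [measurable]: "Pi\<^sub>E I A \<in> sets (\<Pi>\<^sub>M i\<in>I. borel)" using I A by (intro sets_PiM_I_finite) auto
      have "emeasure (distr N (\<Pi>\<^sub>M i\<in>I. borel) (\<lambda>\<omega>. \<lambda>i\<in>I. Y i \<omega>)) (Pi\<^sub>E I A)
         = emeasure N ((\<lambda>\<omega>. \<lambda>i\<in>I. Y i \<omega>) -` Pi\<^sub>E I A \<inter> space N)"
        by (rule emeasure_distr) measurable
      also have "\<dots> = ennreal (measure N ((\<lambda>\<omega>. \<lambda>i\<in>I. Y i \<omega>) -` Pi\<^sub>E I A \<inter> space N))"
        by (rule N.emeasure_eq_measure)
      also have "measure N ((\<lambda>\<omega>. \<lambda>i\<in>I. Y i \<omega>) -` Pi\<^sub>E I A \<inter> space N)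
         = (LINT \<omega>|N. indicator ((\<lambda>\<omega>. \<lambda>i\<in>I. Y i \<omega>) -` Pi\<^sub>E I A \<inter> space N) \<omega>)"
        by simp
      also have "\<dots> = (LINT \<omega>|N. (\<Prod>j\<in>I. indicator (A j) (Y j \<omega>) :: real))"
        using I by (intro Bochner_Integration.integral_cong) (auto simp: indicator_def PiE_def Pi_def split: if_splits)
      finally show ?thesis .
    qed
    have "(LINT \<omega>|M. (\<Prod>j\<in>I. indicator (A j) (X j \<omega>))) = (LINT \<omega>|M'. (\<Prod>j\<in>I. indicator (A j) (X' j \<omega>) :: real))"
      using *[of I A] A I by (simp del: of_real_prod)
    then show "emeasure (distr M (\<Pi>\<^sub>M i\<in>I. borel) (\<lambda>\<omega>. \<lambda>i\<in>I. X i \<omega>)) (Pi\<^sub>E I A)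
        = emeasure (distr M' (\<Pi>\<^sub>M i\<in>I. borel) (\<lambda>\<omega>. \<lambda>i\<in>I. X' i \<omega>)) (Pi\<^sub>E I A)"
      by (simp add: meas assms)
  next
    have "(\<Pi>\<^sub>E i\<in>I. space borel) \<in> prod_algebra I (\<lambda>_. borel :: real measure)"
      using I by (intro prod_algebraI_finite) auto
    then show "range (\<lambda>_::nat. space (\<Pi>\<^sub>M i\<in>I. borel)) \<subseteq> prod_algebra I (\<lambda>_. borel :: real measure)"
      by (auto simp: space_PiM)
  next
    fix n :: nat
    interpret F: finite_measure "distr M (\<Pi>\<^sub>M i\<in>I. borel) (\<lambda>\<omega>. \<lambda>i\<in>I. X i \<omega>)" by fact
    show "emeasure (distr M (\<Pi>\<^sub>M i\<in>I. borel) (\<lambda>\<omega>. \<lambda>i\<in>I. X i \<omega>)) (space (\<Pi>\<^sub>M i\<in>I. borel)) \<noteq> \<infinity>"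
      by (rule F.emeasure_finite[unfolded top_ennreal.rep_eq infinity_ennreal_def[symmetric]])
  qed (use I in auto)
qed

subsection \<open>Fourier inversion with a smooth density\<close>

text \<open>Decay as for Schwartz functions, but with no condition on derivatives: decay alone makes
  the Fourier transform smooth, and it survives multiplication by polynomials.\<close>

definition rapidly_decreasing :: "('n::euclidean_space \<Rightarrow> complex) \<Rightarrow> bool" where
  "rapidly_decreasing \<phi> \<longleftrightarrow> \<phi> \<in> borel_measurable borel \<and> (\<forall>N::nat. \<exists>C. \<forall>x. (1 + norm x) ^ N * cmod (\<phi> x) \<le> C)"

lemma integrable_inverse_one_plus_square: "integrable lborel (\<lambda>x::real. 1 / (1 + x\<^sup>2))"
proof -
  have "set_integrable lborel {0<..} (\<lambda>x::real. 1 / (1 + x\<^sup>2))"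
    using integrable_I0i_1_div_plus_square by (simp add: interval_lebesgue_integrable_def zero_ereal_def)
  then have p: "integrable lborel (\<lambda>x::real. indicator {0<..} x * (1 / (1 + x\<^sup>2)))"
    by (simp add: set_integrable_def)
  have n: "integrable lborel (\<lambda>x::real. indicator {0<..} (-x) * (1 / (1 + x\<^sup>2)))"
    using lborel_integrable_real_affine[OF p, of "-1" 0] by simp
  show ?thesis
  proof (rule integrable_cong_AE_imp[OF Bochner_Integration.integrable_add[OF p n]])
    show "AE x::real in lborel. indicator {0<..} x * (1 / (1 + x\<^sup>2)) + indicator {0<..} (-x) * (1 / (1 + x\<^sup>2)) = 1 / (1 + x\<^sup>2)"
      using AE_lborel_singleton[of "0::real"] by eventually_elim (auto simp: indicator_def)
  qed simp
qed

text \<open>Each coordinate satisfies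
  \<open>1 + (x \<bullet> b)\<^sup>2 \<le> (1 + norm x)\<^sup>2\<close>, hence the exponent 2 per
  dimension; the product majorant factorises into one-dimensional integrals.\<close>

lemma integrable_inverse_one_plus_norm_power:
  "integrable lborel (\<lambda>x::'n::euclidean_space. 1 / (1 + norm x) ^ (2 * DIM('n)))"
proof (rule Bochner_Integration.integrable_bound)
  have "(\<integral>\<^sup>+x. ennreal (\<Prod>b\<in>Basis. 1 / (1 + (x \<bullet> b)\<^sup>2)) \<partial>(lborel :: 'n measure))
      = (\<integral>\<^sup>+x. (\<Prod>b\<in>Basis. ennreal (1 / (1 + (x \<bullet> b)\<^sup>2))) \<partial>(lborel :: 'n measure))"
    by (subst prod_ennreal) auto
  also have "\<dots> = (\<Prod>b\<in>(Basis::'n set). \<integral>\<^sup>+x. ennreal (1 / (1 + x\<^sup>2)) \<partial>lborel)"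
    by (rule nn_integral_lborel_prod[where f="\<lambda>b x. ennreal (1 / (1 + x\<^sup>2))"]) auto
  also have "\<dots> < \<infinity>"
    using integrable_inverse_one_plus_square
    by (simp add: integrable_iff_bounded power_less_top_ennreal)
  finally show "integrable lborel (\<lambda>x::'n. \<Prod>b\<in>Basis. 1 / (1 + (x \<bullet> b)\<^sup>2))"
    by (simp add: integrable_iff_bounded abs_prod prod_nonneg)
  show "AE x::'n in lborel. norm (1 / (1 + norm x) ^ (2 * DIM('n))) \<le> norm (\<Prod>b\<in>Basis. 1 / (1 + (x \<bullet> b)\<^sup>2))"
  proof (rule AE_I2)
    fix x :: 'n
    have "1 + (x \<bullet> b)\<^sup>2 \<le> (1 + norm x)\<^sup>2" if "b \<in> Basis" for b
    proof -
      have "(x \<bullet> b)\<^sup>2 \<le> (norm x)\<^sup>2"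
        using Basis_le_norm[OF that, of x] by (metis abs_le_square_iff abs_norm_cancel)
      then show ?thesis using norm_ge_zero[of x] unfolding power2_sum power_one by linarith
    qed
    then have "(\<Prod>b\<in>(Basis::'n set). 1 / (1 + norm x)\<^sup>2) \<le> (\<Prod>b\<in>Basis. 1 / (1 + (x \<bullet> b)\<^sup>2))"
      by (intro prod_mono conjI divide_left_mono) (auto intro!: mult_pos_pos add_pos_nonneg zero_less_power)
    then show "norm (1 / (1 + norm x) ^ (2 * DIM('n))) \<le> norm (\<Prod>b\<in>Basis. 1 / (1 + (x \<bullet> b)\<^sup>2))"
      by (simp add: power_mult power_one_over prod_nonneg abs_prod)
  qed
qed simp

lemma rapidly_decreasing_integrable:
  fixes \<phi> :: "'n::euclidean_space \<Rightarrow> complex"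
  assumes "rapidly_decreasing \<phi>"
  shows "integrable lborel \<phi>"
proof -
  obtain C where C: "\<And>x. (1 + norm x) ^ (2 * DIM('n)) * cmod (\<phi> x) \<le> C"
    using assms unfolding rapidly_decreasing_def by blast
  have "integrable lborel (\<lambda>x::'n. C * (1 / (1 + norm x) ^ (2 * DIM('n))))"
    by (intro integrable_mult_right integrable_inverse_one_plus_norm_power)
  then show ?thesis
  proof (rule Bochner_Integration.integrable_bound)
    show "\<phi> \<in> borel_measurable lborel" using assms by (simp add: rapidly_decreasing_def)
    have "cmod (\<phi> x) \<le> C * (1 / (1 + norm x) ^ (2 * DIM('n)))" for x
    proof -
      have "0 < (1 + norm x) ^ (2 * DIM('n))" by (intro zero_less_power) (simp add: add_pos_nonneg)
      then show ?thesis using C[of x] by (simp add: pos_le_divide_eq mult.commute)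
    qed
    then show "AE x in lborel. norm (\<phi> x) \<le> norm (C * (1 / (1 + norm x) ^ (2 * DIM('n))))"
      by (intro AE_I2) (metis order_trans abs_ge_self real_norm_def)
  qed
qed

lemma rapidly_decreasing_mult:
  assumes \<phi>: "rapidly_decreasing \<phi>" and [measurable]: "q \<in> borel_measurable borel"
    and q: "\<And>x. cmod (q x) \<le> K * (1 + norm x) ^ k"
  shows "rapidly_decreasing (\<lambda>x. q x * \<phi> x)"
  unfolding rapidly_decreasing_def
proof (intro conjI allI)
  show "(\<lambda>x. q x * \<phi> x) \<in> borel_measurable borel"
    using \<phi> by (auto simp: rapidly_decreasing_def)
  fix N :: nat
  obtain C where C: "\<And>x. (1 + norm x) ^ (N + k) * cmod (\<phi> x) \<le> C"
    using \<phi> unfolding rapidly_decreasing_def by blast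
  have "K \<ge> 0" using q[of 0] order_trans[OF norm_ge_zero] by fastforce
  have "(1 + norm x) ^ N * cmod (q x * \<phi> x) \<le> K * C" for x
  proof -
    have "(1 + norm x) ^ N * cmod (q x * \<phi> x) \<le> (1 + norm x) ^ N * ((K * (1 + norm x) ^ k) * cmod (\<phi> x))"
      using q[of x] by (auto simp: norm_mult intro!: mult_left_mono mult_right_mono)
    also have "\<dots> = K * ((1 + norm x) ^ (N + k) * cmod (\<phi> x))" by (simp add: power_add ac_simps)
    also have "\<dots> \<le> K * C" using C \<open>K \<ge> 0\<close> by (intro mult_left_mono)
    finally show ?thesis .
  qed
  then show "\<exists>C. \<forall>x. (1 + norm x) ^ N * cmod (q x * \<phi> x) \<le> C" by blast
qed

text \<open>Unnormalised: the factor \<open>1 / (2 * pi) ^ DIM('n)\<close> is absorbed into \<phi>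
  where inversion needs it. Taking the real part gives the real-valued functions that
  \<open>smooth_fun\<close> speaks about.\<close>

definition Fourier_Re :: "('n::euclidean_space \<Rightarrow> complex) \<Rightarrow> 'n \<Rightarrow> real" where
  "Fourier_Re \<phi> x = Re (CLINT \<xi>|lborel. \<phi> \<xi> * iexp (- (\<xi> \<bullet> x)))"

lemma integrable_mult_iexp:
  assumes "integrable M (f :: 'a \<Rightarrow> complex)" and [measurable]: "h \<in> borel_measurable M"
  shows "integrable M (\<lambda>x. f x * iexp (h x))"
  using assms(1) by (rule Bochner_Integration.integrable_bound) (use assms in \<open>auto simp: norm_mult\<close>)

lemma rapidly_decreasing_mult_inner:
  assumes "rapidly_decreasing \<phi>"
  shows "rapidly_decreasing (\<lambda>\<xi>. - \<i> * complex_of_real (\<xi> \<bullet> v) * \<phi> \<xi>)"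
proof (rule rapidly_decreasing_mult[OF assms, where k=1 and K="norm v"])
  fix \<xi>
  have "\<bar>\<xi> \<bullet> v\<bar> \<le> norm v * (1 + norm \<xi>)"
    using Cauchy_Schwarz_ineq2[of \<xi> v] by (simp add: algebra_simps add_increasing)
  then show "cmod (- \<i> * complex_of_real (\<xi> \<bullet> v)) \<le> norm v * (1 + norm \<xi>) ^ 1"
    by (simp add: norm_mult)
qed measurable

text \<open>Differentiation under the integral. The remainder of \<open>iexp\<close> of order two is
  at most quadratic, so the error is bounded by \<open>(norm (y - x))\<^sup>2\<close> times the
  integral of \<open>(1 + norm \<xi>)\<^sup>2 * cmod (\<phi> \<xi>)\<close>. The derivative is
  written as a \<open>Fourier_Re\<close> again so that the lemma can be iterated.\<close>

lemma Fourier_Re_has_derivative: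
  fixes \<phi> :: "'n::euclidean_space \<Rightarrow> complex"
  assumes \<phi>: "rapidly_decreasing \<phi>"
  shows "(Fourier_Re \<phi> has_derivative (\<lambda>v. Fourier_Re (\<lambda>\<xi>. - \<i> * complex_of_real (\<xi> \<bullet> v) * \<phi> \<xi>) x)) (at x)"
proof -
  let ?D = "\<lambda>v. Fourier_Re (\<lambda>\<xi>. - \<i> * complex_of_real (\<xi> \<bullet> v) * \<phi> \<xi>) x"
  have [measurable]: "\<phi> \<in> borel_measurable borel" using \<phi> by (simp add: rapidly_decreasing_def)
  have inner_le: "\<bar>\<xi> \<bullet> v\<bar> \<le> norm v * (1 + norm \<xi>)" for \<xi> v :: 'n
    using Cauchy_Schwarz_ineq2[of \<xi> v] norm_ge_zero[of v] by (simp add: algebra_simps add_increasing)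
  note rv = rapidly_decreasing_mult_inner[OF \<phi>]
  have r2: "rapidly_decreasing (\<lambda>\<xi>. complex_of_real ((1 + norm \<xi>)\<^sup>2) * \<phi> \<xi>)"
    by (intro rapidly_decreasing_mult[OF \<phi>, where k=2 and K=1]) (auto simp: norm_power simp del: of_real_add of_real_power)
  have r1: "rapidly_decreasing (\<lambda>\<xi>. complex_of_real (1 + norm \<xi>) * \<phi> \<xi>)"
    by (intro rapidly_decreasing_mult[OF \<phi>, where k=1 and K=1]) (auto simp del: of_real_add)
  define C where "C = (LINT \<xi>|lborel. norm (complex_of_real ((1 + norm \<xi>)\<^sup>2) * \<phi> \<xi>))"
  note int = integrable_mult_iexp[OF rapidly_decreasing_integrable]
  have i0: "integrable lborel (\<lambda>\<xi>. \<phi> \<xi> * iexp (- (\<xi> \<bullet> y)))" for y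
    by (rule int[OF \<phi>]) simp
  have i1: "integrable lborel (\<lambda>\<xi>. - \<i> * complex_of_real (\<xi> \<bullet> v) * \<phi> \<xi> * iexp (- (\<xi> \<bullet> y)))" for v y
    by (rule int[OF rv]) simp
  have lin: "bounded_linear ?D"
  proof (rule bounded_linear_intro[where K="LINT \<xi>|lborel. norm (complex_of_real (1 + norm \<xi>) * \<phi> \<xi>)"])
    show "?D (v + w) = ?D v + ?D w" for v w
      unfolding Fourier_Re_def plus_complex.sel(1)[symmetric] Bochner_Integration.integral_add[OF i1 i1, symmetric]
      by (simp add: inner_add_right algebra_simps)
    have "(\<lambda>\<xi>. - \<i> * complex_of_real (\<xi> \<bullet> r *\<^sub>R v) * \<phi> \<xi> * iexp (- (\<xi> \<bullet> x)))
      = (\<lambda>\<xi>. complex_of_real r * (- \<i> * complex_of_real (\<xi> \<bullet> v) * \<phi> \<xi> * iexp (- (\<xi> \<bullet> x))))" for r v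
      by (auto simp: algebra_simps)
    then show "?D (r *\<^sub>R v) = r *\<^sub>R ?D v" for r v
      unfolding Fourier_Re_def by (simp only: integral_mult_right_zero) simp
    fix v
    have "norm (?D v) \<le> cmod (CLINT \<xi>|lborel. - \<i> * complex_of_real (\<xi> \<bullet> v) * \<phi> \<xi> * iexp (- (\<xi> \<bullet> x)))"
      unfolding Fourier_Re_def real_norm_def by (rule abs_Re_le_cmod)
    also have "\<dots> \<le> (LINT \<xi>|lborel. norm v * norm (complex_of_real (1 + norm \<xi>) * \<phi> \<xi>))"
      using i1 inner_le rapidly_decreasing_integrable[OF r1]
      by (intro Bochner_Integration.integral_norm_bound_integral integrable_mult_right integrable_norm)
        (auto simp: norm_mult mult.assoc[symmetric] simp del: of_real_add intro!: mult_right_mono)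
    finally show "norm (?D v) \<le> norm v * (LINT \<xi>|lborel. norm (complex_of_real (1 + norm \<xi>) * \<phi> \<xi>))"
      by simp
  qed
  show ?thesis
  proof (rule has_derivativeI_sandwich[where e=1 and H="\<lambda>y. C * norm (y - x)", OF _ lin])
    fix y :: 'n assume "y \<noteq> x"
    have pt: "cmod (\<phi> \<xi> * iexp (- (\<xi> \<bullet> y)) - \<phi> \<xi> * iexp (- (\<xi> \<bullet> x)) - - \<i> * complex_of_real (\<xi> \<bullet> (y - x)) * \<phi> \<xi> * iexp (- (\<xi> \<bullet> x)))
       \<le> (norm (y - x))\<^sup>2 * norm (complex_of_real ((1 + norm \<xi>)\<^sup>2) * \<phi> \<xi>)" for \<xi>
    proof -
      define h where "h = - (\<xi> \<bullet> (y - x))"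
      have "iexp (- (\<xi> \<bullet> y)) = iexp (- (\<xi> \<bullet> x)) * iexp h"
        by (simp add: h_def exp_add[symmetric] inner_diff_right algebra_simps)
      then have "\<phi> \<xi> * iexp (- (\<xi> \<bullet> y)) - \<phi> \<xi> * iexp (- (\<xi> \<bullet> x)) - - \<i> * complex_of_real (\<xi> \<bullet> (y - x)) * \<phi> \<xi> * iexp (- (\<xi> \<bullet> x))
         = \<phi> \<xi> * iexp (- (\<xi> \<bullet> x)) * (iexp h - (1 + \<i> * h))"
        by (simp add: h_def algebra_simps)
      moreover have "cmod (iexp h - (1 + \<i> * h)) \<le> (norm (y - x) * (1 + norm \<xi>))\<^sup>2"
      proof -
        have "cmod (iexp h - (1 + \<i> * h)) \<le> \<bar>h\<bar>\<^sup>2 / 2"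
          using iexp_approx1[of h 1] by (simp add: numeral_2_eq_2)
        moreover have "\<bar>h\<bar>\<^sup>2 \<le> (norm (y - x) * (1 + norm \<xi>))\<^sup>2"
          using inner_le[of \<xi> "y - x"] by (intro power_mono) (auto simp: h_def)
        moreover have "0 \<le> \<bar>h\<bar>\<^sup>2" by simp
        ultimately show ?thesis by linarith
      qed
      ultimately have "cmod (\<phi> \<xi> * iexp (- (\<xi> \<bullet> y)) - \<phi> \<xi> * iexp (- (\<xi> \<bullet> x)) - - \<i> * complex_of_real (\<xi> \<bullet> (y - x)) * \<phi> \<xi> * iexp (- (\<xi> \<bullet> x)))
         \<le> cmod (\<phi> \<xi>) * (norm (y - x) * (1 + norm \<xi>))\<^sup>2"
        by (simp only: norm_mult norm_exp_i_times mult_1_right) (rule mult_left_mono, simp_all only: norm_ge_zero)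
      then show ?thesis
        by (simp add: norm_mult norm_power power_mult_distrib ac_simps del: of_real_add of_real_power)
    qed
    have "norm (Fourier_Re \<phi> y - Fourier_Re \<phi> x - ?D (y - x)) = \<bar>Re (CLINT \<xi>|lborel. \<phi> \<xi> * iexp (- (\<xi> \<bullet> y)) - \<phi> \<xi> * iexp (- (\<xi> \<bullet> x)) - - \<i> * complex_of_real (\<xi> \<bullet> (y - x)) * \<phi> \<xi> * iexp (- (\<xi> \<bullet> x)))\<bar>"
      unfolding Fourier_Re_def using i0 i1
      by (subst Bochner_Integration.integral_diff) (auto intro!: Bochner_Integration.integrable_diff)
    also have "\<dots> \<le> cmod (CLINT \<xi>|lborel. \<phi> \<xi> * iexp (- (\<xi> \<bullet> y)) - \<phi> \<xi> * iexp (- (\<xi> \<bullet> x)) - - \<i> * complex_of_real (\<xi> \<bullet> (y - x)) * \<phi> \<xi> * iexp (- (\<xi> \<bullet> x)))"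
      by (rule abs_Re_le_cmod)
    also have "\<dots> \<le> (LINT \<xi>|lborel. (norm (y - x))\<^sup>2 * norm (complex_of_real ((1 + norm \<xi>)\<^sup>2) * \<phi> \<xi>))"
      using i0 i1 rapidly_decreasing_integrable[OF r2] pt
      by (intro Bochner_Integration.integral_norm_bound_integral Bochner_Integration.integrable_diff integrable_mult_right integrable_norm)
    also have "\<dots> = C * (norm (y - x))\<^sup>2" by (simp add: C_def)
    finally show "norm (Fourier_Re \<phi> y - Fourier_Re \<phi> x - ?D (y - x)) / norm (y - x) \<le> C * norm (y - x)"
      using \<open>y \<noteq> x\<close> by (simp add: pos_divide_le_eq power2_eq_square ac_simps)
  next
    show "((\<lambda>y. C * norm (y - x)) \<longlongrightarrow> 0) (at x)"
      by (auto intro!: tendsto_eq_intros)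
  qed simp
qed

text \<open>The functions \<open>Fourier_Re \<phi>\<close> with \<phi> rapidly decreasing are closed
  under directional derivatives; this family is the invariant of the coinduction.\<close>

lemma Fourier_Re_smooth:
  fixes \<phi> :: "'n::euclidean_space \<Rightarrow> complex"
  assumes "rapidly_decreasing \<phi>"
  shows "smooth_fun (Fourier_Re \<phi>)"
proof -
  show ?thesis
    using assms
  proof (coinduction arbitrary: \<phi> rule: smooth_fun.coinduct)
    case (smooth_fun \<phi>)
    then show ?case
      apply simp
      apply (rule exI[where x="\<lambda>x v. Fourier_Re (\<lambda>\<xi>. - \<i> * complex_of_real (\<xi> \<bullet> v) * \<phi> \<xi>) x"])
      using Fourier_Re_has_derivative rapidly_decreasing_mult_inner
      apply blast
      done
  qed
qed

section \<open>Gaussian mollifiers and their Fourier transforms\<close>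

definition gauss_kernel :: "real \<Rightarrow> 'n::euclidean_space \<Rightarrow> real" where
  "gauss_kernel \<sigma> x = (\<Prod>b\<in>Basis. normal_density 0 \<sigma> (x \<bullet> b))"

lemma gauss_kernel_nonneg [simp]: "0 \<le> gauss_kernel \<sigma> x"
  by (simp add: gauss_kernel_def prod_nonneg)

lemma gauss_kernel_measurable [measurable]: "gauss_kernel \<sigma> \<in> borel_measurable borel"
  unfolding gauss_kernel_def by measurable

lemma
  assumes "\<sigma> > 0"
  shows gauss_kernel_integrable: "integrable lborel (gauss_kernel \<sigma> :: 'n::euclidean_space \<Rightarrow> real)"
    and gauss_kernel_integral: "(LINT x|lborel. gauss_kernel \<sigma> (x::'n)) = 1"
proof -
  have "(\<integral>\<^sup>+x. ennreal (gauss_kernel \<sigma> x) \<partial>(lborel :: 'n measure))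
      = (\<integral>\<^sup>+x. (\<Prod>b\<in>Basis. ennreal (normal_density 0 \<sigma> (x \<bullet> b))) \<partial>(lborel :: 'n measure))"
    unfolding gauss_kernel_def by (subst prod_ennreal) auto
  also have "\<dots> = (\<Prod>b\<in>(Basis::'n set). \<integral>\<^sup>+x. ennreal (normal_density 0 \<sigma> x) \<partial>lborel)"
    by (rule nn_integral_lborel_prod[where f="\<lambda>b x. ennreal (normal_density 0 \<sigma> x)"]) auto
  also have "\<dots> = 1"
    using assms by (subst nn_integral_eq_integral) auto
  finally have nn: "(\<integral>\<^sup>+x. ennreal (gauss_kernel \<sigma> x) \<partial>(lborel :: 'n measure)) = 1" .
  then show "integrable lborel (gauss_kernel \<sigma> :: 'n \<Rightarrow> real)"
    by (simp add: integrable_iff_bounded)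
  show "(LINT x|lborel. gauss_kernel \<sigma> (x::'n)) = 1"
    by (subst integral_eq_nn_integral) (simp_all add: nn)
qed

lemma gauss_kernel_le:
  assumes "\<sigma> > 0"
  shows "gauss_kernel \<sigma> (x::'n::euclidean_space) \<le> (1 / sqrt (2 * pi * \<sigma>\<^sup>2)) ^ DIM('n)"
proof -
  have "gauss_kernel \<sigma> x \<le> (\<Prod>b\<in>(Basis::'n set). 1 / sqrt (2 * pi * \<sigma>\<^sup>2))"
    unfolding gauss_kernel_def
    by (intro prod_mono) (auto simp: normal_density_def divide_right_mono)
  then show ?thesis by (simp add: power_one_over)
qed

lemma gauss_kernel_scaleR:
  assumes "\<sigma> > 0"
  shows "\<sigma> ^ DIM('n) * gauss_kernel \<sigma> (\<sigma> *\<^sub>R (z::'n::euclidean_space)) = gauss_kernel 1 z"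
proof -
  have "\<sigma> * normal_density 0 \<sigma> (\<sigma> * t) = normal_density 0 1 t" for t
    using assms by (simp add: normal_density_def real_sqrt_mult power_mult_distrib)
  then show ?thesis
    by (simp add: gauss_kernel_def prod.distrib[symmetric] flip: prod_constant)
qed

lemma integral_gauss_kernel_affine:
  fixes f :: "'n::euclidean_space \<Rightarrow> real"
  assumes \<sigma>: "\<sigma> > 0" and [measurable]: "f \<in> borel_measurable borel"
  shows "(LINT a|lborel. f a * gauss_kernel \<sigma> (a - y)) = (LINT z|lborel. f (y + \<sigma> *\<^sub>R z) * gauss_kernel 1 z)"
proof -
  have "(LINT a|lborel. f a * gauss_kernel \<sigma> (a - y))
      = (LINT a|density (distr lborel borel (\<lambda>x. y + \<sigma> *\<^sub>R x)) (\<lambda>_. ennreal (\<bar>\<sigma>\<bar> ^ DIM('n))). f a * gauss_kernel \<sigma> (a - y))"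
    using lborel_affine[of \<sigma> y] \<sigma> by simp
  also have "\<dots> = (LINT z|lborel. f (y + \<sigma> *\<^sub>R z) * (\<sigma> ^ DIM('n) * gauss_kernel \<sigma> (\<sigma> *\<^sub>R z)))"
    using \<sigma> by (subst integral_density; simp add: integral_distr ac_simps)
  finally show ?thesis using \<sigma> by (simp add: gauss_kernel_scaleR)
qed

lemma integral_lborel_prod:
  fixes f :: "'n::euclidean_space \<Rightarrow> real \<Rightarrow> complex"
  assumes f: "\<And>b. b \<in> Basis \<Longrightarrow> integrable lborel (f b)"
  shows "(CLINT x|lborel. (\<Prod>b\<in>Basis. f b (x \<bullet> b))) = (\<Prod>b\<in>Basis. CLINT x|lborel. f b x)"
    and "integrable lborel (\<lambda>x. \<Prod>b\<in>Basis. f b (x \<bullet> b))"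
proof -
  interpret P: product_sigma_finite "\<lambda>_::'n. lborel :: real measure" ..
  have [measurable]: "\<And>b. b \<in> Basis \<Longrightarrow> f b \<in> borel_measurable borel" using f by auto
  have e: "(\<Sum>b\<in>Basis. x b *\<^sub>R b) \<bullet> c = x c" if "c \<in> Basis" for x and c :: 'n
    using that by (simp add: inner_sum_left inner_Basis if_distrib[of "\<lambda>u. _ * u"] cong: if_cong)
  show "(CLINT x|lborel. (\<Prod>b\<in>Basis. f b (x \<bullet> b))) = (\<Prod>b\<in>Basis. CLINT x|lborel. f b x)"
    by (subst lborel_eq, subst integral_distr)
      (use P.product_integral_prod[OF finite_Basis f] in \<open>auto simp: e cong: prod.cong\<close>)
  show "integrable lborel (\<lambda>x. \<Prod>b\<in>Basis. f b (x \<bullet> b))"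
    by (subst lborel_eq, subst integrable_distr_eq)
      (use P.product_integrable_prod[OF finite_Basis f] in \<open>auto simp: e cong: prod.cong\<close>)
qed

text \<open>The characteristic function of the standard normal law read backwards:
  \<open>exp (- x\<^sup>2 / 2)\<close> is a multiple of its density, and the substitution \<sigma> s
  brings in the variance.\<close>

lemma normal_density_Fourier:
  assumes \<sigma>: "\<sigma> > 0"
  shows "(CLINT s|lborel. complex_of_real (exp (- (\<sigma> * s)\<^sup>2 / 2)) * iexp (- (s * y))) = complex_of_real (2 * pi * normal_density 0 \<sigma> y)"
    and "integrable lborel (\<lambda>s. complex_of_real (exp (- (\<sigma> * s)\<^sup>2 / 2)) * iexp (- (s * y)))"
proof -
  have i: "integrable lborel (\<lambda>s. complex_of_real (std_normal_density s) * iexp (c * s))" for c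
    using integrable_mult_iexp[of lborel "\<lambda>s. complex_of_real (std_normal_density s)" "\<lambda>s. c * s"] by simp
  have ex: "exp (- x\<^sup>2 / 2) = sqrt (2 * pi) * std_normal_density x" for x :: real
    by (simp add: std_normal_density_def)
  have "(CLINT s|lborel. std_normal_density s * iexp ((- y / \<sigma>) * s)) = char std_normal_distribution (- y / \<sigma>)"
    by (simp add: char_def integral_density scaleR_conv_of_real)
  also have "\<dots> = exp (- (y / \<sigma>)\<^sup>2 / 2)"
    unfolding char_std_normal_distribution by simp
  finally have 1: "(CLINT s|lborel. std_normal_density s * iexp ((- y / \<sigma>) * s)) = exp (- (y / \<sigma>)\<^sup>2 / 2)" .
  have "(CLINT s|lborel. std_normal_density s * iexp ((- y / \<sigma>) * s))
     = \<bar>\<sigma>\<bar> *\<^sub>R (CLINT s|lborel. std_normal_density (0 + \<sigma> * s) * iexp ((- y / \<sigma>) * (0 + \<sigma> * s)))"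
    using \<sigma> by (intro lborel_integral_real_affine) auto
  also have "\<dots> = \<sigma> * (CLINT s|lborel. std_normal_density (\<sigma> * s) * iexp (- (s * y)))"
    using \<sigma> by (simp add: scaleR_conv_of_real ac_simps)
  finally have 2: "\<sigma> * (CLINT s|lborel. std_normal_density (\<sigma> * s) * iexp (- (s * y))) = exp (- (y / \<sigma>)\<^sup>2 / 2)"
    using 1 by simp
  have "(CLINT s|lborel. complex_of_real (exp (- (\<sigma> * s)\<^sup>2 / 2)) * iexp (- (s * y))) = sqrt (2 * pi) * (CLINT s|lborel. std_normal_density (\<sigma> * s) * iexp (- (s * y)))"
    unfolding ex of_real_mult mult.assoc by simp
  also have "\<dots> = complex_of_real (sqrt (2 * pi) * (exp (- (y / \<sigma>)\<^sup>2 / 2) / \<sigma>))"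
    using 2 \<sigma> by (simp add: field_simps)
  also have "sqrt (2 * pi) * (exp (- (y / \<sigma>)\<^sup>2 / 2) / \<sigma>) = (2 * pi * normal_density 0 \<sigma> y)"
    using \<sigma> by (simp add: normal_density_def real_sqrt_mult field_simps power_divide)
  finally show "(CLINT s|lborel. complex_of_real (exp (- (\<sigma> * s)\<^sup>2 / 2)) * iexp (- (s * y))) = complex_of_real (2 * pi * normal_density 0 \<sigma> y)" .
  have "integrable lborel (\<lambda>s. complex_of_real (std_normal_density (0 + \<sigma> * s)) * iexp ((- y / \<sigma>) * (0 + \<sigma> * s)))"
    using \<sigma> by (intro lborel_integrable_real_affine i) auto
  then have "integrable lborel (\<lambda>s. complex_of_real (sqrt (2 * pi)) * (complex_of_real (std_normal_density (\<sigma> * s)) * iexp (- (s * y))))"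
    using \<sigma> by (intro integrable_mult_right) (simp add: ac_simps)
  then show "integrable lborel (\<lambda>s. complex_of_real (exp (- (\<sigma> * s)\<^sup>2 / 2)) * iexp (- (s * y)))"
    unfolding ex of_real_mult mult.assoc .
qed

lemma gauss_kernel_Fourier:
  fixes y :: "'n::euclidean_space"
  assumes \<sigma>: "\<sigma> > 0"
  shows "(CLINT \<xi>|lborel. complex_of_real (exp (- (\<sigma> * norm \<xi>)\<^sup>2 / 2)) * iexp (- (\<xi> \<bullet> y))) = complex_of_real ((2 * pi) ^ DIM('n) * gauss_kernel \<sigma> y)"
    and "integrable lborel (\<lambda>\<xi>. complex_of_real (exp (- (\<sigma> * norm \<xi>)\<^sup>2 / 2)) * iexp (- (\<xi> \<bullet> y)))"
proof -
  have e: "complex_of_real (exp (- (\<sigma> * norm \<xi>)\<^sup>2 / 2)) * iexp (- (\<xi> \<bullet> y))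
    = (\<Prod>b\<in>Basis. complex_of_real (exp (- (\<sigma> * (\<xi> \<bullet> b))\<^sup>2 / 2)) * iexp (- ((\<xi> \<bullet> b) * (y \<bullet> b))))" for \<xi> :: 'n
  proof -
    have "(\<sigma> * norm \<xi>)\<^sup>2 = (\<Sum>b\<in>Basis. (\<sigma> * (\<xi> \<bullet> b))\<^sup>2)"
      unfolding power_mult_distrib sum_distrib_left[symmetric] power2_norm_eq_inner
      by (subst euclidean_inner) (simp add: power2_eq_square)
    then have "exp (- (\<sigma> * norm \<xi>)\<^sup>2 / 2) = (\<Prod>b\<in>Basis. exp (- (\<sigma> * (\<xi> \<bullet> b))\<^sup>2 / 2))"
      by (subst exp_sum[symmetric]) (auto simp: sum_negf sum_divide_distrib)
    moreover have "iexp (- (\<xi> \<bullet> y)) = (\<Prod>b\<in>Basis. iexp (- ((\<xi> \<bullet> b) * (y \<bullet> b))))"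
      by (subst exp_sum[symmetric]) (auto simp: euclidean_inner[of \<xi> y] sum_negf sum_distrib_left)
    ultimately show ?thesis by (simp add: prod.distrib)
  qed
  show "(CLINT \<xi>|lborel. complex_of_real (exp (- (\<sigma> * norm \<xi>)\<^sup>2 / 2)) * iexp (- (\<xi> \<bullet> y))) = complex_of_real ((2 * pi) ^ DIM('n) * gauss_kernel \<sigma> y)"
  proof -
    have "(CLINT \<xi>|lborel. complex_of_real (exp (- (\<sigma> * norm \<xi>)\<^sup>2 / 2)) * iexp (- (\<xi> \<bullet> y)))
       = (\<Prod>b\<in>Basis. CLINT t|lborel. complex_of_real (exp (- (\<sigma> * t)\<^sup>2 / 2)) * iexp (- (t * (y \<bullet> b))))"
      unfolding e using \<sigma>
      by (intro integral_lborel_prod(1)[where f="\<lambda>b t. complex_of_real (exp (- (\<sigma> * t)\<^sup>2 / 2)) * iexp (- (t * (y \<bullet> b)))"] normal_density_Fourier(2))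
    also have "\<dots> = (\<Prod>b\<in>Basis. complex_of_real (2 * pi * normal_density 0 \<sigma> (y \<bullet> b)))"
      by (intro prod.cong refl normal_density_Fourier(1) \<sigma>)
    also have "\<dots> = complex_of_real ((2 * pi) ^ DIM('n) * gauss_kernel \<sigma> y)"
      by (simp add: gauss_kernel_def prod.distrib power_mult_distrib)
    finally show ?thesis .
  qed
  show "integrable lborel (\<lambda>\<xi>. complex_of_real (exp (- (\<sigma> * norm \<xi>)\<^sup>2 / 2)) * iexp (- (\<xi> \<bullet> y)))"
    unfolding e using \<sigma>
    by (intro integral_lborel_prod(2)[where f="\<lambda>b t. complex_of_real (exp (- (\<sigma> * t)\<^sup>2 / 2)) * iexp (- (t * (y \<bullet> b)))"] normal_density_Fourier(2))
qed

text \<open>The left side is the density at \<open>a\<close> of \<open>Y\<close> plus an independent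
  centered Gaussian vector with standard deviation \<sigma>. The Gaussian factor makes the double
  integral absolutely convergent, so Fubini applies before anything is known about the decay of the
  characteristic function of \<open>Y\<close>.\<close>

lemma smoothed_density_Fourier:
  fixes Y :: "'a \<Rightarrow> 'n::euclidean_space"
  assumes "prob_space M" and [measurable]: "Y \<in> borel_measurable M" and \<sigma>: "\<sigma> > 0"
  shows "(LINT \<omega>|M. gauss_kernel \<sigma> (a - Y \<omega>))
    = Fourier_Re (\<lambda>\<xi>. complex_of_real (1 / (2 * pi) ^ DIM('n) * exp (- (\<sigma> * norm \<xi>)\<^sup>2 / 2)) * (CLINT \<omega>|M. iexp (\<xi> \<bullet> Y \<omega>))) a"
proof -
  interpret M: prob_space M by fact
  interpret pair_sigma_finite lborel M ..
  let ?c = "(2 * pi) ^ DIM('n)"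
  let ?e = "\<lambda>\<xi>::'n. exp (- (\<sigma> * norm \<xi>)\<^sup>2 / 2)"
  have ie: "integrable lborel ?e"
  proof -
    have "integrable lborel (\<lambda>\<xi>::'n. norm (complex_of_real (exp (- (\<sigma> * norm \<xi>)\<^sup>2 / 2)) * iexp (- (\<xi> \<bullet> 0))))"
      by (intro integrable_norm gauss_kernel_Fourier \<sigma>)
    then show ?thesis by simp
  qed
  have int: "integrable (lborel \<Otimes>\<^sub>M M) (\<lambda>(\<xi>, \<omega>). ?e \<xi> * iexp (- (\<xi> \<bullet> (a - Y \<omega>))))"
    by (rule Fubini_integrable)
      (auto simp: norm_mult M.prob_space ie[simplified] intro!: M.integrable_const_bound[where B="?e _" for \<xi>] simp del: of_real_minus of_real_diff)
  have "?c * complex_of_real (LINT \<omega>|M. gauss_kernel \<sigma> (a - Y \<omega>)) = (CLINT \<omega>|M. ?c * gauss_kernel \<sigma> (a - Y \<omega>))"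
    by simp
  also have "\<dots> = (CLINT \<omega>|M. CLINT \<xi>|lborel. ?e \<xi> * iexp (- (\<xi> \<bullet> (a - Y \<omega>))))"
    using gauss_kernel_Fourier(1)[OF \<sigma>, where 'n='n] by simp
  also have "\<dots> = (CLINT \<xi>|lborel. CLINT \<omega>|M. ?e \<xi> * iexp (- (\<xi> \<bullet> (a - Y \<omega>))))"
    by (rule Fubini_integral[OF int])
  also have "\<dots> = (CLINT \<xi>|lborel. ?e \<xi> * (CLINT \<omega>|M. iexp (\<xi> \<bullet> Y \<omega>)) * iexp (- (\<xi> \<bullet> a)))"
  proof (intro Bochner_Integration.integral_cong refl)
    fix \<xi>
    have "(\<lambda>\<omega>. ?e \<xi> * iexp (- (\<xi> \<bullet> (a - Y \<omega>)))) = (\<lambda>\<omega>. (?e \<xi> * iexp (- (\<xi> \<bullet> a))) * iexp (\<xi> \<bullet> Y \<omega>))"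
      by (auto simp: inner_diff_right exp_add[symmetric] algebra_simps)
    then show "(CLINT \<omega>|M. ?e \<xi> * iexp (- (\<xi> \<bullet> (a - Y \<omega>)))) = ?e \<xi> * (CLINT \<omega>|M. iexp (\<xi> \<bullet> Y \<omega>)) * iexp (- (\<xi> \<bullet> a))"
      by (simp only: integral_mult_right_zero) (simp only: ac_simps)
  qed
  finally have "complex_of_real (LINT \<omega>|M. gauss_kernel \<sigma> (a - Y \<omega>))
     = 1 / ?c * (CLINT \<xi>|lborel. ?e \<xi> * (CLINT \<omega>|M. iexp (\<xi> \<bullet> Y \<omega>)) * iexp (- (\<xi> \<bullet> a)))"
    by (simp add: field_simps)
  also have "\<dots> = (CLINT \<xi>|lborel. complex_of_real (1 / ?c * ?e \<xi>) * (CLINT \<omega>|M. iexp (\<xi> \<bullet> Y \<omega>)) * iexp (- (\<xi> \<bullet> a)))"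
    unfolding integral_mult_right_zero[symmetric] by (simp add: ac_simps)
  finally show ?thesis unfolding Fourier_Re_def by (metis Re_complex_of_real)
qed

lemma Fourier_Re_tendsto:
  assumes \<phi>: "integrable lborel \<phi>" and [measurable]: "\<And>n. w n \<in> borel_measurable borel"
    and w: "\<And>n \<xi>. \<bar>w n \<xi>\<bar> \<le> 1" "\<And>\<xi>. (\<lambda>n. w n \<xi>) \<longlonglongrightarrow> 1"
  shows "(\<lambda>n. Fourier_Re (\<lambda>\<xi>. complex_of_real (w n \<xi>) * \<phi> \<xi>) x) \<longlonglongrightarrow> Fourier_Re \<phi> x"
  unfolding Fourier_Re_def
proof (intro tendsto_Re integral_dominated_convergence[where w="\<lambda>\<xi>. cmod (\<phi> \<xi>)"] AE_I2)
  have [measurable]: "\<phi> \<in> borel_measurable borel" using \<phi> by auto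
  show "(\<lambda>\<xi>. \<phi> \<xi> * iexp (- (\<xi> \<bullet> x))) \<in> borel_measurable lborel"
    "(\<lambda>\<xi>. complex_of_real (w n \<xi>) * \<phi> \<xi> * iexp (- (\<xi> \<bullet> x))) \<in> borel_measurable lborel" for n
    by simp_all
  show "integrable lborel (\<lambda>\<xi>. cmod (\<phi> \<xi>))" using \<phi> by simp
  show "cmod (complex_of_real (w n \<xi>) * \<phi> \<xi> * iexp (- (\<xi> \<bullet> x))) \<le> cmod (\<phi> \<xi>)" for n \<xi>
    using w(1)[of n \<xi>] by (simp add: norm_mult mult_left_le_one_le del: of_real_minus)
  have "(\<lambda>n. complex_of_real (w n \<xi>)) \<longlonglongrightarrow> complex_of_real 1" for \<xi>
    using w(2) by (rule tendsto_of_real)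
  then have "(\<lambda>n. complex_of_real (w n \<xi>) * \<phi> \<xi> * iexp (- (\<xi> \<bullet> x))) \<longlonglongrightarrow> complex_of_real 1 * \<phi> \<xi> * iexp (- (\<xi> \<bullet> x))" for \<xi>
    by (intro tendsto_mult tendsto_const)
  then show "(\<lambda>n. complex_of_real (w n \<xi>) * \<phi> \<xi> * iexp (- (\<xi> \<bullet> x))) \<longlonglongrightarrow> \<phi> \<xi> * iexp (- (\<xi> \<bullet> x))" for \<xi>
    by simp
qed

lemma abs_Fourier_Re_le:
  "\<bar>Fourier_Re \<phi> x\<bar> \<le> (LINT \<xi>|lborel. cmod (\<phi> \<xi>))"
proof -
  have "\<bar>Fourier_Re \<phi> x\<bar> \<le> cmod (CLINT \<xi>|lborel. \<phi> \<xi> * iexp (- (\<xi> \<bullet> x)))"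
    unfolding Fourier_Re_def by (rule abs_Re_le_cmod)
  also have "\<dots> \<le> (LINT \<xi>|lborel. cmod (\<phi> \<xi> * iexp (- (\<xi> \<bullet> x))))"
    by (rule integral_norm_bound)
  finally show ?thesis by (simp add: norm_mult del: of_real_minus)
qed

text \<open>Open boxes generate the Borel sets and are stable under intersection. The indicator of a
  box is the limit of the continuous functions \<open>min 1 (k * infdist x (- box a b))\<close>, all
  supported in the box, so dominated convergence applies on both sides; the majorant on the Lebesgue
  side is \<open>C\<close> times the indicator.\<close>

lemma measure_eqI_continuous:
  fixes N :: "'n::euclidean_space measure" and p :: "'n \<Rightarrow> real"
  assumes "prob_space N" and sets_N: "sets N = sets borel" and p0: "\<And>x. 0 \<le> p x" and pC: "\<And>x. p x \<le> C"
    and [measurable]: "p \<in> borel_measurable borel"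
    and eq: "\<And>\<psi> R. continuous_on UNIV \<psi> \<Longrightarrow> (\<And>x. 0 \<le> \<psi> x) \<Longrightarrow> (\<And>x. \<psi> x \<le> 1) \<Longrightarrow> (\<And>x. \<psi> x \<noteq> 0 \<Longrightarrow> norm x \<le> R) \<Longrightarrow>
      (LINT x|N. \<psi> x) = (LINT x|lborel. \<psi> x * p x)"
  shows "N = density lborel p"
proof -
  interpret N: prob_space N by fact
  note sets_N[measurable_cong]
  have box: "emeasure N (box a b) = emeasure (density lborel p) (box a b)" for a b
  proof -
    define \<psi> where "\<psi> k x = min 1 (real k * infdist x (- box a b))" for k x
    \<comment> \<open>\<open>infdist\<close> to the empty set is 0 by convention, so detecting
      membership in the closed complement by distance requires it to be nonempty.\<close>
    have ne: "- box a b \<noteq> {}"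
      by (metis bounded_box not_bounded_UNIV double_complement Compl_empty_eq)
    have cont: "continuous_on UNIV (\<psi> k)" for k
      unfolding \<psi>_def by (intro continuous_intros)
    have [measurable]: "\<psi> k \<in> borel_measurable borel" for k
      by (rule borel_measurable_continuous_onI[OF cont])
    have \<psi>_out: "\<psi> k x = 0" if "x \<notin> box a b" for k x
      using that ne by (simp add: \<psi>_def)
    have \<psi>01: "0 \<le> \<psi> k x" "\<psi> k x \<le> 1" for k x
      by (simp_all add: \<psi>_def infdist_nonneg)
    have lim: "(\<lambda>k. \<psi> k x) \<longlonglongrightarrow> indicator (box a b) x" for x
    proof (cases "x \<in> box a b")
      case False
      then show ?thesis by (simp add: \<psi>_out)
    next
      case True
      then have d: "infdist x (- box a b) > 0"
        using ne in_closed_iff_infdist_zero[of "- box a b" x] infdist_nonneg[of x "- box a b"]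
        by (auto simp: closed_Compl open_box less_le)
      obtain K where K: "1 < real K * infdist x (- box a b)"
        using reals_Archimedean3[OF d] by blast
      have "eventually (\<lambda>k. \<psi> k x = 1) sequentially"
        using eventually_ge_at_top[of K]
      proof eventually_elim
        case (elim k)
        then have "real K * infdist x (- box a b) \<le> real k * infdist x (- box a b)"
          using d by (intro mult_right_mono) auto
        then show ?case using K by (simp add: \<psi>_def)
      qed
      then show ?thesis using True by (simp add: tendsto_eventually)
    qed
    obtain R where R: "\<And>x. x \<in> box a b \<Longrightarrow> norm x \<le> R"
      using bounded_box[of a b] unfolding bounded_iff by blast
    have e: "(LINT x|N. \<psi> k x) = (LINT x|lborel. \<psi> k x * p x)" for k
      by (rule eq[OF cont \<psi>01, where R=R]) (use \<psi>_out R in blast)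
    have "(\<lambda>k. LINT x|N. \<psi> k x) \<longlonglongrightarrow> (LINT x|N. indicator (box a b) x)"
      by (rule integral_dominated_convergence[where w="\<lambda>_. 1"]) (use lim \<psi>01 in \<open>auto\<close>)
    moreover
    have ib: "integrable lborel (\<lambda>x. C * indicator (box a b) x)"
      by (intro integrable_mult_right integrable_real_indicator) (auto simp: emeasure_lborel_box_eq)
    have bd: "norm (\<psi> k x * p x) \<le> C * indicator (box a b) x" for k x
      using \<psi>_out[of x k] \<psi>01[of k x] p0[of x] pC[of x]
      by (auto simp: indicator_def abs_mult intro: order_trans[OF mult_left_le_one_le])
    have "(\<lambda>k. LINT x|lborel. \<psi> k x * p x) \<longlonglongrightarrow> (LINT x|lborel. indicator (box a b) x * p x)"
      using ib bd by (intro integral_dominated_convergence[where w="\<lambda>x. C * indicator (box a b) x"] AE_I2 tendsto_mult lim tendsto_const) auto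
    ultimately have *: "(LINT x|N. indicator (box a b) x) = (LINT x|lborel. indicator (box a b) x * p x)"
      using LIMSEQ_unique unfolding e by blast
    have "integrable lborel (\<lambda>x. indicator (box a b) x * p x)"
      by (rule Bochner_Integration.integrable_bound[OF ib]) (use p0 pC in \<open>auto simp: indicator_def intro!: AE_I2 order_trans[OF pC abs_ge_self]\<close>)
    then have "emeasure (density lborel p) (box a b) = ennreal (LINT x|lborel. indicator (box a b) x * p x)"
      using p0 by (subst nn_integral_eq_integral[symmetric]) (auto simp: emeasure_density ennreal_mult' ennreal_indicator ac_simps)
    also have "\<dots> = emeasure N (box a b)"
      using *[symmetric] by (simp add: N.emeasure_eq_measure sets_N)
    finally show ?thesis by simp
  qed
  show ?thesis
  proof (rule measure_eqI_generator_eq)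
    let ?E = "range (\<lambda>(a, b). box a b::'n set)"
    show "Int_stable ?E"
      by (auto simp: Int_stable_def box_Int_box)
    show "?E \<subseteq> Pow UNIV" "sets N = sigma_sets UNIV ?E" "sets (density lborel p) = sigma_sets UNIV ?E"
      by (simp_all add: borel_eq_box sets_N)
    let ?A = "\<lambda>n::nat. box (- (real n *\<^sub>R One)) (real n *\<^sub>R One) :: 'n set"
    show "range ?A \<subseteq> ?E" "(\<Union>i. ?A i) = UNIV"
      unfolding UN_box_eq_UNIV by auto
    show "emeasure N (?A i) \<noteq> \<infinity>" for i by auto
    show "emeasure N X = emeasure (density lborel p) X" if "X \<in> ?E" for X
      using that box by auto
  qed
qed

text \<open>The mollified densities \<open>q n\<close> have two limits. On the Fourier side they
  converge pointwise to \<open>p\<close> and stay below the constant \<open>C\<close>; as laws they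
  converge weakly to the law of \<open>Y\<close>. Testing against continuous functions of bounded
  support identifies the two limits.\<close>

theorem smooth_density_of_rapidly_decreasing_char:
  fixes Y :: "'a \<Rightarrow> 'n::euclidean_space"
  assumes "prob_space M" and Y[measurable]: "Y \<in> borel_measurable M"
    and rapid: "rapidly_decreasing (\<lambda>\<xi>. CLINT \<omega>|M. iexp (\<xi> \<bullet> Y \<omega>))"
  shows "\<exists>p. (\<forall>x. 0 \<le> p x) \<and> smooth_fun p \<and> distributed M lborel Y (\<lambda>x. ennreal (p x))"
proof -
  interpret M: prob_space M by fact
  let ?\<phi> = "\<lambda>\<xi>. complex_of_real (1 / (2 * pi) ^ DIM('n)) * (CLINT \<omega>|M. iexp (\<xi> \<bullet> Y \<omega>))"
  define p where "p = Fourier_Re ?\<phi>"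
  define s where "s n = inverse (real (Suc n))" for n
  define q where "q n a = (LINT \<omega>|M. gauss_kernel (s n) (a - Y \<omega>))" for n a
  define C where "C = (LINT \<xi>|lborel. cmod (?\<phi> \<xi>))"
  have s: "s n > 0" for n by (simp add: s_def)
  have s0: "s \<longlonglongrightarrow> 0" unfolding s_def by (rule LIMSEQ_inverse_real_of_nat)
  have rphi: "rapidly_decreasing ?\<phi>"
    by (rule rapidly_decreasing_mult[OF rapid, where k=0 and K="1 / (2 * pi) ^ DIM('n)"]) (auto simp: norm_divide norm_mult norm_power)
  then have iphi: "integrable lborel ?\<phi>" by (rule rapidly_decreasing_integrable)
  have qF: "q n a = Fourier_Re (\<lambda>\<xi>. complex_of_real (exp (- (s n * norm \<xi>)\<^sup>2 / 2)) * ?\<phi> \<xi>) a" for n a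
    unfolding q_def smoothed_density_Fourier[OF \<open>prob_space M\<close> Y s]
    by (rule arg_cong[where f="\<lambda>f. Fourier_Re f a"]) (simp add: ac_simps)
  have lim: "(\<lambda>n. q n a) \<longlonglongrightarrow> p a" for a
    unfolding qF p_def
  proof (rule Fourier_Re_tendsto[OF iphi])
    show "(\<lambda>n. exp (- (s n * norm \<xi>)\<^sup>2 / 2)) \<longlonglongrightarrow> 1" for \<xi> :: 'n
      by (rule tendsto_eq_rhs, (rule tendsto_intros s0)+) (auto)
  qed auto
  have q0: "q n a \<ge> 0" for n a unfolding q_def by (intro integral_nonneg_AE) auto
  then have p0: "p a \<ge> 0" for a using LIMSEQ_le_const[OF lim, of 0] by blast
  have qC: "\<bar>q n a\<bar> \<le> C" for n a
  proof -
    have "\<bar>q n a\<bar> \<le> (LINT \<xi>|lborel. cmod (complex_of_real (exp (- (s n * norm \<xi>)\<^sup>2 / 2)) * ?\<phi> \<xi>))"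
      unfolding qF by (rule abs_Fourier_Re_le)
    also have "\<dots> \<le> C" unfolding C_def
    proof (rule integral_mono')
      show "integrable lborel (\<lambda>\<xi>. cmod (?\<phi> \<xi>))" using iphi by (rule integrable_norm)
      fix \<xi> :: 'n
      have "\<bar>exp (- (s n * norm \<xi>)\<^sup>2 / 2)\<bar> \<le> 1" by simp
      then show "cmod (complex_of_real (exp (- (s n * norm \<xi>)\<^sup>2 / 2)) * ?\<phi> \<xi>) \<le> cmod (?\<phi> \<xi>)"
        by (subst norm_mult) (simp add: mult_left_le_one_le)
    qed auto
    finally show ?thesis .
  qed
  have pC: "p a \<le> C" for a
    using qC[of _ a] lim[of a] by (intro LIMSEQ_le_const2[OF lim]) (auto simp: abs_le_iff)
  have smooth: "smooth_fun p" unfolding p_def by (rule Fourier_Re_smooth[OF rphi])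
  have "continuous_on UNIV p"
    unfolding p_def using Fourier_Re_has_derivative[OF rphi]
    by (meson continuous_at_imp_continuous_on has_derivative_continuous)
  then have pm[measurable]: "p \<in> borel_measurable borel" by (rule borel_measurable_continuous_onI)
  have qm[measurable]: "q n \<in> borel_measurable borel" for n
    unfolding q_def by measurable
  have D: "distr M borel Y = density lborel p"
  proof (rule measure_eqI_continuous[OF M.prob_space_distr[OF Y] _ p0 pC pm])
    fix \<psi> :: "'n \<Rightarrow> real" and R
    assume cont: "continuous_on UNIV \<psi>" and \<psi>01: "\<And>x. 0 \<le> \<psi> x" "\<And>x. \<psi> x \<le> 1"
      and R: "\<And>x. \<psi> x \<noteq> 0 \<Longrightarrow> norm x \<le> R"
    have \<psi>m[measurable]: "\<psi> \<in> borel_measurable borel" by (rule borel_measurable_continuous_onI[OF cont])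
    have i\<psi>: "integrable lborel \<psi>"
    proof (rule Bochner_Integration.integrable_bound)
      show "integrable lborel (indicator (cball 0 R) :: 'n \<Rightarrow> real)"
        by (intro integrable_real_indicator) (auto intro: emeasure_bounded_finite[unfolded infinity_ennreal_def])
      show "AE x in lborel. norm (\<psi> x) \<le> norm (indicator (cball 0 R) x :: real)"
        using \<psi>01 R by (intro AE_I2) (auto simp: indicator_def, metis order_refl)
    qed simp
    have c1: "(\<lambda>n. LINT a|lborel. \<psi> a * q n a) \<longlonglongrightarrow> (LINT a|lborel. \<psi> a * p a)"
      using i\<psi> qC \<psi>01
      by (intro integral_dominated_convergence[where w="\<lambda>a. \<psi> a * C"] AE_I2 tendsto_mult lim tendsto_const)
        (auto simp: abs_mult intro!: mult_left_mono)
    \<comment> \<open>Fubini and a change of variables move the mollification from the law of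
      \<open>Y\<close> onto the continuous test function \<psi>, where letting \<open>s n\<close>
      tend to 0 is harmless.\<close>
    have c2: "(LINT a|lborel. \<psi> a * q n a) = (LINT \<omega>|M. LINT z|lborel. \<psi> (Y \<omega> + s n *\<^sub>R z) * gauss_kernel 1 z)" for n
    proof -
      interpret pair_sigma_finite lborel M ..
      define G where "G = (1 / sqrt (2 * pi * (s n)\<^sup>2)) ^ DIM('n)"
      have G: "gauss_kernel (s n) x \<le> G" for x :: 'n unfolding G_def by (rule gauss_kernel_le[OF s])
      have G0: "0 \<le> G" using G[of 0] gauss_kernel_nonneg[of "s n" "0::'n"] by linarith
      have "(LINT a|lborel. \<psi> a * q n a) = (LINT a|lborel. LINT \<omega>|M. \<psi> a * gauss_kernel (s n) (a - Y \<omega>))"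
        unfolding q_def by simp
      also have "\<dots> = (LINT \<omega>|M. LINT a|lborel. \<psi> a * gauss_kernel (s n) (a - Y \<omega>))"
      proof (rule Fubini_integral[symmetric], rule Fubini_integrable, goal_cases)
        case 2
        have "norm (LINT \<omega>|M. norm (\<psi> a * gauss_kernel (s n) (a - Y \<omega>))) \<le> norm (\<psi> a * G)" for a
        proof -
          have "(LINT \<omega>|M. norm (\<psi> a * gauss_kernel (s n) (a - Y \<omega>))) \<le> (LINT \<omega>|M. \<psi> a * G)"
            by (rule integral_mono') (use \<psi>01 G G0 in \<open>auto simp: abs_mult intro!: mult_left_mono\<close>)
          then show ?thesis using \<psi>01 G0 by (simp add: M.prob_space)
        qed
        moreover have "integrable lborel (\<lambda>a. \<psi> a * G)" using i\<psi> by (rule integrable_mult_left)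
        moreover have "(\<lambda>a. LINT \<omega>|M. norm (\<psi> a * gauss_kernel (s n) (a - Y \<omega>))) \<in> borel_measurable lborel"
          by measurable
        ultimately have "integrable lborel (\<lambda>a. LINT \<omega>|M. norm (\<psi> a * gauss_kernel (s n) (a - Y \<omega>)))"
          by (rule_tac Bochner_Integration.integrable_bound[where f="\<lambda>a. \<psi> a * G"]) (assumption, assumption, rule AE_I2, assumption)
        then show ?case by simp
      next
        case 3
        have "integrable M (\<lambda>\<omega>. \<psi> a * gauss_kernel (s n) (a - Y \<omega>))" for a
        proof (rule M.integrable_const_bound[where B=G])
          have "\<bar>\<psi> a\<bar> * \<bar>gauss_kernel (s n) x\<bar> \<le> 1 * G" for x :: 'n
            using \<psi>01[of a] G[of x] by (intro mult_mono) auto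
          then show "AE \<omega> in M. norm (\<psi> a * gauss_kernel (s n) (a - Y \<omega>)) \<le> G"
            by (simp add: abs_mult)
        qed simp
        then show ?case by simp
      qed simp
      also have "\<dots> = (LINT \<omega>|M. LINT z|lborel. \<psi> (Y \<omega> + s n *\<^sub>R z) * gauss_kernel 1 z)"
        by (intro Bochner_Integration.integral_cong refl integral_gauss_kernel_affine s) simp
      finally show ?thesis .
    qed
    have c3: "(\<lambda>n. LINT \<omega>|M. LINT z|lborel. \<psi> (Y \<omega> + s n *\<^sub>R z) * gauss_kernel 1 z) \<longlonglongrightarrow> (LINT \<omega>|M. \<psi> (Y \<omega>))"
    proof (intro integral_dominated_convergence[where w="\<lambda>_. 1"] AE_I2)
      note g1 = gauss_kernel_integrable[of 1, where 'n='n] gauss_kernel_integral[of 1, where 'n='n]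
      have bd: "norm (\<psi> x * gauss_kernel 1 z) \<le> gauss_kernel 1 z" for x z :: 'n
        using \<psi>01[of x] by (auto simp: abs_mult intro!: mult_left_le_one_le)
      fix \<omega>
      have "(\<lambda>n. LINT z|lborel. \<psi> (Y \<omega> + s n *\<^sub>R z) * gauss_kernel 1 z) \<longlonglongrightarrow> (LINT z|lborel. \<psi> (Y \<omega> + 0 *\<^sub>R z) * gauss_kernel 1 z)"
      proof (intro integral_dominated_convergence[where w="gauss_kernel 1"] AE_I2 tendsto_mult tendsto_const)
        have "(\<lambda>n. Y \<omega> + s n *\<^sub>R z) \<longlonglongrightarrow> Y \<omega> + 0 *\<^sub>R z" for z
          by (intro tendsto_intros s0)
        then show "(\<lambda>n. \<psi> (Y \<omega> + s n *\<^sub>R z)) \<longlonglongrightarrow> \<psi> (Y \<omega> + 0 *\<^sub>R z)" for z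
          by (rule continuous_on_tendsto_compose[OF cont]) auto
      qed (use g1 bd in auto)
      then show "(\<lambda>n. LINT z|lborel. \<psi> (Y \<omega> + s n *\<^sub>R z) * gauss_kernel 1 z) \<longlonglongrightarrow> \<psi> (Y \<omega>)"
        using g1 by simp
      fix n
      have "norm (LINT z|lborel. \<psi> (Y \<omega> + s n *\<^sub>R z) * gauss_kernel 1 z) \<le> (LINT z|lborel. gauss_kernel 1 (z::'n))"
        using g1 bd by (intro Bochner_Integration.integral_norm_bound_integral Bochner_Integration.integrable_bound[OF g1(1)]) (auto intro: order_trans[OF _ abs_ge_self])
      then show "norm (LINT z|lborel. \<psi> (Y \<omega> + s n *\<^sub>R z) * gauss_kernel 1 z) \<le> 1"
        using g1 by simp
    qed auto
    have "(LINT \<omega>|M. \<psi> (Y \<omega>)) = (LINT a|lborel. \<psi> a * p a)"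
      by (rule LIMSEQ_unique[OF c3 c1[unfolded c2]])
    then show "(LINT x|distr M borel Y. \<psi> x) = (LINT a|lborel. \<psi> a * p a)"
      by (simp add: integral_distr)
  qed simp
  have "distributed M lborel Y (\<lambda>x. ennreal (p x))"
    unfolding distributed_def using D by (auto cong: distr_cong)
  with p0 smooth show ?thesis by blast
qed

subsection \<open>Bilinear functionals of a pair of Gaussian vectors\<close>

text \<open>Completing the square: the weight multiplies the standard density into a Gaussian of
  precision \<open>\<sigma>\<^sup>2 = 1 + c\<close>. With \<open>c = 0\<close> the formula
  linearises a square in an exponent; with \<open>p = 0\<close> it yields the decay factor
  \<open>1 / sqrt (1 + c)\<close>.\<close>

lemma integral_std_normal_exp_iexp:
  assumes "0 \<le> c"
  shows "(CLINT z|std_normal_distribution. complex_of_real (exp (- c * z\<^sup>2 / 2)) * iexp (z * p))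
    = complex_of_real (exp (- p\<^sup>2 / (2 * (1 + c))) / sqrt (1 + c))"
proof -
  define \<sigma> where "\<sigma> = sqrt (1 + c)"
  have \<sigma>: "\<sigma> > 0" "\<sigma>\<^sup>2 = 1 + c" using assms by (auto simp: \<sigma>_def)
  have "std_normal_density z * exp (- c * z\<^sup>2 / 2) = exp (- (\<sigma> * z)\<^sup>2 / 2) / sqrt (2 * pi)" for z
    unfolding power_mult_distrib \<sigma>(2) by (simp add: std_normal_density_def exp_add[symmetric] field_simps)
  then have e: "complex_of_real (std_normal_density z) * (complex_of_real (exp (- c * z\<^sup>2 / 2)) * iexp (z * p))
    = complex_of_real (1 / sqrt (2 * pi)) * (complex_of_real (exp (- (\<sigma> * z)\<^sup>2 / 2)) * iexp (- (z * - p)))" for z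
    unfolding mult.assoc[symmetric] of_real_mult[symmetric] by simp
  have "(CLINT z|std_normal_distribution. complex_of_real (exp (- c * z\<^sup>2 / 2)) * iexp (z * p))
    = (CLINT z|lborel. complex_of_real (std_normal_density z) * (complex_of_real (exp (- c * z\<^sup>2 / 2)) * iexp (z * p)))"
    by (simp add: integral_density scaleR_conv_of_real)
  also have "\<dots> = complex_of_real (1 / sqrt (2 * pi)) * complex_of_real (2 * pi * normal_density 0 \<sigma> (- p))"
    unfolding e integral_mult_right_zero normal_density_Fourier(1)[OF \<sigma>(1)] ..
  also have "\<dots> = complex_of_real (exp (- p\<^sup>2 / (2 * \<sigma>\<^sup>2)) / \<sigma>)"
    unfolding of_real_mult[symmetric] using \<sigma>(1)
    by (intro arg_cong[where f=complex_of_real]) (simp add: normal_density_def real_sqrt_mult field_simps)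
  finally show ?thesis unfolding \<sigma>(2) by (simp add: \<sigma>_def)
qed

abbreviation std_normal_PiM :: "'b set \<Rightarrow> ('b \<Rightarrow> real) measure" where
  "std_normal_PiM B \<equiv> \<Pi>\<^sub>M b\<in>B. std_normal_distribution"

lemma prob_space_std_normal: "prob_space std_normal_distribution"
  by (intro prob_space_normal_density) simp

lemma prob_space_std_normal_PiM: "prob_space (std_normal_PiM B)"
  by (intro prob_space_PiM prob_space_std_normal)

lemma std_normal_PiM_integral_exp_iexp:
  assumes "finite B" "0 \<le> c"
  shows "(CLINT z|std_normal_PiM B. complex_of_real (exp (- c * (\<Sum>b\<in>B. (z b)\<^sup>2) / 2)) * iexp (\<Sum>b\<in>B. z b * x b))
    = complex_of_real (exp (- (\<Sum>b\<in>B. (x b)\<^sup>2) / (2 * (1 + c))) / sqrt (1 + c) ^ card B)"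
proof -
  interpret N: prob_space std_normal_distribution by (rule prob_space_std_normal)
  interpret product_sigma_finite "\<lambda>_. std_normal_distribution" ..
  have e: "complex_of_real (exp (- c * (\<Sum>b\<in>B. (z b)\<^sup>2) / 2)) * iexp (\<Sum>b\<in>B. z b * x b)
    = (\<Prod>b\<in>B. complex_of_real (exp (- c * (z b)\<^sup>2 / 2)) * iexp (z b * x b))" for z
    using assms(1)
    by (simp add: prod.distrib exp_sum[symmetric] sum_distrib_left sum_divide_distrib sum_negf flip: of_real_prod)
  have "integrable std_normal_distribution (\<lambda>z. complex_of_real (exp (- c * z\<^sup>2 / 2)) * iexp (z * p))" for p
    using assms(2) by (intro N.integrable_const_bound[where B=1]) (auto simp: norm_mult simp del: of_real_mult of_real_minus)
  then have "(CLINT z|std_normal_PiM B. complex_of_real (exp (- c * (\<Sum>b\<in>B. (z b)\<^sup>2) / 2)) * iexp (\<Sum>b\<in>B. z b * x b))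
    = (\<Prod>b\<in>B. CLINT z|std_normal_distribution. complex_of_real (exp (- c * z\<^sup>2 / 2)) * iexp (z * x b))"
    unfolding e by (intro product_integral_prod assms)
  also have "\<dots> = (\<Prod>b\<in>B. complex_of_real (exp (- (x b)\<^sup>2 / (2 * (1 + c))) / sqrt (1 + c)))"
    using assms by (intro prod.cong refl integral_std_normal_exp_iexp)
  also have "\<dots> = complex_of_real (exp (- (\<Sum>b\<in>B. (x b)\<^sup>2) / (2 * (1 + c))) / sqrt (1 + c) ^ card B)"
    using assms(1) by (simp add: prod_dividef exp_sum[symmetric] sum_divide_distrib sum_negf flip: of_real_prod)
  finally show ?thesis .
qed

text \<open>\<open>joint_char\<close> states in one identity that both vectors are centered
  Gaussian, independent, and of the same covariance \<open>S\<close>; \<open>coercive\<close> says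
  that \<open>S\<close> dominates \<kappa> times the identity.\<close>

locale gaussian_pair = prob_space M for M :: "'a measure" +
  fixes I :: "'i set" and \<xi> \<eta> :: "'i \<Rightarrow> 'a \<Rightarrow> real" and S :: "'i \<Rightarrow> 'i \<Rightarrow> real" and \<kappa> :: real
  assumes I[simp, intro]: "finite I"
    and \<xi>[measurable]: "\<And>i. i \<in> I \<Longrightarrow> \<xi> i \<in> borel_measurable M"
    and \<eta>[measurable]: "\<And>i. i \<in> I \<Longrightarrow> \<eta> i \<in> borel_measurable M"
    and \<kappa>: "0 < \<kappa>"
    and coercive: "\<And>a. \<kappa> * (\<Sum>i\<in>I. (a i)\<^sup>2) \<le> (\<Sum>i\<in>I. \<Sum>j\<in>I. a i * a j * S i j)"
    and joint_char: "\<And>a b. (CLINT \<omega>|M. iexp ((\<Sum>i\<in>I. a i * \<xi> i \<omega>) + (\<Sum>i\<in>I. b i * \<eta> i \<omega>)))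
      = complex_of_real (exp (- ((\<Sum>i\<in>I. \<Sum>j\<in>I. a i * a j * S i j) + (\<Sum>i\<in>I. \<Sum>j\<in>I. b i * b j * S i j)) / 2))"
begin

definition Q :: "('i \<Rightarrow> real) \<Rightarrow> real" where
  "Q a = (\<Sum>i\<in>I. \<Sum>j\<in>I. a i * a j * S i j)"

lemma Q_nonneg: "0 \<le> Q a"
proof -
  have "0 \<le> \<kappa> * (\<Sum>i\<in>I. (a i)\<^sup>2)"
    using \<kappa> by (intro mult_nonneg_nonneg sum_nonneg) auto
  then show ?thesis using coercive[of a] unfolding Q_def by linarith
qed

lemma char_\<xi>: "(CLINT \<omega>|M. iexp (\<Sum>i\<in>I. a i * \<xi> i \<omega>)) = complex_of_real (exp (- Q a / 2))"
  using joint_char[of a "\<lambda>_. 0"] by (simp add: Q_def)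

lemma char_\<eta>: "(CLINT \<omega>|M. iexp (\<Sum>i\<in>I. a i * \<eta> i \<omega>)) = complex_of_real (exp (- Q a / 2))"
  using joint_char[of "\<lambda>_. 0" a] by (simp add: Q_def)

text \<open>The exponent in \<open>joint_char\<close> is a sum, so the joint characteristic function
  factorises and the pair has the law of two independent copies living on
  \<open>M \<Otimes>\<^sub>M M\<close>. This turns an expectation into an iterated one. In
  \<open>I <+> I\<close> the left summand carries \<xi> and the right one \<eta>.\<close>

lemma decouple:
  fixes f :: "('i + 'i \<Rightarrow> real) \<Rightarrow> complex"
  assumes f[measurable]: "f \<in> borel_measurable (\<Pi>\<^sub>M k\<in>I <+> I. borel)" and f1: "\<And>x. cmod (f x) \<le> 1"
  shows "(CLINT \<omega>|M. f (\<lambda>k\<in>I <+> I. case_sum \<xi> \<eta> k \<omega>))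
    = (CLINT \<omega>'|M. CLINT \<omega>|M. f (\<lambda>k\<in>I <+> I. case_sum (\<lambda>i. \<xi> i \<omega>) (\<lambda>i. \<eta> i \<omega>') k))"
proof -
  interpret P: pair_prob_space M M ..
  define X where "X k = (\<lambda>(\<omega>, \<omega>'). case_sum (\<lambda>i. \<xi> i \<omega>) (\<lambda>i. \<eta> i \<omega>') k)" for k
  have X[measurable]: "X k \<in> borel_measurable (M \<Otimes>\<^sub>M M)" if "k \<in> I <+> I" for k
    using that by (auto simp: X_def)
  have case_meas[measurable]: "case_sum \<xi> \<eta> k \<in> borel_measurable M" if "k \<in> I <+> I" for k
    using that by auto
  have split: "(\<Sum>k\<in>I <+> I. g k) = (\<Sum>i\<in>I. g (Inl i)) + (\<Sum>i\<in>I. g (Inr i))" for g :: "_ \<Rightarrow> real"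
    by (simp add: sum.Plus)
  have "distr M (\<Pi>\<^sub>M k\<in>I <+> I. borel) (\<lambda>\<omega>. \<lambda>k\<in>I <+> I. case_sum \<xi> \<eta> k \<omega>)
      = distr (M \<Otimes>\<^sub>M M) (\<Pi>\<^sub>M k\<in>I <+> I. borel) (\<lambda>\<omega>. \<lambda>k\<in>I <+> I. X k \<omega>)"
  proof (rule joint_law_eq_of_char_eq)
    fix a :: "'i + 'i \<Rightarrow> real"
    have i: "integrable (M \<Otimes>\<^sub>M M) (\<lambda>(\<omega>, \<omega>'). iexp (\<Sum>i\<in>I. a (Inl i) * \<xi> i \<omega>) * iexp (\<Sum>i\<in>I. a (Inr i) * \<eta> i \<omega>'))"
      by (intro P.integrable_const_bound[where B=1] AE_I2) (auto simp: norm_mult simp del: of_real_sum)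
    have "(CLINT \<omega>|M \<Otimes>\<^sub>M M. iexp (\<Sum>k\<in>I <+> I. a k * X k \<omega>))
      = (CLINT \<omega>|M \<Otimes>\<^sub>M M. (\<lambda>(\<omega>, \<omega>'). iexp (\<Sum>i\<in>I. a (Inl i) * \<xi> i \<omega>) * iexp (\<Sum>i\<in>I. a (Inr i) * \<eta> i \<omega>')) \<omega>)"
      by (intro Bochner_Integration.integral_cong refl)
        (auto simp: split X_def exp_add distrib_left)
    also have "\<dots> = (CLINT \<omega>|M. CLINT \<omega>'|M. iexp (\<Sum>i\<in>I. a (Inl i) * \<xi> i \<omega>) * iexp (\<Sum>i\<in>I. a (Inr i) * \<eta> i \<omega>'))"
      using P.integral_fst'[OF i] by simp
    also have "\<dots> = (CLINT \<omega>|M. iexp (\<Sum>i\<in>I. a (Inl i) * \<xi> i \<omega>)) * (CLINT \<omega>'|M. iexp (\<Sum>i\<in>I. a (Inr i) * \<eta> i \<omega>'))"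
      unfolding integral_mult_right_zero integral_mult_left_zero ..
    also have "\<dots> = (CLINT \<omega>|M. iexp (\<Sum>k\<in>I <+> I. a k * case_sum \<xi> \<eta> k \<omega>))"
      unfolding char_\<xi> char_\<eta> split sum.case joint_char
      by (simp add: Q_def exp_add[symmetric] add_divide_distrib flip: of_real_mult)
    finally show "(CLINT \<omega>|M. iexp (\<Sum>k\<in>I <+> I. a k * case_sum \<xi> \<eta> k \<omega>)) = (CLINT \<omega>|M \<Otimes>\<^sub>M M. iexp (\<Sum>k\<in>I <+> I. a k * X k \<omega>))" ..
  qed (auto intro: prob_space_axioms P.prob_space_axioms X case_meas)
  then have "(CLINT x|distr M (\<Pi>\<^sub>M k\<in>I <+> I. borel) (\<lambda>\<omega>. \<lambda>k\<in>I <+> I. case_sum \<xi> \<eta> k \<omega>). f x)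
      = (CLINT x|distr (M \<Otimes>\<^sub>M M) (\<Pi>\<^sub>M k\<in>I <+> I. borel) (\<lambda>\<omega>. \<lambda>k\<in>I <+> I. X k \<omega>). f x)"
    by simp
  then have "(CLINT \<omega>|M. f (\<lambda>k\<in>I <+> I. case_sum \<xi> \<eta> k \<omega>)) = (CLINT \<omega>|M \<Otimes>\<^sub>M M. f (\<lambda>k\<in>I <+> I. X k \<omega>))"
    by (simp add: integral_distr measurable_restrict)
  also have "\<dots> = (CLINT \<omega>'|M. CLINT \<omega>|M. f (\<lambda>k\<in>I <+> I. X k (\<omega>, \<omega>')))"
  proof -
    have "integrable (M \<Otimes>\<^sub>M M) (\<lambda>(\<omega>, \<omega>'). f (\<lambda>k\<in>I <+> I. X k (\<omega>, \<omega>')))"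
      using f1 by (intro P.integrable_const_bound[where B=1] AE_I2) (auto simp: case_prod_beta')
    from P.integral_snd[OF this] show ?thesis by (simp add: case_prod_beta')
  qed
  finally show ?thesis by (simp add: X_def)
qed

text \<open>For fixed \<eta> the exponent is linear in \<xi>, with coefficient vector
  \<open>y\<close>. Integrating over \<xi> gives \<open>exp (- Q y / 2)\<close>, the part linear in
  \<eta> has modulus one, and coercivity replaces \<open>Q y\<close> by \<kappa> times the squared
  norm of \<open>y\<close>.\<close>

lemma bilinear_char_le:
  "cmod (CLINT \<omega>|M. iexp ((\<Sum>i\<in>I. \<xi> i \<omega> * (\<alpha> i + (\<Sum>j\<in>I. \<beta> i j * \<eta> j \<omega>))) + (\<Sum>j\<in>I. v j * \<eta> j \<omega>)))
    \<le> (LINT \<omega>|M. exp (- (\<kappa> * (\<Sum>i\<in>I. (\<alpha> i + (\<Sum>j\<in>I. \<beta> i j * \<eta> j \<omega>))\<^sup>2)) / 2))"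
proof -
  have [simp]: "Inl i \<in> I <+> I \<longleftrightarrow> i \<in> I" "Inr i \<in> I <+> I \<longleftrightarrow> i \<in> I" for i
    by auto
  define y where "y i \<omega> = \<alpha> i + (\<Sum>j\<in>I. \<beta> i j * \<eta> j \<omega>)" for i \<omega>
  have y[measurable]: "y i \<in> borel_measurable M" for i unfolding y_def by measurable
  define f where "f x = iexp ((\<Sum>i\<in>I. x (Inl i) * (\<alpha> i + (\<Sum>j\<in>I. \<beta> i j * x (Inr j)))) + (\<Sum>j\<in>I. v j * x (Inr j)))" for x :: "'i + 'i \<Rightarrow> real"
  have f: "f \<in> borel_measurable (\<Pi>\<^sub>M k\<in>I <+> I. borel)"
  proof -
    have [measurable]: "(\<lambda>x. x (Inl i)) \<in> borel_measurable (\<Pi>\<^sub>M k\<in>I <+> I. borel :: real measure)"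
      "(\<lambda>x. x (Inr i)) \<in> borel_measurable (\<Pi>\<^sub>M k\<in>I <+> I. borel :: real measure)" if "i \<in> I" for i
      using that by (auto intro!: measurable_component_singleton)
    show ?thesis unfolding f_def by measurable
  qed
  have "(CLINT \<omega>|M. iexp ((\<Sum>i\<in>I. \<xi> i \<omega> * y i \<omega>) + (\<Sum>j\<in>I. v j * \<eta> j \<omega>)))
      = (CLINT \<omega>|M. f (\<lambda>k\<in>I <+> I. case_sum \<xi> \<eta> k \<omega>))"
    by (simp add: f_def y_def cong: sum.cong)
  also have "\<dots> = (CLINT \<omega>'|M. CLINT \<omega>|M. f (\<lambda>k\<in>I <+> I. case_sum (\<lambda>i. \<xi> i \<omega>) (\<lambda>i. \<eta> i \<omega>') k))"
    by (rule decouple[OF f]) (simp add: f_def del: of_real_sum of_real_add)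
  also have "\<dots> = (CLINT \<omega>'|M. exp (- Q (\<lambda>i. y i \<omega>') / 2) * iexp (\<Sum>j\<in>I. v j * \<eta> j \<omega>'))"
  proof (intro Bochner_Integration.integral_cong refl)
    fix \<omega>'
    have "f (\<lambda>k\<in>I <+> I. case_sum (\<lambda>i. \<xi> i \<omega>) (\<lambda>i. \<eta> i \<omega>') k) = iexp (\<Sum>i\<in>I. y i \<omega>' * \<xi> i \<omega>) * iexp (\<Sum>j\<in>I. v j * \<eta> j \<omega>')" for \<omega>
      by (simp add: f_def y_def exp_add[symmetric] distrib_left ac_simps cong: sum.cong)
    then show "(CLINT \<omega>|M. f (\<lambda>k\<in>I <+> I. case_sum (\<lambda>i. \<xi> i \<omega>) (\<lambda>i. \<eta> i \<omega>') k)) = exp (- Q (\<lambda>i. y i \<omega>') / 2) * iexp (\<Sum>j\<in>I. v j * \<eta> j \<omega>')"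
      by (simp only: integral_mult_left_zero char_\<xi>)
  qed
  also have "cmod \<dots> \<le> (LINT \<omega>|M. exp (- (\<kappa> * (\<Sum>i\<in>I. (y i \<omega>)\<^sup>2)) / 2))"
  proof (rule order_trans[OF integral_norm_bound integral_mono'])
    show "integrable M (\<lambda>\<omega>. exp (- (\<kappa> * (\<Sum>i\<in>I. (y i \<omega>)\<^sup>2)) / 2))"
      using \<kappa> by (intro integrable_const_bound[where B=1] AE_I2) (auto intro!: mult_nonneg_nonneg sum_nonneg)
    show "cmod (exp (- Q (\<lambda>i. y i \<omega>) / 2) * iexp (\<Sum>j\<in>I. v j * \<eta> j \<omega>)) \<le> exp (- (\<kappa> * (\<Sum>i\<in>I. (y i \<omega>)\<^sup>2)) / 2)" for \<omega>
      using coercive[of "\<lambda>i. y i \<omega>"] by (simp add: norm_mult Q_def del: of_real_sum)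
  qed simp
  finally show ?thesis unfolding y_def .
qed

text \<open>Here \<open>exp (- \<bar>X\<bar>\<^sup>2 / 2)\<close> is the characteristic function of an independent standard normal vector
  at \<open>X\<close>; exchanging the two expectations reduces the claim to a lower bound for the covariance.\<close>

lemma exp_quadratic_le:
  fixes c :: "'b \<Rightarrow> 'i \<Rightarrow> real"
  assumes B: "finite B"
    and lower: "\<And>z. r * (\<Sum>b\<in>B. (z b)\<^sup>2) \<le> Q (\<lambda>j. \<Sum>b\<in>B. z b * c b j)" and r: "0 \<le> r"
  shows "(LINT \<omega>|M. exp (- (\<Sum>b\<in>B. (\<Sum>j\<in>I. c b j * \<eta> j \<omega>)\<^sup>2) / 2)) \<le> 1 / sqrt (1 + r) ^ card B"
proof -
  interpret Z: prob_space "std_normal_PiM B" by (rule prob_space_std_normal_PiM)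
  interpret P: pair_prob_space "std_normal_PiM B" M ..
  define X where "X b \<omega> = (\<Sum>j\<in>I. c b j * \<eta> j \<omega>)" for b \<omega>
  have X[measurable]: "X b \<in> borel_measurable M" for b unfolding X_def by measurable
  have zm[measurable]: "(\<lambda>z. z b) \<in> borel_measurable (std_normal_PiM B)" if "b \<in> B" for b
  proof -
    have "(\<lambda>z. z b) \<in> std_normal_PiM B \<rightarrow>\<^sub>M std_normal_distribution" using that by (rule measurable_component_singleton)
    then show ?thesis by simp
  qed
  have e: "(\<Sum>b\<in>B. z b * X b \<omega>) = (\<Sum>j\<in>I. (\<Sum>b\<in>B. z b * c b j) * \<eta> j \<omega>)" for z \<omega>
    unfolding X_def sum_distrib_left sum_distrib_right mult.assoc by (rule sum.swap)
  have "complex_of_real (LINT \<omega>|M. exp (- (\<Sum>b\<in>B. (X b \<omega>)\<^sup>2) / 2)) = (CLINT \<omega>|M. CLINT z|std_normal_PiM B. iexp (\<Sum>b\<in>B. z b * X b \<omega>))"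
    using std_normal_PiM_integral_exp_iexp[OF B, of 0] by (simp del: of_real_sum)
  also have "\<dots> = (CLINT z|std_normal_PiM B. CLINT \<omega>|M. iexp (\<Sum>b\<in>B. z b * X b \<omega>))"
    by (rule P.Fubini_integral) (auto intro!: P.integrable_const_bound[where B=1] AE_I2 simp del: of_real_sum)
  also have "\<dots> = (CLINT z|std_normal_PiM B. complex_of_real (exp (- Q (\<lambda>j. \<Sum>b\<in>B. z b * c b j) / 2)))"
    unfolding e char_\<eta> ..
  finally have "(LINT \<omega>|M. exp (- (\<Sum>b\<in>B. (X b \<omega>)\<^sup>2) / 2)) = (LINT z|std_normal_PiM B. exp (- Q (\<lambda>j. \<Sum>b\<in>B. z b * c b j) / 2))"
    by (simp only: integral_complex_of_real of_real_eq_iff)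
  also have "\<dots> \<le> (LINT z|std_normal_PiM B. exp (- r * (\<Sum>b\<in>B. (z b)\<^sup>2) / 2))"
  proof (rule integral_mono)
    show "integrable (std_normal_PiM B) (\<lambda>z. exp (- r * (\<Sum>b\<in>B. (z b)\<^sup>2) / 2))"
      using r by (intro Z.integrable_const_bound[where B=1] AE_I2) (auto intro!: mult_nonneg_nonneg sum_nonneg)
    have "(\<lambda>z. Q (\<lambda>j. \<Sum>b\<in>B. z b * c b j)) \<in> borel_measurable (std_normal_PiM B)" unfolding Q_def by measurable
    then show "integrable (std_normal_PiM B) (\<lambda>z. exp (- Q (\<lambda>j. \<Sum>b\<in>B. z b * c b j) / 2))"
      using Q_nonneg by (intro Z.integrable_const_bound[where B=1] AE_I2) auto
    show "exp (- Q (\<lambda>j. \<Sum>b\<in>B. z b * c b j) / 2) \<le> exp (- r * (\<Sum>b\<in>B. (z b)\<^sup>2) / 2)" for z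
      using lower[of z] by simp
  qed
  also have "\<dots> = 1 / sqrt (1 + r) ^ card B"
  proof -
    have "complex_of_real (LINT z|std_normal_PiM B. exp (- r * (\<Sum>b\<in>B. (z b)\<^sup>2) / 2)) = complex_of_real (1 / sqrt (1 + r) ^ card B)"
      using std_normal_PiM_integral_exp_iexp[OF B r, of "\<lambda>_. 0"] by (simp del: of_real_sum of_real_power of_real_divide flip: integral_complex_of_real)
    then show ?thesis by (simp only: of_real_eq_iff)
  qed
  finally show ?thesis unfolding X_def .
qed

text \<open>The same linearisation with a single auxiliary normal variable \<open>z\<close>. The
  shift \<open>p\<close> becomes the phase \<open>iexp (z * p)\<close>, and the random part raises
  the precision of \<open>z\<close> from 1 to \<open>1 + Q c\<close>, which is why the variance
  damps the decay in \<open>p\<close>.\<close>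

lemma exp_affine_square_le:
  "(LINT \<omega>|M. exp (- (p + (\<Sum>j\<in>I. c j * \<eta> j \<omega>))\<^sup>2 / 2)) \<le> exp (- p\<^sup>2 / (2 * (1 + Q c)))"
proof -
  let ?N = std_normal_distribution
  interpret Z: prob_space ?N by (rule prob_space_std_normal)
  interpret P: pair_prob_space ?N M ..
  define X where "X \<omega> = (\<Sum>j\<in>I. c j * \<eta> j \<omega>)" for \<omega>
  have X[measurable]: "X \<in> borel_measurable M" unfolding X_def by measurable
  have "complex_of_real (LINT \<omega>|M. exp (- (p + X \<omega>)\<^sup>2 / 2)) = (CLINT \<omega>|M. CLINT z|?N. iexp (z * (p + X \<omega>)))"
  proof -
    have "(CLINT z|?N. iexp (z * x)) = complex_of_real (exp (- x\<^sup>2 / 2))" for x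
      using integral_std_normal_exp_iexp[of 0 x] by simp
    then show ?thesis by (simp only: integral_complex_of_real)
  qed
  also have "\<dots> = (CLINT z|?N. CLINT \<omega>|M. iexp (z * (p + X \<omega>)))"
    by (rule P.Fubini_integral) (auto intro!: P.integrable_const_bound[where B=1] AE_I2 simp del: of_real_mult)
  also have "\<dots> = (CLINT z|?N. complex_of_real (exp (- Q c * z\<^sup>2 / 2)) * iexp (z * p))"
  proof (intro Bochner_Integration.integral_cong refl)
    fix z
    have "iexp (z * (p + X \<omega>)) = iexp (\<Sum>j\<in>I. z * c j * \<eta> j \<omega>) * iexp (z * p)" for \<omega>
      by (simp add: exp_add[symmetric] X_def sum_distrib_left algebra_simps)
    moreover have "Q (\<lambda>j. z * c j) = Q c * z\<^sup>2"
      by (simp add: Q_def sum_distrib_left power2_eq_square ac_simps)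
    ultimately show "(CLINT \<omega>|M. iexp (z * (p + X \<omega>))) = complex_of_real (exp (- Q c * z\<^sup>2 / 2)) * iexp (z * p)"
      by (simp only: integral_mult_left_zero char_\<eta>) simp
  qed
  also have "\<dots> = complex_of_real (exp (- p\<^sup>2 / (2 * (1 + Q c))) / sqrt (1 + Q c))"
    by (rule integral_std_normal_exp_iexp[OF Q_nonneg])
  finally have "(LINT \<omega>|M. exp (- (p + X \<omega>)\<^sup>2 / 2)) = exp (- p\<^sup>2 / (2 * (1 + Q c))) / sqrt (1 + Q c)"
    by (simp only: of_real_eq_iff)
  also have "\<dots> \<le> exp (- p\<^sup>2 / (2 * (1 + Q c)))"
    using Q_nonneg[of c] by (simp add: divide_le_eq)
  finally show ?thesis unfolding X_def .
qed

end

subsection \<open>The area matrix\<close>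

text \<open>\<open>K\<close> is the index of the last, possibly incomplete, grid interval and \<open>\<theta>\<close> the fraction of it
  that is covered.\<close>

definition levy_weight :: "nat \<Rightarrow> real \<Rightarrow> nat \<Rightarrow> real" where
  "levy_weight K \<theta> j = (if j < K then 1 else \<theta>)"

text \<open>The antisymmetric matrix \<open>J\<close>: the dyadic area is half the bilinear form it
  defines on the increments. An entry carries the weight of the later of the two intervals, and its
  sign tells which component moves first.\<close>

definition levy_matrix :: "nat \<Rightarrow> real \<Rightarrow> nat \<Rightarrow> nat \<Rightarrow> real" where
  "levy_matrix K \<theta> i j = (if i = j then 0 else if i < j then levy_weight K \<theta> j else - levy_weight K \<theta> i)"

definition haar_step :: "nat \<Rightarrow> nat \<Rightarrow> nat \<Rightarrow> real" where
  "haar_step l s i = (if i < s \<or> s + 2 * l \<le> i then 0 else if i < s + l then 1 else - 1)"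

lemma haar_step_sum:
  assumes "s + 2 * l \<le> K"
  shows "(\<Sum>i\<le>K. haar_step l s i * f i) = (\<Sum>i=s..<s+l. f i) - (\<Sum>i=s+l..<s+2*l. f i)"
proof -
  have "(\<Sum>i\<le>K. haar_step l s i * f i) = (\<Sum>i=s..<s+2*l. haar_step l s i * f i)"
    using assms by (intro sum.mono_neutral_right) (auto simp: haar_step_def)
  also have "\<dots> = (\<Sum>i=s..<s+l. haar_step l s i * f i) + (\<Sum>i=s+l..<s+2*l. haar_step l s i * f i)"
    by (rule sum.atLeastLessThan_concat[symmetric]) auto
  also have "(\<Sum>i=s..<s+l. haar_step l s i * f i) = (\<Sum>i=s..<s+l. f i)"
    by (intro sum.cong) (auto simp: haar_step_def)
  also have "(\<Sum>i=s+l..<s+2*l. haar_step l s i * f i) = - (\<Sum>i=s+l..<s+2*l. f i)"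
    unfolding sum_negf[symmetric] by (intro sum.cong) (auto simp: haar_step_def)
  finally show ?thesis by simp
qed

text \<open>The block ends at or below \<open>K\<close>, so the weight is constantly 1 on it. This
  orthogonality eliminates \<open>u\<close> from the tested vector.\<close>

lemma haar_step_weight:
  assumes "s + 2 * l \<le> K"
  shows "(\<Sum>i\<le>K. haar_step l s i * levy_weight K \<theta> i) = 0"
  using assms by (simp add: haar_step_sum levy_weight_def)

text \<open>Seen from an index \<open>j\<close> outside the block, the matrix entries do not vary
  over the block, and a Haar function annihilates constants. Hence distinct blocks have images with
  disjoint supports.\<close>

lemma haar_step_matrix_outside:
  assumes "s + 2 * l \<le> K" "j < s \<or> s + 2 * l \<le> j"
  shows "(\<Sum>i\<le>K. haar_step l s i * levy_matrix K \<theta> i j) = 0"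
proof -
  define c where "c = (if j < s then -1 else levy_weight K \<theta> j)"
  have "levy_matrix K \<theta> i j = c" if "i \<in> {s..<s+2*l}" for i
    using that assms by (auto simp: levy_matrix_def levy_weight_def c_def)
  then show ?thesis using assms(1) by (simp add: haar_step_sum)
qed

text \<open>The image of a Haar function is a tent over its block. Only the rising half is
  evaluated, as it already has squared norm of the right order.\<close>

lemma haar_step_matrix_inside:
  assumes "s + 2 * l \<le> K" "s \<le> j" "j < s + l"
  shows "(\<Sum>i\<le>K. haar_step l s i * levy_matrix K \<theta> i j) = 2 * real (j - s) + 1"
proof -
  have "(\<Sum>i=s..<s+l. levy_matrix K \<theta> i j) = (\<Sum>i=s..<j. levy_matrix K \<theta> i j) + (\<Sum>i=j..<s+l. levy_matrix K \<theta> i j)"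
    using assms by (intro sum.atLeastLessThan_concat[symmetric]) auto
  also have "(\<Sum>i=s..<j. levy_matrix K \<theta> i j) = (\<Sum>i=s..<j. 1)"
    using assms by (intro sum.cong) (auto simp: levy_matrix_def levy_weight_def)
  also have "(\<Sum>i=j..<s+l. levy_matrix K \<theta> i j) = levy_matrix K \<theta> j j + (\<Sum>i=Suc j..<s+l. levy_matrix K \<theta> i j)"
    using assms by (intro sum.atLeast_Suc_lessThan) auto
  also have "(\<Sum>i=Suc j..<s+l. levy_matrix K \<theta> i j) = (\<Sum>i=Suc j..<s+l. -1)"
    using assms by (intro sum.cong) (auto simp: levy_matrix_def levy_weight_def)
  finally have 1: "(\<Sum>i=s..<s+l. levy_matrix K \<theta> i j) = real (j - s) - real (s + l - Suc j)"
    by (simp add: levy_matrix_def)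
  have "(\<Sum>i=s+l..<s+2*l. levy_matrix K \<theta> i j) = (\<Sum>i=s+l..<s+2*l. -1)"
    using assms by (intro sum.cong) (auto simp: levy_matrix_def levy_weight_def)
  then have 2: "(\<Sum>i=s+l..<s+2*l. levy_matrix K \<theta> i j) = - real l" by simp
  show ?thesis unfolding haar_step_sum[OF assms(1)] 1 2 using assms by (simp add: of_nat_diff)
qed

text \<open>The exact value is \<open>l * (4 * l\<^sup>2 - 1) / 3\<close>; the rounder bound is
  enough to count powers of \<open>l\<close>.\<close>

lemma cube_le_sum_odd_squares: "real l ^ 3 \<le> (\<Sum>q<l. (2 * real q + 1)\<^sup>2)"
proof (induction l)
  case (Suc l)
  have "real (Suc l) ^ 3 \<le> real l ^ 3 + (2 * real l + 1)\<^sup>2"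
    by (simp add: power3_eq_cube power2_eq_square algebra_simps)
  then show ?case using Suc by simp
qed simp

text \<open>Bessel's inequality for \<open>N\<close> disjointly supported Haar functions, each of
  squared norm \<open>2 * l\<close>, keeps \<open>N\<close> squares and removes \<open>u\<close>.
  The remaining linear forms in \<eta> have disjointly supported coefficients, so by coercivity
  their covariance is at least \<open>\<kappa> * A\<^sup>2 * l ^ 3\<close>, which equals
  \<open>(\<kappa> * w * l)\<^sup>2 / 8\<close>.\<close>

lemma levy_quadratic_le:
  assumes G: "gaussian_pair M {..K} \<xi> \<eta> S \<kappa>" and K: "2 * N * l \<le> K" and l: "l > 0"
  shows "(LINT \<omega>|M. exp (- (\<kappa> * (\<Sum>i\<le>K. (u * levy_weight K \<theta> i + (\<Sum>j\<le>K. w / 2 * levy_matrix K \<theta> i j * \<eta> j \<omega>))\<^sup>2)) / 2))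
    \<le> 1 / sqrt (1 + (\<kappa> * w * real l)\<^sup>2 / 8) ^ N"
proof -
  interpret gaussian_pair M "{..K}" \<xi> \<eta> S \<kappa> by fact
  define s where "s b = 2 * b * l" for b :: nat
  define blk where "blk b = {s b..<s b + 2 * l}" for b
  define c where "c b j = (\<Sum>i\<le>K. haar_step l (s b) i * levy_matrix K \<theta> i j)" for b j
  \<comment> \<open>The root contains \<kappa> from the exponent and \<open>1 / (2 * l)\<close> from
    normalising a Haar function; \<open>w / 2\<close> is the coefficient of the matrix.\<close>
  define A where "A = sqrt (\<kappa> / (2 * real l)) * (w / 2)"
  have A2: "A\<^sup>2 = \<kappa> * w\<^sup>2 / (8 * real l)"
    using \<kappa> l by (simp add: A_def power_mult_distrib power_divide field_simps)
  have sK: "s b + 2 * l \<le> K" if "b < N" for b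
  proof -
    have "2 * (Suc b) * l \<le> 2 * N * l" using that by (intro mult_le_mono) auto
    then show ?thesis using K by (simp add: s_def algebra_simps)
  qed
  have disj: "blk b \<inter> blk b' = {}" if "b \<noteq> b'" for b b'
  proof -
    have *: "blk b \<inter> blk b' = {}" if "b < b'" for b b'
    proof -
      have "2 * (Suc b) * l \<le> 2 * b' * l" using that by (intro mult_le_mono) auto
      then show ?thesis by (auto simp: blk_def s_def algebra_simps)
    qed
    show ?thesis using *[of b b'] *[of b' b] that by (cases "b < b'") auto
  qed
  have sum_blk: "(\<Sum>b<N. \<Sum>i\<in>blk b. g i) \<le> (\<Sum>i\<le>K. g i)" if "\<And>i. 0 \<le> g i" for g :: "nat \<Rightarrow> real"
  proof -
    have "(\<Sum>b<N. \<Sum>i\<in>blk b. g i) = (\<Sum>i\<in>(\<Union>b<N. blk b). g i)"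
      using disj by (subst sum.UNION_disjoint) (auto simp: blk_def)
    also have "\<dots> \<le> (\<Sum>i\<le>K. g i)"
      using that sK by (intro sum_mono2) (auto simp: blk_def dest!: sK)
    finally show ?thesis .
  qed
  have c_out: "c b j = 0" if "b < N" "j \<notin> blk b" for b j
    unfolding c_def using that sK by (intro haar_step_matrix_outside) (auto simp: blk_def)
  have c_sq: "real l ^ 3 \<le> (\<Sum>j\<in>blk b. (c b j)\<^sup>2)" if "b < N" for b
  proof -
    have "(\<Sum>q<l. (2 * real q + 1)\<^sup>2) = (\<Sum>j=s b..<s b + l. (2 * real (j - s b) + 1)\<^sup>2)"
      by (rule sum.reindex_bij_witness[where i="\<lambda>j. j - s b" and j="\<lambda>q. q + s b"]) auto
    also have "\<dots> = (\<Sum>j=s b..<s b + l. (c b j)\<^sup>2)"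
      unfolding c_def using that sK by (intro sum.cong refl) (simp add: haar_step_matrix_inside)
    also have "\<dots> \<le> (\<Sum>j\<in>blk b. (c b j)\<^sup>2)"
      by (intro sum_mono2) (auto simp: blk_def)
    finally show ?thesis using cube_le_sum_odd_squares[of l] by linarith
  qed
  have pointwise: "(\<Sum>b<N. (\<Sum>j\<le>K. A * c b j * \<eta> j \<omega>)\<^sup>2)
    \<le> \<kappa> * (\<Sum>i\<le>K. (u * levy_weight K \<theta> i + (\<Sum>j\<le>K. w / 2 * levy_matrix K \<theta> i j * \<eta> j \<omega>))\<^sup>2)" for \<omega>
  proof -
    define x where "x i = u * levy_weight K \<theta> i + (\<Sum>j\<le>K. w / 2 * levy_matrix K \<theta> i j * \<eta> j \<omega>)" for i
    have x: "(\<Sum>i\<le>K. haar_step l (s b) i * x i) = w / 2 * (\<Sum>j\<le>K. c b j * \<eta> j \<omega>)" if "b < N" for b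
    proof -
      have "(\<Sum>i\<le>K. haar_step l (s b) i * x i)
        = u * (\<Sum>i\<le>K. haar_step l (s b) i * levy_weight K \<theta> i) + (\<Sum>i\<le>K. \<Sum>j\<le>K. w / 2 * (haar_step l (s b) i * levy_matrix K \<theta> i j * \<eta> j \<omega>))"
        by (simp add: x_def distrib_left sum.distrib sum_distrib_left ac_simps)
      also have "(\<Sum>i\<le>K. \<Sum>j\<le>K. w / 2 * (haar_step l (s b) i * levy_matrix K \<theta> i j * \<eta> j \<omega>)) = w / 2 * (\<Sum>j\<le>K. c b j * \<eta> j \<omega>)"
        unfolding c_def sum_distrib_left sum_distrib_right by (rule sum.swap)
      finally show ?thesis using haar_step_weight[OF sK[OF that]] by simp
    qed
    have cs: "(\<Sum>i\<le>K. haar_step l (s b) i * x i)\<^sup>2 \<le> 2 * real l * (\<Sum>i\<in>blk b. (x i)\<^sup>2)" if "b < N" for b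
    proof -
      have "(\<Sum>i\<le>K. haar_step l (s b) i * x i) = (\<Sum>i\<in>blk b. haar_step l (s b) i * x i)"
        using sK[OF that] by (intro sum.mono_neutral_right) (auto simp: blk_def haar_step_def)
      moreover have "(\<Sum>i\<in>blk b. haar_step l (s b) i * x i)\<^sup>2 \<le> (\<Sum>i\<in>blk b. (haar_step l (s b) i)\<^sup>2) * (\<Sum>i\<in>blk b. (x i)\<^sup>2)"
        by (rule Cauchy_Schwarz_ineq_sum)
      moreover have "(\<Sum>i\<in>blk b. (haar_step l (s b) i)\<^sup>2) = (\<Sum>i\<in>blk b. 1)"
        by (intro sum.cong) (auto simp: blk_def haar_step_def)
      ultimately show ?thesis by (simp add: blk_def)
    qed
    have "(\<Sum>b<N. (\<Sum>j\<le>K. A * c b j * \<eta> j \<omega>)\<^sup>2) = (\<Sum>b<N. \<kappa> / (2 * real l) * (\<Sum>i\<le>K. haar_step l (s b) i * x i)\<^sup>2)"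
    proof (intro sum.cong refl)
      fix b assume "b \<in> {..<N}"
      have "(\<Sum>j\<le>K. A * c b j * \<eta> j \<omega>) = sqrt (\<kappa> / (2 * real l)) * (w / 2 * (\<Sum>j\<le>K. c b j * \<eta> j \<omega>))"
        by (simp add: A_def sum_distrib_left ac_simps)
      also have "w / 2 * (\<Sum>j\<le>K. c b j * \<eta> j \<omega>) = (\<Sum>i\<le>K. haar_step l (s b) i * x i)"
        using x[of b] \<open>b \<in> {..<N}\<close> by simp
      finally have "(\<Sum>j\<le>K. A * c b j * \<eta> j \<omega>) = sqrt (\<kappa> / (2 * real l)) * (\<Sum>i\<le>K. haar_step l (s b) i * x i)" .
      then show "(\<Sum>j\<le>K. A * c b j * \<eta> j \<omega>)\<^sup>2 = \<kappa> / (2 * real l) * (\<Sum>i\<le>K. haar_step l (s b) i * x i)\<^sup>2"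
        using \<kappa> l by (simp add: power_mult_distrib)
    qed
    also have "\<dots> \<le> (\<Sum>b<N. \<kappa> / (2 * real l) * (2 * real l * (\<Sum>i\<in>blk b. (x i)\<^sup>2)))"
      using \<kappa> l cs by (intro sum_mono mult_left_mono) auto
    also have "\<dots> = \<kappa> * (\<Sum>b<N. \<Sum>i\<in>blk b. (x i)\<^sup>2)"
      using l by (simp add: sum_distrib_left)
    also have "\<dots> \<le> \<kappa> * (\<Sum>i\<le>K. (x i)\<^sup>2)"
      using \<kappa> by (intro mult_left_mono sum_blk) auto
    finally show ?thesis unfolding x_def .
  qed
  have "(LINT \<omega>|M. exp (- (\<kappa> * (\<Sum>i\<le>K. (u * levy_weight K \<theta> i + (\<Sum>j\<le>K. w / 2 * levy_matrix K \<theta> i j * \<eta> j \<omega>))\<^sup>2)) / 2))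
    \<le> (LINT \<omega>|M. exp (- (\<Sum>b<N. (\<Sum>j\<le>K. A * c b j * \<eta> j \<omega>)\<^sup>2) / 2))"
  proof (rule integral_mono')
    show "integrable M (\<lambda>\<omega>. exp (- (\<Sum>b<N. (\<Sum>j\<le>K. A * c b j * \<eta> j \<omega>)\<^sup>2) / 2))"
      by (intro integrable_const_bound[where B=1] AE_I2) (auto intro!: sum_nonneg)
  qed (use pointwise in auto)
  also have "\<dots> \<le> 1 / sqrt (1 + (\<kappa> * w * real l)\<^sup>2 / 8) ^ card {..<N}"
  proof (rule exp_quadratic_le)
    fix z :: "nat \<Rightarrow> real"
    have "(\<kappa> * w * real l)\<^sup>2 / 8 * (\<Sum>b<N. (z b)\<^sup>2) = (\<Sum>b<N. \<kappa> * A\<^sup>2 * (z b)\<^sup>2 * real l ^ 3)"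
    proof -
      have "(\<kappa> * w * real l)\<^sup>2 / 8 = \<kappa> * A\<^sup>2 * real l ^ 3"
        using l unfolding A2 by (simp add: power_mult_distrib power2_eq_square power3_eq_cube)
      then show ?thesis by (simp add: sum_distrib_left ac_simps)
    qed
    also have "\<dots> \<le> (\<Sum>b<N. \<kappa> * A\<^sup>2 * (z b)\<^sup>2 * (\<Sum>j\<in>blk b. (c b j)\<^sup>2))"
      using \<kappa> c_sq by (intro sum_mono mult_left_mono) auto
    also have "\<dots> = \<kappa> * (\<Sum>b<N. \<Sum>j\<in>blk b. (\<Sum>b'<N. z b' * (A * c b' j))\<^sup>2)"
    proof -
      have "(\<Sum>b'<N. z b' * (A * c b' j)) = z b * (A * c b j)" if "b < N" "j \<in> blk b" for b j
      proof -
        have "c b' j = 0" if "b' < N" "b' \<noteq> b" for b'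
          using disj[of b b'] c_out[of b' j] \<open>j \<in> blk b\<close> that by blast
        then have "(\<Sum>b'<N. z b' * (A * c b' j)) = (\<Sum>b'\<in>{b}. z b' * (A * c b' j))"
          using \<open>b < N\<close> by (intro sum.mono_neutral_right) auto
        then show ?thesis by simp
      qed
      then have "(\<Sum>b<N. \<Sum>j\<in>blk b. (\<Sum>b'<N. z b' * (A * c b' j))\<^sup>2) = (\<Sum>b<N. \<Sum>j\<in>blk b. (z b * (A * c b j))\<^sup>2)"
        by (intro sum.cong refl) simp
      then show ?thesis
        by (simp add: sum_distrib_left power_mult_distrib ac_simps)
    qed
    also have "\<dots> \<le> \<kappa> * (\<Sum>j\<le>K. (\<Sum>b<N. z b * (A * c b j))\<^sup>2)"
      using \<kappa> by (intro mult_left_mono sum_blk) auto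
    also have "\<dots> \<le> Q (\<lambda>j. \<Sum>b<N. z b * (A * c b j))"
      unfolding Q_def by (rule coercive)
    finally show "(\<kappa> * w * real l)\<^sup>2 / 8 * (\<Sum>b<N. (z b)\<^sup>2) \<le> Q (\<lambda>j. \<Sum>b<N. z b * (A * c b j))" .
  qed auto
  finally show ?thesis by simp
qed

text \<open>The test vector is 1 on the \<open>K\<close> complete intervals, where the weight is 1,
  and 0 on the last one. Cauchy-Schwarz leaves \<kappa> / K times the square of a sum with mean
  \<open>K * u\<close>, giving decay of order \<open>\<kappa> * K * u\<^sup>2\<close>;
  \<open>V\<close> measures the variance of the random part, a combination of column sums of the
  matrix, in units of \<open>K\<^sup>2\<close>.\<close>

lemma levy_linear_le:
  assumes G: "gaussian_pair M {..K} \<xi> \<eta> S \<kappa>" and K: "K > 0"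
    and V: "(\<Sum>i\<le>K. \<Sum>j\<le>K. (\<Sum>k<K. levy_matrix K \<theta> k i) * (\<Sum>k<K. levy_matrix K \<theta> k j) * S i j) \<le> V * (real K)\<^sup>2"
  shows "(LINT \<omega>|M. exp (- (\<kappa> * (\<Sum>i\<le>K. (u * levy_weight K \<theta> i + (\<Sum>j\<le>K. w / 2 * levy_matrix K \<theta> i j * \<eta> j \<omega>))\<^sup>2)) / 2))
    \<le> exp (- (\<kappa> * K * u\<^sup>2) / (2 * (1 + \<kappa> * K * w\<^sup>2 * V / 4)))"
proof -
  interpret gaussian_pair M "{..K}" \<xi> \<eta> S \<kappa> by fact
  define r where "r j = (\<Sum>k<K. levy_matrix K \<theta> k j)" for j
  define A where "A = sqrt (\<kappa> / K)"
  have A2: "A\<^sup>2 = \<kappa> / K" using \<kappa> by (simp add: A_def)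
  have pointwise: "(A * K * u + (\<Sum>j\<le>K. A * w / 2 * r j * \<eta> j \<omega>))\<^sup>2
    \<le> \<kappa> * (\<Sum>i\<le>K. (u * levy_weight K \<theta> i + (\<Sum>j\<le>K. w / 2 * levy_matrix K \<theta> i j * \<eta> j \<omega>))\<^sup>2)" for \<omega>
  proof -
    define x where "x i = u * levy_weight K \<theta> i + (\<Sum>j\<le>K. w / 2 * levy_matrix K \<theta> i j * \<eta> j \<omega>)" for i
    have "(\<Sum>k<K. x k) = (\<Sum>k<K. u) + (\<Sum>k<K. \<Sum>j\<le>K. w / 2 * levy_matrix K \<theta> k j * \<eta> j \<omega>)"
      unfolding x_def sum.distrib by (simp add: levy_weight_def)
    also have "(\<Sum>k<K. \<Sum>j\<le>K. w / 2 * levy_matrix K \<theta> k j * \<eta> j \<omega>) = (\<Sum>j\<le>K. w / 2 * r j * \<eta> j \<omega>)"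
      unfolding r_def sum_distrib_left sum_distrib_right by (rule sum.swap)
    finally have "A * (\<Sum>k<K. x k) = A * K * u + (\<Sum>j\<le>K. A * w / 2 * r j * \<eta> j \<omega>)"
      by (simp add: distrib_left sum_distrib_left ac_simps)
    then have "(A * K * u + (\<Sum>j\<le>K. A * w / 2 * r j * \<eta> j \<omega>))\<^sup>2 = A\<^sup>2 * (\<Sum>k<K. 1 * x k)\<^sup>2"
      by (metis (no_types, lifting) power_mult_distrib mult_1 sum.cong)
    also have "\<dots> \<le> A\<^sup>2 * ((\<Sum>k<K. 1\<^sup>2) * (\<Sum>k<K. (x k)\<^sup>2))"
      by (intro mult_left_mono Cauchy_Schwarz_ineq_sum) auto
    also have "\<dots> = \<kappa> * (\<Sum>k<K. (x k)\<^sup>2)" using K by (simp add: A2)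
    also have "\<dots> \<le> \<kappa> * (\<Sum>k\<le>K. (x k)\<^sup>2)"
      using \<kappa> by (intro mult_left_mono sum_mono2) auto
    finally show ?thesis unfolding x_def .
  qed
  have "(LINT \<omega>|M. exp (- (\<kappa> * (\<Sum>i\<le>K. (u * levy_weight K \<theta> i + (\<Sum>j\<le>K. w / 2 * levy_matrix K \<theta> i j * \<eta> j \<omega>))\<^sup>2)) / 2))
    \<le> (LINT \<omega>|M. exp (- (A * K * u + (\<Sum>j\<le>K. A * w / 2 * r j * \<eta> j \<omega>))\<^sup>2 / 2))"
  proof (rule integral_mono')
    show "integrable M (\<lambda>\<omega>. exp (- (A * K * u + (\<Sum>j\<le>K. A * w / 2 * r j * \<eta> j \<omega>))\<^sup>2 / 2))"
      by (intro integrable_const_bound[where B=1] AE_I2) auto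
  qed (use pointwise in auto)
  also have "\<dots> \<le> exp (- (A * K * u)\<^sup>2 / (2 * (1 + Q (\<lambda>j. A * w / 2 * r j))))"
    by (rule exp_affine_square_le)
  also have "\<dots> \<le> exp (- (\<kappa> * K * u\<^sup>2) / (2 * (1 + \<kappa> * K * w\<^sup>2 * V / 4)))"
  proof -
    have "Q (\<lambda>j. A * w / 2 * r j) = A\<^sup>2 * w\<^sup>2 / 4 * Q r"
      by (simp add: Q_def sum_distrib_left power2_eq_square ac_simps)
    also have "\<dots> \<le> A\<^sup>2 * w\<^sup>2 / 4 * (V * (real K)\<^sup>2)"
      using V by (intro mult_left_mono) (auto simp: Q_def r_def)
    also have "\<dots> = (A\<^sup>2 * K) * K * w\<^sup>2 * V / 4" by (simp add: power2_eq_square)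
    also have "A\<^sup>2 * K = \<kappa>" using K by (simp add: A2)
    finally have le: "Q (\<lambda>j. A * w / 2 * r j) \<le> \<kappa> * K * w\<^sup>2 * V / 4" .
    have "(A * K * u)\<^sup>2 = (A\<^sup>2 * K) * K * u\<^sup>2" by (simp add: power2_eq_square)
    also have "A\<^sup>2 * K = \<kappa>" using K by (simp add: A2)
    finally have "(A * K * u)\<^sup>2 = \<kappa> * K * u\<^sup>2" .
    moreover have "0 \<le> Q (\<lambda>j. A * w / 2 * r j)" by (rule Q_nonneg)
    moreover have "0 \<le> \<kappa> * K * u\<^sup>2" using \<kappa> by simp
    ultimately have "\<kappa> * K * u\<^sup>2 / (2 * (1 + \<kappa> * K * w\<^sup>2 * V / 4)) \<le> (A * K * u)\<^sup>2 / (2 * (1 + Q (\<lambda>j. A * w / 2 * r j)))"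
      using le by (simp only:) (intro divide_left_mono mult_pos_pos mult_left_mono, auto)
    then show ?thesis by simp
  qed
  finally show ?thesis .
qed

subsection \<open>Covariance of fractional increments\<close>

text \<open>Concavity of the power function as a tangent line bound, obtained from weighted AM-GM
  for \<open>y / x\<close> and 1. With exponent \<open>2 * H < 1\<close> it gives both the sign of
  the correlations and the row sums.\<close>

lemma powr_le_tangent:
  fixes x y a :: real
  assumes "0 < x" "0 \<le> y" "0 < a" "a < 1"
  shows "y powr a \<le> x powr a + a * x powr (a - 1) * (y - x)"
proof (cases "y = 0")
  case True
  have "x powr a = x powr (a - 1) * x" using assms by (simp add: powr_diff)
  then have "x powr a + a * x powr (a - 1) * (0 - x) = (1 - a) * x powr a"
    by (simp add: algebra_simps)
  then show ?thesis using True assms by simp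
next
  case False
  have "(y / x) powr a * 1 powr (1 - a) \<le> a * (y / x) + (1 - a) * 1"
    using assms False by (intro Youngs_inequality_0) auto
  then have "x powr a * (y / x) powr a \<le> x powr a * (a * (y / x) + (1 - a))"
    using assms by (intro mult_left_mono) auto
  also have "x powr a * (y / x) powr a = y powr a" using assms by (simp add: powr_divide)
  also have "x powr a * (a * (y / x) + (1 - a)) = x powr a + a * x powr (a - 1) * (y - x)"
    using assms by (simp add: powr_diff field_simps)
  finally show ?thesis .
qed

lemma powr_midpoint_concave:
  fixes x h a :: real
  assumes "0 \<le> h" "h \<le> x" "0 < a" "a < 1"
  shows "(x + h) powr a + (x - h) powr a \<le> 2 * x powr a"
proof (cases "x = 0")
  case False
  then have "x > 0" using assms by simp
  then show ?thesis
    using powr_le_tangent[of x "x + h" a] powr_le_tangent[of x "x - h" a] assms by (simp add: algebra_simps)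
qed (use assms in simp)

lemma powr_increment_ge:
  fixes x h a :: real
  assumes "0 \<le> x" "0 < h" "x + h \<le> T" "0 < a" "a < 1"
  shows "a * T powr (a - 1) * h \<le> (x + h) powr a - x powr a"
proof -
  have "x powr a \<le> (x + h) powr a + a * (x + h) powr (a - 1) * (x - (x + h))"
    using assms by (intro powr_le_tangent) auto
  moreover have "T powr (a - 1) \<le> (x + h) powr (a - 1)"
    using assms by (intro powr_mono2') auto
  then have "a * T powr (a - 1) * h \<le> a * (x + h) powr (a - 1) * h"
    using assms by (intro mult_right_mono mult_left_mono) auto
  ultimately show ?thesis by simp
qed

text \<open>Replacing \<open>x i * x j\<close> by the mean of the two squares can only lower the
  off-diagonal terms, whose coefficients are nonpositive, and leaves the diagonal unchanged. By
  symmetry the result is the sum of \<open>(x i)\<^sup>2\<close> times the row sums.\<close>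

lemma quadratic_form_ge_of_row_sums:
  fixes S :: "'i \<Rightarrow> 'i \<Rightarrow> real"
  assumes "finite I"
    and sym: "\<And>i j. S i j = S j i"
    and off: "\<And>i j. i \<in> I \<Longrightarrow> j \<in> I \<Longrightarrow> i \<noteq> j \<Longrightarrow> S i j \<le> 0"
    and row: "\<And>i. i \<in> I \<Longrightarrow> \<kappa> \<le> (\<Sum>j\<in>I. S i j)"
  shows "\<kappa> * (\<Sum>i\<in>I. (x i)\<^sup>2) \<le> (\<Sum>i\<in>I. \<Sum>j\<in>I. x i * x j * S i j)"
proof -
  have "\<kappa> * (\<Sum>i\<in>I. (x i)\<^sup>2) \<le> (\<Sum>i\<in>I. (x i)\<^sup>2 * (\<Sum>j\<in>I. S i j))"
    unfolding mult.commute[of \<kappa>] sum_distrib_right using row by (intro sum_mono mult_left_mono) auto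
  also have "\<dots> = (\<Sum>i\<in>I. \<Sum>j\<in>I. (x i)\<^sup>2 * S i j)"
    by (simp add: sum_distrib_left)
  also have "\<dots> = ((\<Sum>i\<in>I. \<Sum>j\<in>I. (x i)\<^sup>2 * S i j) + (\<Sum>i\<in>I. \<Sum>j\<in>I. (x j)\<^sup>2 * S i j)) / 2"
  proof -
    have "(\<Sum>i\<in>I. \<Sum>j\<in>I. (x j)\<^sup>2 * S i j) = (\<Sum>j\<in>I. \<Sum>i\<in>I. (x j)\<^sup>2 * S i j)" by (rule sum.swap)
    also have "\<dots> = (\<Sum>i\<in>I. \<Sum>j\<in>I. (x i)\<^sup>2 * S i j)" by (subst sym) simp
    finally show ?thesis by simp
  qed
  also have "\<dots> = (\<Sum>i\<in>I. \<Sum>j\<in>I. ((x i)\<^sup>2 + (x j)\<^sup>2) / 2 * S i j)"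
    by (simp add: sum.distrib[symmetric] sum_divide_distrib add_divide_distrib distrib_right)
  also have "\<dots> \<le> (\<Sum>i\<in>I. \<Sum>j\<in>I. x i * x j * S i j)"
  proof (intro sum_mono)
    fix i j assume ij: "i \<in> I" "j \<in> I"
    show "((x i)\<^sup>2 + (x j)\<^sup>2) / 2 * S i j \<le> x i * x j * S i j"
    proof (cases "i = j")
      case False
      have "x i * x j \<le> ((x i)\<^sup>2 + (x j)\<^sup>2) / 2"
        using sum_squares_bound[of "x i" "x j"] by simp
      then show ?thesis using off[OF ij False] by (rule mult_right_mono_neg)
    qed (simp add: power2_eq_square)
  qed
  finally show ?thesis .
qed

definition fbm_incr_cov :: "real \<Rightarrow> real \<Rightarrow> nat \<Rightarrow> nat \<Rightarrow> real" where
  "fbm_incr_cov H h i j =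
     fbm_cov H (real (Suc i) * h) (real (Suc j) * h) - fbm_cov H (real (Suc i) * h) (real j * h)
     - fbm_cov H (real i * h) (real (Suc j) * h) + fbm_cov H (real i * h) (real j * h)"

lemma fbm_cov_sym: "fbm_cov H s t = fbm_cov H t s"
  by (simp add: fbm_cov_def abs_minus_commute)

lemma fbm_incr_cov_sym: "fbm_incr_cov H h i j = fbm_incr_cov H h j i"
  unfolding fbm_incr_cov_def by (subst (1 2 3 4) fbm_cov_sym) simp

text \<open>Off the diagonal the covariance is half a second difference, with step \<open>h\<close>
  at the lag \<open>x\<close>, of the concave function \<open>x powr (2 * H)\<close>.\<close>

lemma fbm_incr_cov_nonpos:
  assumes H: "0 < H" "H < 1/2" and h: "h > 0" and "i \<noteq> j"
  shows "fbm_incr_cov H h i j \<le> 0"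
proof -
  have *: "fbm_incr_cov H h i j \<le> 0" if "i < j" for i j
  proof -
    define x where "x = (real j - real i) * h"
    have hx: "h \<le> x"
    proof -
      have "1 * h \<le> (real j - real i) * h" using that h by (intro mult_right_mono) auto
      then show ?thesis by (simp add: x_def)
    qed
    have e: "\<bar>real (Suc j) * h - real (Suc i) * h\<bar> = x" "\<bar>real j * h - real i * h\<bar> = x"
      "\<bar>real j * h - real (Suc i) * h\<bar> = x - h" "\<bar>real (Suc j) * h - real i * h\<bar> = x + h"
      using hx h by (auto simp: x_def algebra_simps)
    have "fbm_incr_cov H h i j = ((x + h) powr (2*H) + (x - h) powr (2*H) - 2 * x powr (2*H)) / 2"
      unfolding fbm_incr_cov_def fbm_cov_def e by (simp add: field_simps)
    then show ?thesis using powr_midpoint_concave[of h x "2*H"] hx h H by simp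
  qed
  show ?thesis using *[of i j] *[of j i] fbm_incr_cov_sym[of H h i j] \<open>i \<noteq> j\<close>
    by (cases "i < j") auto
qed

text \<open>A row telescopes to the covariance of one increment with the value at the right end of
  the grid. That is the mean of two increments of \<open>x powr (2 * H)\<close>, one starting at the
  distance to the left end and one at the distance to the right end; on \<open>[0, T]\<close> the
  slope of this function is at least its slope at \<open>T\<close>.\<close>

lemma fbm_incr_cov_row_sum:
  assumes H: "0 < H" "H < 1/2" and h: "h > 0" and i: "i \<le> K" and T: "real (Suc K) * h \<le> T"
  shows "2 * H * T powr (2 * H - 1) * h \<le> (\<Sum>j\<le>K. fbm_incr_cov H h i j)"
proof -
  define D where "D j = fbm_cov H (real (Suc i) * h) (real j * h) - fbm_cov H (real i * h) (real j * h)" for j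
  have "(\<Sum>j\<le>K. fbm_incr_cov H h i j) = (\<Sum>j<Suc K. D (Suc j) - D j)"
    unfolding lessThan_Suc_atMost by (intro sum.cong) (auto simp: fbm_incr_cov_def D_def)
  also have "\<dots> = D (Suc K) - D 0" by (rule sum_lessThan_telescope)
  also have "D 0 = 0" using h by (simp add: D_def fbm_cov_def)
  finally have s: "(\<Sum>j\<le>K. fbm_incr_cov H h i j) = D (Suc K)" by simp
  define x y where "x = real i * h" and "y = (real K - real i) * h"
  have xy: "0 \<le> x" "0 \<le> y" using h i by (auto simp: x_def y_def)
  have e: "\<bar>real (Suc K) * h - real (Suc i) * h\<bar> = y" "\<bar>real (Suc K) * h - real i * h\<bar> = y + h" "real (Suc i) * h = x + h"
  proof -
    have "real (Suc K) * h - real (Suc i) * h = y" "real (Suc K) * h - real i * h = y + h"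
      by (auto simp: y_def algebra_simps)
    then show "\<bar>real (Suc K) * h - real (Suc i) * h\<bar> = y" "\<bar>real (Suc K) * h - real i * h\<bar> = y + h"
      using xy h by auto
  qed (simp add: x_def algebra_simps)
  have D: "D (Suc K) = (((x + h) powr (2*H) - x powr (2*H)) + ((y + h) powr (2*H) - y powr (2*H))) / 2"
    unfolding D_def fbm_cov_def e(1,2) unfolding e(3) by (simp add: x_def field_simps)
  have "x + y + h \<le> T" using T by (simp add: x_def y_def algebra_simps)
  then have "x + h \<le> T" "y + h \<le> T" using xy by auto
  then show ?thesis unfolding s D
    using powr_increment_ge[of x h T "2*H"] powr_increment_ge[of y h T "2*H"] xy h H by simp
qed

lemma fbm_incr_cov_coercive:
  assumes H: "0 < H" "H < 1/2" and h: "h > 0" and T: "real (Suc K) * h \<le> T"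
  shows "2 * H * T powr (2 * H - 1) * h * (\<Sum>i\<le>K. (x i)\<^sup>2) \<le> (\<Sum>i\<le>K. \<Sum>j\<le>K. x i * x j * fbm_incr_cov H h i j)"
  using assms by (intro quadratic_form_ge_of_row_sums fbm_incr_cov_row_sum) (auto intro: fbm_incr_cov_sym fbm_incr_cov_nonpos)

lemma abs_fbm_cov_le:
  assumes "0 < H" "s \<in> {0..T}" "t \<in> {0..T}"
  shows "\<bar>fbm_cov H s t\<bar> \<le> 2 * T powr (2 * H)"
proof -
  have m: "x powr (2*H) \<le> T powr (2*H)" if "0 \<le> x" "x \<le> T" for x
    using that assms by (intro powr_mono2) auto
  have "\<bar>t - s\<bar> \<le> T" using assms by auto
  then show ?thesis
    using m[of s] m[of t] m[of "\<bar>t - s\<bar>"] assms powr_ge_zero[of s "2*H"] powr_ge_zero[of t "2*H"] powr_ge_zero[of "\<bar>t - s\<bar>" "2*H"]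
    unfolding fbm_cov_def by (simp add: abs_le_iff del: powr_ge_zero)
qed

section \<open>Characteristic functions of fractional Brownian increments\<close>

lemma centered_normal_char:
  assumes "prob_space M" "centered_normal_rv M X v"
  shows "(CLINT \<omega>|M. iexp (X \<omega>)) = complex_of_real (exp (- v / 2))"
proof -
  interpret prob_space M by fact
  have X[measurable]: "X \<in> borel_measurable M" using assms(2) by (simp add: centered_normal_rv_def)
  show ?thesis
  proof (cases "v = 0")
    case True
    then have "AE \<omega> in M. X \<omega> = 0" using assms(2) by (simp add: centered_normal_rv_def)
    then have "(CLINT \<omega>|M. iexp (X \<omega>)) = (CLINT \<omega>|M. 1)"
      by (intro integral_cong_AE) auto
    then show ?thesis using True by (simp add: prob_space)
  next
    case False
    define \<sigma> where "\<sigma> = sqrt v"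
    have v: "v > 0" and D: "distributed M lborel X (\<lambda>x. ennreal (normal_density 0 \<sigma> x))"
      using assms(2) False by (auto simp: centered_normal_rv_def \<sigma>_def)
    have \<sigma>: "\<sigma> > 0" "\<sigma>\<^sup>2 = v" using v by (auto simp: \<sigma>_def)
    have "distributed M lborel (\<lambda>x. (X x - 0) / \<sigma>) (\<lambda>x. ennreal (std_normal_density x))"
      using normal_standard_normal_convert[OF \<sigma>(1), of X 0] D by simp
    then have d: "distr M lborel (\<lambda>x. X x / \<sigma>) = density lborel (\<lambda>x. ennreal (std_normal_density x))"
      by (simp add: distributed_distr_eq_density)
    have "(CLINT \<omega>|M. iexp (X \<omega>)) = (CLINT \<omega>|M. iexp (\<sigma> * (X \<omega> / \<sigma>)))" using \<sigma> by simp
    also have "\<dots> = (CLINT x|distr M lborel (\<lambda>x. X x / \<sigma>). iexp (\<sigma> * x))"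
      by (subst integral_distr) auto
    also have "\<dots> = char std_normal_distribution \<sigma>" unfolding d char_def ..
    finally show ?thesis unfolding char_std_normal_distribution by (simp add: \<sigma>)
  qed
qed

lemma fbm2_char:
  fixes \<tau> :: "'k \<Rightarrow> real"
  assumes fbm: "fbm2 M H T B1 B2" and F: "finite F" and \<tau>: "\<And>k. k \<in> F \<Longrightarrow> \<tau> k \<in> {0..T}"
  shows "(CLINT \<omega>|M. iexp ((\<Sum>k\<in>F. a k * B1 (\<tau> k) \<omega>) + (\<Sum>k\<in>F. b k * B2 (\<tau> k) \<omega>)))
    = complex_of_real (exp (- ((\<Sum>k\<in>F. \<Sum>l\<in>F. a k * a l * fbm_cov H (\<tau> k) (\<tau> l)) + (\<Sum>k\<in>F. \<Sum>l\<in>F. b k * b l * fbm_cov H (\<tau> k) (\<tau> l))) / 2))"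
proof -
  define S where "S = \<tau> ` F"
  define grp where "grp c s = (\<Sum>k | k \<in> F \<and> \<tau> k = s. c k)" for c :: "'k \<Rightarrow> real" and s
  have lin: "(\<Sum>s\<in>S. grp c s * g s) = (\<Sum>k\<in>F. c k * g (\<tau> k))" for c g
  proof -
    have "(\<Sum>s\<in>S. grp c s * g s) = (\<Sum>s\<in>S. \<Sum>k | k \<in> F \<and> \<tau> k = s. c k * g (\<tau> k))"
      unfolding grp_def sum_distrib_right by (intro sum.cong refl) auto
    also have "\<dots> = (\<Sum>k\<in>F. c k * g (\<tau> k))"
      unfolding S_def by (rule sum.image_gen[OF F, symmetric])
    finally show ?thesis .
  qed
  have quad: "(\<Sum>s\<in>S. \<Sum>t\<in>S. grp c s * grp c t * fbm_cov H s t) = (\<Sum>k\<in>F. \<Sum>l\<in>F. c k * c l * fbm_cov H (\<tau> k) (\<tau> l))" for c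
  proof -
    have "(\<Sum>s\<in>S. \<Sum>t\<in>S. grp c s * grp c t * fbm_cov H s t) = (\<Sum>s\<in>S. grp c s * (\<Sum>t\<in>S. grp c t * fbm_cov H s t))"
      by (simp add: sum_distrib_left mult.assoc)
    also have "\<dots> = (\<Sum>k\<in>F. c k * (\<Sum>l\<in>F. c l * fbm_cov H (\<tau> k) (\<tau> l)))"
      unfolding lin ..
    finally show ?thesis by (simp add: sum_distrib_left mult.assoc)
  qed
  have "centered_normal_rv M (\<lambda>\<omega>. \<Sum>s\<in>S. grp a s * B1 s \<omega> + grp b s * B2 s \<omega>)
      (\<Sum>s\<in>S. \<Sum>t\<in>S. (grp a s * grp a t + grp b s * grp b t) * fbm_cov H s t)"
    using fbm F \<tau> unfolding fbm2_def S_def by blast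
  then have "(CLINT \<omega>|M. iexp (\<Sum>s\<in>S. grp a s * B1 s \<omega> + grp b s * B2 s \<omega>))
     = complex_of_real (exp (- (\<Sum>s\<in>S. \<Sum>t\<in>S. (grp a s * grp a t + grp b s * grp b t) * fbm_cov H s t) / 2))"
    using fbm by (intro centered_normal_char) (auto simp: fbm2_def)
  then show ?thesis
    unfolding sum.distrib distrib_right lin quad .
qed

lemma fbm2_incr_char:
  assumes fbm: "fbm2 M H T B1 B2" and h: "h > 0" and T: "real (Suc K) * h \<le> T"
  shows "(CLINT \<omega>|M. iexp ((\<Sum>i\<le>K. a i * (B1 (real (Suc i) * h) \<omega> - B1 (real i * h) \<omega>)) + (\<Sum>i\<le>K. b i * (B2 (real (Suc i) * h) \<omega> - B2 (real i * h) \<omega>))))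
    = complex_of_real (exp (- ((\<Sum>i\<le>K. \<Sum>j\<le>K. a i * a j * fbm_incr_cov H h i j) + (\<Sum>i\<le>K. \<Sum>j\<le>K. b i * b j * fbm_incr_cov H h i j)) / 2))"
proof -
  \<comment> \<open>The index \<open>(i, True)\<close> is the right endpoint of interval
    \<open>i\<close> and \<open>(i, False)\<close> its left endpoint, taken with the opposite sign
    in \<open>sg\<close>.\<close>
  define F where "F = {..K} \<times> (UNIV :: bool set)"
  define \<tau> where "\<tau> k = real (if snd k then Suc (fst k) else fst k) * h" for k :: "nat \<times> bool"
  define sg where "sg c k = (if snd k then c (fst k) else - c (fst k))" for c :: "nat \<Rightarrow> real" and k :: "nat \<times> bool"
  have F: "finite F" by (simp add: F_def)
  have \<tau>: "\<tau> k \<in> {0..T}" if "k \<in> F" for k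
  proof -
    have "real (if snd k then Suc (fst k) else fst k) * h \<le> real (Suc K) * h"
      using that h by (intro mult_right_mono) (auto simp: F_def)
    then have "\<tau> k \<le> T" using T unfolding \<tau>_def by linarith
    moreover have "0 \<le> \<tau> k" using h by (simp add: \<tau>_def)
    ultimately show ?thesis by simp
  qed
  have sumF: "(\<Sum>k\<in>F. g k) = (\<Sum>i\<le>K. g (i, True) + g (i, False))" for g :: "_ \<Rightarrow> real"
  proof -
    have "(\<Sum>k\<in>F. g k) = (\<Sum>i\<le>K. \<Sum>b\<in>UNIV. g (i, b))"
      unfolding F_def by (simp add: sum.cartesian_product del: UNIV_bool)
    then show ?thesis by (simp add: UNIV_bool add.commute)
  qed
  have lin: "(\<Sum>k\<in>F. sg c k * g (\<tau> k)) = (\<Sum>i\<le>K. c i * (g (real (Suc i) * h) - g (real i * h)))" for c and g :: "real \<Rightarrow> real"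
    unfolding sumF by (simp add: sg_def \<tau>_def algebra_simps)
  have quad: "(\<Sum>k\<in>F. \<Sum>l\<in>F. sg c k * sg c l * fbm_cov H (\<tau> k) (\<tau> l)) = (\<Sum>i\<le>K. \<Sum>j\<le>K. c i * c j * fbm_incr_cov H h i j)" for c
    unfolding sumF sum.distrib[symmetric]
    by (intro sum.cong refl) (simp add: sg_def \<tau>_def fbm_incr_cov_def algebra_simps)
  show ?thesis
    using fbm2_char[where \<tau>=\<tau>, OF fbm F \<tau>, where a="sg a" and b="sg b"] unfolding quad lin[of _ "\<lambda>s. B1 s _"] lin[of _ "\<lambda>s. B2 s _"] .
qed

subsection \<open>Dyadic approximations\<close>

lemma dyad_idx_eq:
  assumes "T > 0" "s < T" "0 \<le> s" "real k * (T / 2^m) \<le> s" "s < real (Suc k) * (T / 2^m)"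
  shows "dyad_idx T m s = k"
proof -
  have h: "T / 2^m > 0" using assms by simp
  have "real k \<le> s / (T / 2^m)" "s / (T / 2^m) < real (Suc k)"
    using assms(4,5) by (simp_all only: pos_le_divide_eq[OF h] pos_divide_less_eq[OF h])
  then have f: "\<lfloor>s / (T / 2^m)\<rfloor> = int k"
    by (intro floor_unique) auto
  have "real k * (T / 2^m) < 2^m * (T / 2^m)" using assms by simp
  then have "real k < real (2^m)" using h by (subst (asm) mult_less_cancel_right_pos) auto
  then have "k < 2^m" by (simp only: of_nat_less_iff)
  then show ?thesis unfolding dyad_idx_def f by simp
qed

lemma dyad_idx_bounds:
  fixes m :: nat
  assumes T: "T > 0" and t: "t \<in> {0..T}"
  defines "h \<equiv> T / 2^m" and "K \<equiv> dyad_idx T m t"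
  shows "real K * h \<le> t" "t \<le> real (Suc K) * h" "K < 2^m" "real (Suc K) * h \<le> T"
proof -
  have h: "h > 0" "2^m * h = T" using T by (auto simp: h_def)
  have fl: "0 \<le> \<lfloor>t / h\<rfloor>" using h t by simp
  show K: "K < 2^m"
    unfolding K_def dyad_idx_def by (rule le_less_trans[OF min.cobounded2]) simp
  have "real K \<le> real (nat \<lfloor>t / h\<rfloor>)" unfolding K_def dyad_idx_def h_def by simp
  also have "\<dots> \<le> t / h" using fl by simp
  finally show "real K * h \<le> t" using h by (simp add: pos_le_divide_eq)
  show "t \<le> real (Suc K) * h"
  proof (cases "nat \<lfloor>t / h\<rfloor> \<le> 2^m - 1")
    case True
    then have "real K = of_int \<lfloor>t / h\<rfloor>" using fl by (simp add: K_def dyad_idx_def h_def[symmetric])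
    then have "t / h \<le> real (Suc K)" using real_of_int_floor_add_one_ge[of "t / h"] unfolding of_nat_Suc by linarith
    then show ?thesis by (simp only: pos_divide_le_eq[OF h(1)])
  next
    \<comment> \<open>Here the floor is \<open>2^m\<close>, which means \<open>t = T\<close>. The
      cap in \<open>dyad_idx\<close> then selects the last interval, which is fully covered.\<close>
    case False
    then have "K = 2^m - 1" unfolding K_def dyad_idx_def h_def[symmetric] by (intro min.absorb2) simp
    then have "Suc K = 2^m" by simp
    then have "real (Suc K) = 2^m" by (metis of_nat_numeral of_nat_power)
    then have "real (Suc K) * h = T" by (simp only: h(2))
    then show ?thesis using t by (simp only: atLeastAtMost_iff)
  qed
  have "Suc K \<le> 2^m" using K by (simp only: Suc_le_eq)
  then have "real (Suc K) \<le> 2^m" by (metis of_nat_le_iff of_nat_numeral of_nat_power)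
  then have "real (Suc K) * h \<le> 2^m * h" by (rule mult_right_mono) (rule less_imp_le[OF h(1)])
  then show "real (Suc K) * h \<le> T" by (simp only: h(2))
qed

lemma integral_piecewise_linear_piece:
  fixes a b F D G h :: real
  assumes "a \<le> b" "h \<noteq> 0"
  shows "((\<lambda>s. (F + (s - a) / h * D) * G) has_integral ((b - a) * F + (b - a)\<^sup>2 / (2 * h) * D) * G) {a..b}"
proof -
  have "((\<lambda>s. (F + (s - a) / h * D) * G) has_integral
     (((b - a) * F + (b - a)\<^sup>2 / (2 * h) * D) * G) - (((a - a) * F + (a - a)\<^sup>2 / (2 * h) * D) * G)) {a..b}"
    by (rule fundamental_theorem_of_calculus[OF assms(1)])
      (use assms(2) in \<open>auto intro!: derivative_eq_intros simp: has_real_derivative_iff_has_vector_derivative[symmetric] field_simps power2_eq_square\<close>)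
  then show ?thesis by simp
qed

lemma dyad_integrand_has_integral:
  fixes f g :: "real \<Rightarrow> real"
  assumes T: "T > 0" and t: "t \<in> {0..T}" and k: "k < 2^m"
  defines "h \<equiv> T / 2^m"
  defines "\<Delta>f \<equiv> f (real (Suc k) * h) - f (real k * h)" and "\<Delta>g \<equiv> g (real (Suc k) * h) - g (real k * h)"
  assumes b: "real k * h \<le> b" "b \<le> real (Suc k) * h"
  shows "((\<lambda>s. dyad_approx T m f s * dyad_slope T m g s) has_integral
     ((b - real k * h) / h * f (real k * h) + ((b - real k * h) / h)\<^sup>2 / 2 * \<Delta>f) * \<Delta>g) {real k * h..b}"
proof -
  have h: "h > 0" "2^m * h = T" using T by (auto simp: h_def)
  have "real (Suc k) \<le> real (2^m)" using k by (simp only: of_nat_le_iff Suc_le_eq)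
  then have "real (Suc k) * h \<le> 2^m * h" using h by (intro mult_right_mono) auto
  then have kT: "real (Suc k) * h \<le> T" using h by simp
  define \<theta> where "\<theta> = (b - real k * h) / h"
  have b_eq: "b - real k * h = \<theta> * h" using h by (simp add: \<theta>_def)
  have int: "((\<lambda>s. (f (real k * h) + (s - real k * h) / h * \<Delta>f) * (\<Delta>g / h)) has_integral
     ((b - real k * h) * f (real k * h) + (b - real k * h)\<^sup>2 / (2 * h) * \<Delta>f) * (\<Delta>g / h)) {real k * h..b}"
    using h by (intro integral_piecewise_linear_piece b(1)) auto
  \<comment> \<open>At the right endpoint \<open>b\<close> the index may already have moved on to
    \<open>Suc k\<close>; this single point is removed and does not affect the integral.\<close>
  have eq: "dyad_approx T m f s * dyad_slope T m g s = (f (real k * h) + (s - real k * h) / h * \<Delta>f) * (\<Delta>g / h)"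
    if "s \<in> {real k * h..b} - {b}" for s
  proof -
    have "dyad_idx T m s = k"
      using that b kT h T by (intro dyad_idx_eq) (auto simp: h_def[symmetric] intro: order_trans[of _ "real k * h"])
    then show ?thesis
      by (simp add: dyad_approx_def dyad_slope_def Let_def h_def[symmetric] \<Delta>f_def \<Delta>g_def add.commute)
  qed
  have "((\<lambda>s. dyad_approx T m f s * dyad_slope T m g s) has_integral
     ((b - real k * h) * f (real k * h) + (b - real k * h)\<^sup>2 / (2 * h) * \<Delta>f) * (\<Delta>g / h)) {real k * h..b}"
    by (rule has_integral_spike_finite[where S="{b}", OF _ eq int]) simp_all
  moreover have "((b - real k * h) * f (real k * h) + (b - real k * h)\<^sup>2 / (2 * h) * \<Delta>f) * (\<Delta>g / h)
    = (\<theta> * f (real k * h) + \<theta>\<^sup>2 / 2 * \<Delta>f) * \<Delta>g"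
    unfolding b_eq using h by (simp add: field_simps power2_eq_square)
  ultimately show ?thesis unfolding \<theta>_def by (simp only:)
qed

lemma dyad_rs_integral_eq:
  fixes f g :: "real \<Rightarrow> real"
  fixes m :: nat
  assumes T: "T > 0" and t: "t \<in> {0..T}"
  defines "h \<equiv> T / 2^m" and "K \<equiv> dyad_idx T m t"
  defines "\<theta> \<equiv> (t - real K * h) / h"
  defines "\<Delta> \<equiv> \<lambda>f k. f (real (Suc k) * h) - f (real k * h)"
  shows "dyad_rs_integral T m f g t =
    (\<Sum>k<K. (f (real k * h) + \<Delta> f k / 2) * \<Delta> g k) + (\<theta> * f (real K * h) + \<theta>\<^sup>2 / 2 * \<Delta> f K) * \<Delta> g K"
proof -
  note b = dyad_idx_bounds[OF T t, of m, folded h_def K_def]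
  have h: "h > 0" using T by (simp add: h_def)
  note piece = dyad_integrand_has_integral[OF T t, where m=m, folded h_def]
  have "((\<lambda>s. dyad_approx T m f s * dyad_slope T m g s) has_integral (\<Sum>k<n. (f (real k * h) + \<Delta> f k / 2) * \<Delta> g k)) {0..real n * h}"
    if "n \<le> K" for n
    using that
  proof (induction n)
    case (Suc n)
    have "((\<lambda>s. dyad_approx T m f s * dyad_slope T m g s) has_integral
      ((real (Suc n) * h - real n * h) / h * f (real n * h) + ((real (Suc n) * h - real n * h) / h)\<^sup>2 / 2 * \<Delta> f n) * \<Delta> g n) {real n * h..real (Suc n) * h}"
      unfolding \<Delta>_def using Suc.prems b(3) h by (intro piece) auto
    moreover have "(real (Suc n) * h - real n * h) / h = 1" using h by (simp add: field_simps)
    ultimately have "((\<lambda>s. dyad_approx T m f s * dyad_slope T m g s) has_integral (f (real n * h) + \<Delta> f n / 2) * \<Delta> g n) {real n * h..real (Suc n) * h}"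
      by simp
    from has_integral_combine[OF _ _ Suc.IH this] show ?case
      using Suc.prems h by simp
  qed (simp add: has_integral_refl)
  from this[of K] have "((\<lambda>s. dyad_approx T m f s * dyad_slope T m g s) has_integral (\<Sum>k<K. (f (real k * h) + \<Delta> f k / 2) * \<Delta> g k)) {0..real K * h}"
    by simp
  moreover have "((\<lambda>s. dyad_approx T m f s * dyad_slope T m g s) has_integral (\<theta> * f (real K * h) + \<theta>\<^sup>2 / 2 * \<Delta> f K) * \<Delta> g K) {real K * h..t}"
    unfolding \<theta>_def \<Delta>_def by (rule piece[OF b(3) b(1,2)])
  ultimately have "((\<lambda>s. dyad_approx T m f s * dyad_slope T m g s) has_integral
     (\<Sum>k<K. (f (real k * h) + \<Delta> f k / 2) * \<Delta> g k) + (\<theta> * f (real K * h) + \<theta>\<^sup>2 / 2 * \<Delta> f K) * \<Delta> g K) {0..t}"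
    using b h by (intro has_integral_combine[where c="real K * h"]) auto
  then show ?thesis unfolding dyad_rs_integral_def by (rule integral_unique)
qed

text \<open>The products of two increments over the same interval are symmetric in \<open>f\<close>
  and \<open>g\<close> and cancel under antisymmetrisation. What remains is a left-endpoint sum, in
  which the incomplete interval enters linearly with weight \<theta>.\<close>

lemma levy_area_approx_eq:
  fixes f g :: "real \<Rightarrow> real"
  fixes m :: nat
  assumes T: "T > 0" and t: "t \<in> {0..T}"
  defines "h \<equiv> T / 2^m" and "K \<equiv> dyad_idx T m t"
  defines "\<theta> \<equiv> (t - real K * h) / h"
  defines "\<Delta> \<equiv> \<lambda>f k. f (real (Suc k) * h) - f (real k * h)"
  shows "levy_area_approx T m f g t =
    (\<Sum>k\<le>K. levy_weight K \<theta> k * (f (real k * h) * \<Delta> g k - g (real k * h) * \<Delta> f k)) / 2"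
proof -
  have 1: "(\<Sum>k\<le>K. levy_weight K \<theta> k * (f (real k * h) * \<Delta> g k - g (real k * h) * \<Delta> f k))
    = (\<Sum>k<K. f (real k * h) * \<Delta> g k - g (real k * h) * \<Delta> f k) + \<theta> * (f (real K * h) * \<Delta> g K - g (real K * h) * \<Delta> f K)"
    by (simp add: lessThan_Suc_atMost[symmetric] levy_weight_def)
  have 2: "(\<Sum>k<K. f (real k * h) * \<Delta> g k - g (real k * h) * \<Delta> f k)
    = (\<Sum>k<K. (f (real k * h) + \<Delta> f k / 2) * \<Delta> g k) - (\<Sum>k<K. (g (real k * h) + \<Delta> g k / 2) * \<Delta> f k)"
    unfolding sum_subtractf[symmetric] by (intro sum.cong refl) (simp add: algebra_simps)
  have 3: "((P + (\<theta> * a + \<theta>\<^sup>2 / 2 * x) * y) - (R + (\<theta> * b + \<theta>\<^sup>2 / 2 * y) * x)) / 2 = (P - R + \<theta> * (a * y - b * x)) / 2" for P R a b x y :: real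
    by (simp add: algebra_simps)
  have rs: "dyad_rs_integral T m f g t =
    (\<Sum>k<K. (f (real k * h) + \<Delta> f k / 2) * \<Delta> g k) + (\<theta> * f (real K * h) + \<theta>\<^sup>2 / 2 * \<Delta> f K) * \<Delta> g K" for f g
    unfolding \<Delta>_def \<theta>_def K_def h_def by (rule dyad_rs_integral_eq[OF T t])
  show ?thesis
    unfolding 1 2 levy_area_approx_def rs by (rule 3)
qed

lemma levy_sum_eq_matrix:
  fixes x y :: "nat \<Rightarrow> real"
  shows "(\<Sum>k\<le>K. levy_weight K \<theta> k * ((\<Sum>i<k. x i) * y k - (\<Sum>i<k. y i) * x k))
    = (\<Sum>i\<le>K. \<Sum>j\<le>K. levy_matrix K \<theta> i j * x i * y j)"
proof -
  have "(\<Sum>i\<le>K. \<Sum>j\<le>K. levy_matrix K \<theta> i j * x i * y j)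
    = (\<Sum>i\<le>K. \<Sum>j\<le>K. (if i < j then levy_weight K \<theta> j * x i * y j else 0) - (if j < i then levy_weight K \<theta> i * x i * y j else 0))"
    by (intro sum.cong refl) (auto simp: levy_matrix_def)
  also have "\<dots> = (\<Sum>i\<le>K. \<Sum>j\<le>K. if i < j then levy_weight K \<theta> j * x i * y j else 0) - (\<Sum>i\<le>K. \<Sum>j\<le>K. if j < i then levy_weight K \<theta> i * x i * y j else 0)"
    by (simp add: sum_subtractf)
  also have "(\<Sum>i\<le>K. \<Sum>j\<le>K. if i < j then levy_weight K \<theta> j * x i * y j else 0) = (\<Sum>k\<le>K. \<Sum>i\<le>K. if i < k then levy_weight K \<theta> k * x i * y k else 0)"
    by (rule sum.swap)
  also have "\<dots> = (\<Sum>k\<le>K. levy_weight K \<theta> k * (\<Sum>i<k. x i) * y k)"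
  proof (intro sum.cong refl)
    fix k assume "k \<in> {..K}"
    then have "(\<Sum>i\<le>K. if i < k then levy_weight K \<theta> k * x i * y k else 0) = (\<Sum>i<k. levy_weight K \<theta> k * x i * y k)"
      by (intro sum.mono_neutral_cong_right) auto
    then show "(\<Sum>i\<le>K. if i < k then levy_weight K \<theta> k * x i * y k else 0) = levy_weight K \<theta> k * (\<Sum>i<k. x i) * y k"
      by (simp add: sum_distrib_left sum_distrib_right)
  qed
  also have "(\<Sum>i\<le>K. \<Sum>j\<le>K. if j < i then levy_weight K \<theta> i * x i * y j else 0) = (\<Sum>k\<le>K. levy_weight K \<theta> k * (\<Sum>i<k. y i) * x k)"
  proof (intro sum.cong refl)
    fix k assume "k \<in> {..K}"
    then have "(\<Sum>i\<le>K. if i < k then levy_weight K \<theta> k * x k * y i else 0) = (\<Sum>i<k. levy_weight K \<theta> k * x k * y i)"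
      by (intro sum.mono_neutral_cong_right) auto
    then show "(\<Sum>i\<le>K. if i < k then levy_weight K \<theta> k * x k * y i else 0) = levy_weight K \<theta> k * (\<Sum>i<k. y i) * x k"
      by (simp add: sum_distrib_left sum_distrib_right ac_simps)
  qed
  finally show ?thesis by (simp add: sum_subtractf algebra_simps)
qed

lemma levy_area_approx_eq_matrix:
  fixes f g :: "real \<Rightarrow> real"
  fixes m :: nat
  assumes T: "T > 0" and t: "t \<in> {0..T}" and "f 0 = 0" "g 0 = 0"
  defines "h \<equiv> T / 2^m" and "K \<equiv> dyad_idx T m t"
  defines "\<theta> \<equiv> (t - real K * h) / h"
  defines "\<Delta> \<equiv> \<lambda>f k. f (real (Suc k) * h) - f (real k * h)"
  shows "levy_area_approx T m f g t = (\<Sum>i\<le>K. \<Sum>j\<le>K. levy_matrix K \<theta> i j * \<Delta> f i * \<Delta> g j) / 2"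
proof -
  have tele: "(\<Sum>i<k. \<Delta> f i) = f (real k * h) - f 0" for k and f :: "real \<Rightarrow> real"
    using sum_lessThan_telescope[of "\<lambda>k. f (real k * h)" k] by (simp add: \<Delta>_def)
  have "levy_area_approx T m f g t =
    (\<Sum>k\<le>K. levy_weight K \<theta> k * ((\<Sum>i<k. \<Delta> f i) * \<Delta> g k - (\<Sum>i<k. \<Delta> g i) * \<Delta> f k)) / 2"
    unfolding tele \<open>f 0 = 0\<close> \<open>g 0 = 0\<close> diff_zero
    unfolding \<Delta>_def \<theta>_def h_def K_def by (rule levy_area_approx_eq[OF T t])
  then show ?thesis unfolding levy_sum_eq_matrix .
qed

lemma dyad_approx_eq_sum:
  fixes f :: "real \<Rightarrow> real"
  fixes m :: nat and T t :: real
  assumes f0: "f 0 = 0"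
  defines "h \<equiv> T / 2^m" and "K \<equiv> dyad_idx T m t"
  defines "\<theta> \<equiv> (t - real K * h) / h"
  shows "dyad_approx T m f t = (\<Sum>i\<le>K. levy_weight K \<theta> i * (f (real (Suc i) * h) - f (real i * h)))"
proof -
  have "(\<Sum>i<K. levy_weight K \<theta> i * (f (real (Suc i) * h) - f (real i * h))) = (\<Sum>i<K. f (real (Suc i) * h) - f (real i * h))"
    by (intro sum.cong) (auto simp: levy_weight_def)
  also have "\<dots> = f (real K * h)" using f0 sum_lessThan_telescope[of "\<lambda>k. f (real k * h)" K] by simp
  finally have "(\<Sum>i\<le>K. levy_weight K \<theta> i * (f (real (Suc i) * h) - f (real i * h)))
    = f (real K * h) + \<theta> * (f (real (Suc K) * h) - f (real K * h))"
    unfolding lessThan_Suc_atMost[symmetric] sum.lessThan_Suc by (simp add: levy_weight_def)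
  then show ?thesis
    unfolding dyad_approx_def Let_def \<theta>_def K_def h_def by (simp only: of_nat_Suc add.commute[of 1])
qed

lemma fbm2_swap:
  assumes "fbm2 M H T B1 B2"
  shows "fbm2 M H T B2 B1"
  unfolding fbm2_def
proof (intro conjI allI impI)
  fix S :: "real set" and a b :: "real \<Rightarrow> real"
  assume "finite S" "S \<subseteq> {0..T}"
  then have "centered_normal_rv M (\<lambda>\<omega>. \<Sum>t\<in>S. b t * B1 t \<omega> + a t * B2 t \<omega>)
     (\<Sum>s\<in>S. \<Sum>t\<in>S. (b s * b t + a s * a t) * fbm_cov H s t)"
    using assms unfolding fbm2_def by blast
  then show "centered_normal_rv M (\<lambda>\<omega>. \<Sum>t\<in>S. a t * B2 t \<omega> + b t * B1 t \<omega>)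
     (\<Sum>s\<in>S. \<Sum>t\<in>S. (a s * a t + b s * b t) * fbm_cov H s t)"
    by (simp only: add.commute)
qed (use assms in \<open>simp_all add: fbm2_def\<close>)

lemma fbm2_measurable:
  assumes "fbm2 M H T B1 B2" "s \<in> {0..T}"
  shows "B1 s \<in> borel_measurable M"
  using assms unfolding fbm2_def by blast

text \<open>The variance at time 0 vanishes, so the prescribed law is the point mass at 0.
  \<open>fbm2\<close> fixes the starting value only in law, hence almost surely.\<close>

lemma fbm2_at_0:
  assumes fbm: "fbm2 M H T B1 B2" and "0 \<le> T"
  shows "AE \<omega> in M. B1 0 \<omega> = 0"
proof -
  have "centered_normal_rv M (\<lambda>\<omega>. \<Sum>t\<in>{0}. 1 * B1 t \<omega> + 0 * B2 t \<omega>)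
     (\<Sum>s\<in>{0}. \<Sum>t\<in>{0}. (1 * 1 + 0 * 0) * fbm_cov H s t)"
    using fbm assms(2) unfolding fbm2_def
    by (elim conjE allE[of _ "{0}"] allE[of _ "\<lambda>_. 1"] allE[of _ "\<lambda>_. 0"]) auto
  then show ?thesis by (simp add: centered_normal_rv_def fbm_cov_def)
qed

lemma grid_point_mem:
  assumes "h > 0" "real n * h \<le> T" "i \<le> n"
  shows "real i * h \<in> {0..T}"
proof -
  have "real i * h \<le> real n * h" using assms by (intro mult_right_mono) auto
  then have "real i * h \<le> T" using assms(2) by (rule order_trans)
  then show ?thesis using assms(1) by simp
qed

lemma fbm2_gaussian_pair:
  assumes fbm: "fbm2 M H T B1 B2" and H: "0 < H" "H < 1/2" and h: "h > 0" and T: "real (Suc K) * h \<le> T"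
  shows "gaussian_pair M {..K} (\<lambda>i \<omega>. B1 (real (Suc i) * h) \<omega> - B1 (real i * h) \<omega>)
    (\<lambda>i \<omega>. B2 (real (Suc i) * h) \<omega> - B2 (real i * h) \<omega>) (fbm_incr_cov H h) (2 * H * T powr (2 * H - 1) * h)"
proof -
  interpret prob_space M using fbm by (simp add: fbm2_def)
  have T0: "T > 0" using h T by (smt (verit) mult_pos_pos of_nat_0_less_iff zero_less_Suc)
  note mem = grid_point_mem[OF h T]
  note meas = fbm2_measurable[OF fbm mem] fbm2_measurable[OF fbm2_swap[OF fbm] mem]
  show ?thesis
  proof
    show "(\<lambda>\<omega>. B1 (real (Suc i) * h) \<omega> - B1 (real i * h) \<omega>) \<in> borel_measurable M"
      "(\<lambda>\<omega>. B2 (real (Suc i) * h) \<omega> - B2 (real i * h) \<omega>) \<in> borel_measurable M" if "i \<in> {..K}" for i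
      using that by (auto intro!: borel_measurable_diff meas simp del: of_nat_Suc)
    show "0 < 2 * H * T powr (2 * H - 1) * h" using H h T0 by simp
  qed (use fbm2_incr_char[OF fbm h T] fbm_incr_cov_coercive[OF H h T] in auto)
qed

subsection \<open>Decay of the characteristic function\<close>

lemma levy_matrix_row:
  assumes "k < K"
  shows "(\<Sum>j\<le>K. levy_matrix K \<theta> k j * (g (Suc j) - g j)) = (g K - g (Suc k)) + \<theta> * (g (Suc K) - g K) - (g k - g 0 :: real)"
proof -
  have "(\<Sum>j\<le>K. levy_matrix K \<theta> k j * (g (Suc j) - g j)) = (\<Sum>j=0..<K. levy_matrix K \<theta> k j * (g (Suc j) - g j)) + \<theta> * (g (Suc K) - g K)"
    using assms by (simp add: lessThan_Suc_atMost[symmetric] lessThan_atLeast0 levy_matrix_def levy_weight_def)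
  also have "(\<Sum>j=0..<K. levy_matrix K \<theta> k j * (g (Suc j) - g j))
    = (\<Sum>j=0..<k. levy_matrix K \<theta> k j * (g (Suc j) - g j)) + (\<Sum>j=k..<K. levy_matrix K \<theta> k j * (g (Suc j) - g j))"
    using assms by (intro sum.atLeastLessThan_concat[symmetric]) auto
  also have "(\<Sum>j=0..<k. levy_matrix K \<theta> k j * (g (Suc j) - g j)) = - (\<Sum>j=0..<k. g (Suc j) - g j)"
    unfolding sum_negf[symmetric] using assms by (intro sum.cong) (auto simp: levy_matrix_def levy_weight_def)
  also have "(\<Sum>j=k..<K. levy_matrix K \<theta> k j * (g (Suc j) - g j)) = levy_matrix K \<theta> k k * (g (Suc k) - g k) + (\<Sum>j=Suc k..<K. levy_matrix K \<theta> k j * (g (Suc j) - g j))"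
    using assms by (intro sum.atLeast_Suc_lessThan) auto
  also have "(\<Sum>j=Suc k..<K. levy_matrix K \<theta> k j * (g (Suc j) - g j)) = (\<Sum>j=Suc k..<K. g (Suc j) - g j)"
    using assms by (intro sum.cong) (auto simp: levy_matrix_def levy_weight_def)
  finally show ?thesis using assms by (simp add: sum_Suc_diff' levy_matrix_def)
qed

text \<open>After exchanging the sums, each of the \<open>K\<close> rows telescopes on both sides of
  the diagonal and leaves four values of \<open>g\<close> together with one difference weighted by
  \<theta>, hence \<open>6 * C\<close>. Only the supremum of \<open>g\<close> enters, so the bound
  is insensitive to the roughness of the path and to the mesh.\<close>

lemma levy_matrix_col_sum_bound:
  assumes \<theta>: "0 \<le> \<theta>" "\<theta> \<le> 1" and g: "\<And>i. i \<le> Suc K \<Longrightarrow> \<bar>g i\<bar> \<le> (C::real)"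
  shows "\<bar>\<Sum>j\<le>K. (\<Sum>k<K. levy_matrix K \<theta> k j) * (g (Suc j) - g j)\<bar> \<le> 6 * real K * C"
proof -
  have "(\<Sum>j\<le>K. (\<Sum>k<K. levy_matrix K \<theta> k j) * (g (Suc j) - g j)) = (\<Sum>k<K. \<Sum>j\<le>K. levy_matrix K \<theta> k j * (g (Suc j) - g j))"
    unfolding sum_distrib_right by (rule sum.swap)
  also have "\<bar>\<dots>\<bar> \<le> (\<Sum>k<K. 6 * C)"
  proof (rule order_trans[OF sum_abs], rule sum_mono)
    fix k assume "k \<in> {..<K}"
    then have k: "k < K" by simp
    have "\<bar>\<theta> * (g (Suc K) - g K)\<bar> \<le> 1 * (2 * C)"
      unfolding abs_mult using \<theta> g[of K] g[of "Suc K"] by (intro mult_mono) auto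
    moreover have "\<bar>g K\<bar> \<le> C" "\<bar>g (Suc k)\<bar> \<le> C" "\<bar>g k\<bar> \<le> C" "\<bar>g 0\<bar> \<le> C"
      using k by (auto intro!: g)
    ultimately show "\<bar>\<Sum>j\<le>K. levy_matrix K \<theta> k j * (g (Suc j) - g j)\<bar> \<le> 6 * C"
      unfolding levy_matrix_row[OF k] by linarith
  qed
  finally show ?thesis by simp
qed

text \<open>The column sum bound is applied twice, once in each argument of the covariance, which is
  bounded by \<open>2 * T powr (2 * H)\<close>; 72 is 6 * 6 * 2. The constant is independent of the
  mesh, as the \<open>V\<close> of \<open>levy_linear_le\<close> has to be.\<close>

lemma levy_col_sum_variance_le:
  assumes H: "0 < H" and h: "h > 0" and T: "real (Suc K) * h \<le> T" and \<theta>: "0 \<le> \<theta>" "\<theta> \<le> 1"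
  shows "(\<Sum>i\<le>K. \<Sum>j\<le>K. (\<Sum>k<K. levy_matrix K \<theta> k i) * (\<Sum>k<K. levy_matrix K \<theta> k j) * fbm_incr_cov H h i j)
    \<le> 72 * T powr (2 * H) * (real K)\<^sup>2"
proof -
  define r where "r j = (\<Sum>k<K. levy_matrix K \<theta> k j)" for j
  define P where "P i s = fbm_cov H (real i * h) s" for i s
  define G where "G s = (\<Sum>i\<le>K. r i * (P (Suc i) s - P i s))" for s
  note mem = grid_point_mem[OF h T]
  have G: "\<bar>G (real i * h)\<bar> \<le> 6 * real K * (2 * T powr (2 * H))" if "i \<le> Suc K" for i
    unfolding G_def r_def by (rule levy_matrix_col_sum_bound[OF \<theta>]) (use H mem that in \<open>auto simp: P_def intro!: abs_fbm_cov_le\<close>)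
  have "(\<Sum>i\<le>K. \<Sum>j\<le>K. r i * r j * fbm_incr_cov H h i j) = (\<Sum>j\<le>K. \<Sum>i\<le>K. r i * r j * fbm_incr_cov H h i j)"
    by (rule sum.swap)
  also have "\<dots> = (\<Sum>j\<le>K. r j * (G (real (Suc j) * h) - G (real j * h)))"
    unfolding G_def sum_subtractf[symmetric] sum_distrib_left
    by (intro sum.cong refl) (simp add: fbm_incr_cov_def P_def algebra_simps)
  also have "\<dots> \<le> \<bar>\<dots>\<bar>" by simp
  also have "\<dots> \<le> 6 * real K * (6 * real K * (2 * T powr (2 * H)))"
    unfolding r_def by (rule levy_matrix_col_sum_bound[OF \<theta>, where g="\<lambda>i. G (real i * h)"]) (rule G)
  finally show ?thesis by (simp add: r_def power2_eq_square ac_simps)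
qed

lemma levy_area_approx_swap: "levy_area_approx T m g f t = - levy_area_approx T m f g t"
  by (simp add: levy_area_approx_def diff_divide_distrib)

lemma
  assumes fbm: "fbm2 M H T B1 B2" and T: "T > 0" and t: "t \<in> {0..T}"
  shows dyad_approx_measurable: "(\<lambda>\<omega>. dyad_approx T m (\<lambda>s. B1 s \<omega>) t) \<in> borel_measurable M"
    and levy_area_approx_measurable: "(\<lambda>\<omega>. levy_area_approx T m (\<lambda>s. B1 s \<omega>) (\<lambda>s. B2 s \<omega>) t) \<in> borel_measurable M"
proof -
  define h K where "h = T / 2^m" and "K = dyad_idx T m t"
  have h: "h > 0" using T by (simp add: h_def)
  have KT: "real (Suc K) * h \<le> T" using dyad_idx_bounds(4)[OF T t] by (simp only: h_def K_def)
  note mem = grid_point_mem[OF h KT]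
  have meas: "B1 (real i * h) \<in> borel_measurable M" "B2 (real i * h) \<in> borel_measurable M" if "i \<le> Suc K" for i
    using fbm2_measurable[OF fbm mem[OF that]] fbm2_measurable[OF fbm2_swap[OF fbm] mem[OF that]] .
  have "real K + 1 = real (Suc K)" by simp
  then show "(\<lambda>\<omega>. dyad_approx T m (\<lambda>s. B1 s \<omega>) t) \<in> borel_measurable M"
    unfolding dyad_approx_def Let_def h_def[symmetric] K_def[symmetric]
    by (simp only:) (intro borel_measurable_add borel_measurable_times borel_measurable_diff borel_measurable_const meas, auto)
  show "(\<lambda>\<omega>. levy_area_approx T m (\<lambda>s. B1 s \<omega>) (\<lambda>s. B2 s \<omega>) t) \<in> borel_measurable M"
    unfolding levy_area_approx_eq[OF T t] h_def[symmetric] K_def[symmetric]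
    by (intro borel_measurable_divide borel_measurable_sum borel_measurable_times borel_measurable_diff borel_measurable_const meas) auto
qed

text \<open>An instance of \<open>bilinear_char_le\<close>; \<open>v\<close> enters only through a
  phase linear in \<eta>, which the modulus discards. Path values are sums of increments only if the
  paths start at 0, so the exponents on the two sides agree almost surely and not
  everywhere.\<close>

lemma dyad_char_le:
  fixes m :: nat and u v w :: real
  assumes fbm: "fbm2 M H T B1 B2" and H: "0 < H" "H < 1/2" and T: "T > 0" and t: "t \<in> {0..T}"
  defines "h \<equiv> T / 2^m" and "K \<equiv> dyad_idx T m t"
  defines "\<theta> \<equiv> (t - real K * h) / h"
  shows "cmod (CLINT \<omega>|M. iexp (u * dyad_approx T m (\<lambda>s. B1 s \<omega>) t + v * dyad_approx T m (\<lambda>s. B2 s \<omega>) t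
      + w * levy_area_approx T m (\<lambda>s. B1 s \<omega>) (\<lambda>s. B2 s \<omega>) t))
    \<le> (LINT \<omega>|M. exp (- (2 * H * T powr (2 * H - 1) * h * (\<Sum>i\<le>K. (u * levy_weight K \<theta> i
        + (\<Sum>j\<le>K. w / 2 * levy_matrix K \<theta> i j * (B2 (real (Suc j) * h) \<omega> - B2 (real j * h) \<omega>)))\<^sup>2)) / 2))"
proof -
  have h: "h > 0" using T by (simp add: h_def)
  have KT: "real (Suc K) * h \<le> T" using dyad_idx_bounds(4)[OF T t] by (simp only: h_def K_def)
  define \<xi> \<eta> where "\<xi> i \<omega> = B1 (real (Suc i) * h) \<omega> - B1 (real i * h) \<omega>"
    and "\<eta> i \<omega> = B2 (real (Suc i) * h) \<omega> - B2 (real i * h) \<omega>" for i \<omega>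
  interpret gaussian_pair M "{..K}" \<xi> \<eta> "fbm_incr_cov H h" "2 * H * T powr (2 * H - 1) * h"
    unfolding \<xi>_def \<eta>_def by (rule fbm2_gaussian_pair[OF fbm H h KT])
  have meas: "(\<lambda>\<omega>. iexp (u * dyad_approx T m (\<lambda>s. B1 s \<omega>) t + v * dyad_approx T m (\<lambda>s. B2 s \<omega>) t
      + w * levy_area_approx T m (\<lambda>s. B1 s \<omega>) (\<lambda>s. B2 s \<omega>) t)) \<in> borel_measurable M"
    using dyad_approx_measurable[OF fbm T t] dyad_approx_measurable[OF fbm2_swap[OF fbm] T t] levy_area_approx_measurable[OF fbm T t]
    by simp
  have meas': "(\<lambda>\<omega>. iexp ((\<Sum>i\<le>K. \<xi> i \<omega> * (u * levy_weight K \<theta> i + (\<Sum>j\<le>K. w / 2 * levy_matrix K \<theta> i j * \<eta> j \<omega>)))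
       + (\<Sum>j\<le>K. v * levy_weight K \<theta> j * \<eta> j \<omega>))) \<in> borel_measurable M"
    using \<xi> \<eta> by simp
  have zero: "AE \<omega> in M. B1 0 \<omega> = 0 \<and> B2 0 \<omega> = 0"
    using fbm2_at_0[OF fbm] fbm2_at_0[OF fbm2_swap[OF fbm]] T by simp
  have AE_eq: "AE \<omega> in M. u * dyad_approx T m (\<lambda>s. B1 s \<omega>) t + v * dyad_approx T m (\<lambda>s. B2 s \<omega>) t
      + w * levy_area_approx T m (\<lambda>s. B1 s \<omega>) (\<lambda>s. B2 s \<omega>) t
     = (\<Sum>i\<le>K. \<xi> i \<omega> * (u * levy_weight K \<theta> i + (\<Sum>j\<le>K. w / 2 * levy_matrix K \<theta> i j * \<eta> j \<omega>)))
       + (\<Sum>j\<le>K. v * levy_weight K \<theta> j * \<eta> j \<omega>)"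
    using zero
  proof eventually_elim
    case (elim \<omega>)
    have d1: "dyad_approx T m (\<lambda>s. B1 s \<omega>) t = (\<Sum>i\<le>K. levy_weight K \<theta> i * \<xi> i \<omega>)"
      unfolding \<xi>_def \<theta>_def K_def h_def by (rule dyad_approx_eq_sum) (use elim in simp)
    have d2: "dyad_approx T m (\<lambda>s. B2 s \<omega>) t = (\<Sum>i\<le>K. levy_weight K \<theta> i * \<eta> i \<omega>)"
      unfolding \<eta>_def \<theta>_def K_def h_def by (rule dyad_approx_eq_sum) (use elim in simp)
    have a: "levy_area_approx T m (\<lambda>s. B1 s \<omega>) (\<lambda>s. B2 s \<omega>) t = (\<Sum>i\<le>K. \<Sum>j\<le>K. levy_matrix K \<theta> i j * \<xi> i \<omega> * \<eta> j \<omega>) / 2"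
      unfolding \<xi>_def \<eta>_def \<theta>_def K_def h_def
      by (rule levy_area_approx_eq_matrix[OF T t]) (use elim in simp_all)
    show ?case
      unfolding d1 d2 a by (simp add: sum.distrib sum_distrib_left sum_divide_distrib distrib_left ac_simps)
  qed
  have "(CLINT \<omega>|M. iexp (u * dyad_approx T m (\<lambda>s. B1 s \<omega>) t + v * dyad_approx T m (\<lambda>s. B2 s \<omega>) t
      + w * levy_area_approx T m (\<lambda>s. B1 s \<omega>) (\<lambda>s. B2 s \<omega>) t))
    = (CLINT \<omega>|M. iexp ((\<Sum>i\<le>K. \<xi> i \<omega> * (u * levy_weight K \<theta> i + (\<Sum>j\<le>K. w / 2 * levy_matrix K \<theta> i j * \<eta> j \<omega>)))
       + (\<Sum>j\<le>K. v * levy_weight K \<theta> j * \<eta> j \<omega>)))"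
  proof (rule integral_cong_AE)
    show "AE \<omega> in M. iexp (u * dyad_approx T m (\<lambda>s. B1 s \<omega>) t + v * dyad_approx T m (\<lambda>s. B2 s \<omega>) t
        + w * levy_area_approx T m (\<lambda>s. B1 s \<omega>) (\<lambda>s. B2 s \<omega>) t)
      = iexp ((\<Sum>i\<le>K. \<xi> i \<omega> * (u * levy_weight K \<theta> i + (\<Sum>j\<le>K. w / 2 * levy_matrix K \<theta> i j * \<eta> j \<omega>)))
        + (\<Sum>j\<le>K. v * levy_weight K \<theta> j * \<eta> j \<omega>))"
      using AE_eq by eventually_elim (simp only:)
  qed (fact meas meas')+
  then show ?thesis
    using bilinear_char_le[of "\<lambda>i. u * levy_weight K \<theta> i" "\<lambda>i j. w / 2 * levy_matrix K \<theta> i j" "\<lambda>j. v * levy_weight K \<theta> j"]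
    unfolding \<eta>_def by (simp only:)
qed

lemma power_le_fact_exp:
  fixes x :: real
  assumes "0 \<le> x"
  shows "x ^ n \<le> fact n * exp x"
proof -
  have "x ^ n /\<^sub>R fact n \<le> (\<Sum>k. x ^ k /\<^sub>R fact k)"
    using sum_le_suminf[OF summable_exp_generic[of x], of "{n}"] assms by simp
  then show ?thesis by (simp add: exp_def field_simps)
qed

lemma dyad_weight_bounds:
  fixes m :: nat
  assumes T: "T > 0" and t: "t \<in> {0..T}"
  defines "h \<equiv> T / 2^m" and "K \<equiv> dyad_idx T m t"
  defines "\<theta> \<equiv> (t - real K * h) / h"
  shows "0 \<le> \<theta>" "\<theta> \<le> 1"
proof -
  have h: "h > 0" using T by (simp add: h_def)
  note b = dyad_idx_bounds[OF T t, of m, folded h_def K_def]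
  show "0 \<le> \<theta>" using b(1) h by (simp add: \<theta>_def)
  have "t - real K * h \<le> 1 * h" using b(2) by (simp add: algebra_simps)
  then show "\<theta> \<le> 1" unfolding \<theta>_def using h by (simp only: pos_divide_le_eq)
qed

section \<open>Passage to the limit in the dyadic level\<close>

lemma dyad_mesh_tendsto_0: "(\<lambda>m. T / 2^m) \<longlonglongrightarrow> (0::real)"
  by real_asymp

lemma dyad_idx_tendsto:
  assumes T: "T > 0" and t: "t \<in> {0..T}"
  shows "(\<lambda>m. real (dyad_idx T m t) * (T / 2^m)) \<longlonglongrightarrow> t"
    and "(\<lambda>m. real (Suc (dyad_idx T m t)) * (T / 2^m)) \<longlonglongrightarrow> t"
proof -
  note b = dyad_idx_bounds[OF T t]
  have l: "(\<lambda>m. t - T / 2^m) \<longlonglongrightarrow> t" and u: "(\<lambda>m. t + T / 2^m) \<longlonglongrightarrow> t"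
    using tendsto_diff[OF tendsto_const dyad_mesh_tendsto_0, of t T] tendsto_add[OF tendsto_const dyad_mesh_tendsto_0, of t T] by simp_all
  have s: "real (Suc (dyad_idx T m t)) * (T / 2^m) = real (dyad_idx T m t) * (T / 2^m) + T / 2^m" for m
    by (simp add: field_simps)
  show "(\<lambda>m. real (dyad_idx T m t) * (T / 2^m)) \<longlonglongrightarrow> t"
  proof (rule tendsto_sandwich[OF _ _ l tendsto_const])
    show "\<forall>\<^sub>F m in sequentially. t - T / 2^m \<le> real (dyad_idx T m t) * (T / 2^m)"
      using b(2) unfolding s by (intro always_eventually allI) (simp add: algebra_simps)
    show "\<forall>\<^sub>F m in sequentially. real (dyad_idx T m t) * (T / 2^m) \<le> t"
      using b(1) by (intro always_eventually allI)
  qed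
  show "(\<lambda>m. real (Suc (dyad_idx T m t)) * (T / 2^m)) \<longlonglongrightarrow> t"
  proof (rule tendsto_sandwich[OF _ _ tendsto_const u])
    show "\<forall>\<^sub>F m in sequentially. t \<le> real (Suc (dyad_idx T m t)) * (T / 2^m)"
      using b(2) by (intro always_eventually allI)
    show "\<forall>\<^sub>F m in sequentially. real (Suc (dyad_idx T m t)) * (T / 2^m) \<le> t + T / 2^m"
      using b(1) unfolding s by (intro always_eventually allI add_right_mono)
  qed
qed

lemma dyad_approx_tendsto:
  assumes T: "T > 0" and t: "t \<in> {0..T}" and f: "continuous_on {0..T} f"
  shows "(\<lambda>m. dyad_approx T m f t) \<longlonglongrightarrow> f t"
proof -
  define p q where "p m = f (real (dyad_idx T m t) * (T / 2^m))" and "q m = f (real (Suc (dyad_idx T m t)) * (T / 2^m))" for m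
  define \<theta> where "\<theta> m = (t - real (dyad_idx T m t) * (T / 2^m)) / (T / 2^m)" for m
  have mem: "real i * (T / 2^m) \<in> {0..T}" if "i \<le> Suc (dyad_idx T m t)" for i m
    using T that by (intro grid_point_mem[OF _ dyad_idx_bounds(4)[OF T t]]) auto
  have p: "p \<longlonglongrightarrow> f t" unfolding p_def
    using mem by (intro continuous_on_tendsto_compose[OF f dyad_idx_tendsto(1)[OF T t] t] always_eventually allI) simp
  have q: "q \<longlonglongrightarrow> f t" unfolding q_def
    using mem by (intro continuous_on_tendsto_compose[OF f dyad_idx_tendsto(2)[OF T t] t] always_eventually allI) (simp only: order_refl)
  have pq: "(\<lambda>m. q m - p m) \<longlonglongrightarrow> 0" using tendsto_diff[OF q p] by simp
  have "(\<lambda>m. \<theta> m * (q m - p m)) \<longlonglongrightarrow> 0"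
  proof (rule Lim_null_comparison[OF _ tendsto_rabs_zero[OF pq]])
    have "0 \<le> \<theta> m" "\<theta> m \<le> 1" for m
      unfolding \<theta>_def by (rule dyad_weight_bounds[OF T t])+
    then have "\<bar>\<theta> m\<bar> \<le> 1" for m by simp
    then show "\<forall>\<^sub>F m in sequentially. norm (\<theta> m * (q m - p m)) \<le> \<bar>q m - p m\<bar>"
      by (intro always_eventually allI) (simp add: abs_mult mult_left_le_one_le)
  qed
  from tendsto_add[OF p this] have "(\<lambda>m. p m + \<theta> m * (q m - p m)) \<longlonglongrightarrow> f t" by simp
  moreover have "dyad_approx T m f t = p m + \<theta> m * (q m - p m)" for m
    unfolding dyad_approx_def Let_def p_def q_def \<theta>_def by (simp only: of_nat_Suc add.commute[of 1])
  ultimately show ?thesis by simp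
qed

definition levy_char :: "'a measure \<Rightarrow> real \<Rightarrow> (real \<Rightarrow> 'a \<Rightarrow> real) \<Rightarrow> (real \<Rightarrow> 'a \<Rightarrow> real) \<Rightarrow> real \<Rightarrow> real \<Rightarrow> real \<Rightarrow> real \<Rightarrow> nat \<Rightarrow> complex" where
  "levy_char M T B1 B2 t u v w m = (CLINT \<omega>|M. iexp (u * dyad_approx T m (\<lambda>s. B1 s \<omega>) t
     + v * dyad_approx T m (\<lambda>s. B2 s \<omega>) t + w * levy_area_approx T m (\<lambda>s. B1 s \<omega>) (\<lambda>s. B2 s \<omega>) t))"

lemma levy_char_swap: "levy_char M T B2 B1 t v u (- w) m = levy_char M T B1 B2 t u v w m"
  unfolding levy_char_def levy_area_approx_swap[where f="\<lambda>s. B1 s _"]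
  by (intro Bochner_Integration.integral_cong refl arg_cong[where f=iexp]) simp

lemma levy_char_tendsto:
  assumes fbm: "fbm2 M H T B1 B2" and T: "T > 0" and t: "t \<in> {0..T}"
    and conv: "AE \<omega> in M. convergent (\<lambda>m. levy_area_approx T m (\<lambda>s. B1 s \<omega>) (\<lambda>s. B2 s \<omega>) t)"
  shows "levy_char M T B1 B2 t u v w \<longlonglongrightarrow> (CLINT \<omega>|M. iexp (u * B1 t \<omega> + v * B2 t \<omega>
    + w * lim (\<lambda>m. levy_area_approx T m (\<lambda>s. B1 s \<omega>) (\<lambda>s. B2 s \<omega>) t)))"
  unfolding levy_char_def
proof (rule integral_dominated_convergence[where w="\<lambda>_. 1"])
  interpret prob_space M using fbm by (simp add: fbm2_def)
  note [measurable] = dyad_approx_measurable[OF fbm T t] dyad_approx_measurable[OF fbm2_swap[OF fbm] T t]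
    levy_area_approx_measurable[OF fbm T t] fbm2_measurable[OF fbm t] fbm2_measurable[OF fbm2_swap[OF fbm] t]
  show "(\<lambda>\<omega>. iexp (u * B1 t \<omega> + v * B2 t \<omega> + w * lim (\<lambda>m. levy_area_approx T m (\<lambda>s. B1 s \<omega>) (\<lambda>s. B2 s \<omega>) t))) \<in> borel_measurable M"
    by measurable
  show "(\<lambda>\<omega>. iexp (u * dyad_approx T m (\<lambda>s. B1 s \<omega>) t + v * dyad_approx T m (\<lambda>s. B2 s \<omega>) t
      + w * levy_area_approx T m (\<lambda>s. B1 s \<omega>) (\<lambda>s. B2 s \<omega>) t)) \<in> borel_measurable M" for m
    by measurable
  show "integrable M (\<lambda>_. 1::real)" by simp
  show "AE \<omega> in M. norm (iexp (u * dyad_approx T m (\<lambda>s. B1 s \<omega>) t + v * dyad_approx T m (\<lambda>s. B2 s \<omega>) t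
      + w * levy_area_approx T m (\<lambda>s. B1 s \<omega>) (\<lambda>s. B2 s \<omega>) t)) \<le> 1" for m
    by (simp only: norm_exp_i_times) simp
  have cont: "continuous_on {0..T} (\<lambda>s. B1 s \<omega>)" "continuous_on {0..T} (\<lambda>s. B2 s \<omega>)" if "\<omega> \<in> space M" for \<omega>
    using fbm that by (simp_all add: fbm2_def)
  show "AE \<omega> in M. (\<lambda>m. iexp (u * dyad_approx T m (\<lambda>s. B1 s \<omega>) t + v * dyad_approx T m (\<lambda>s. B2 s \<omega>) t
      + w * levy_area_approx T m (\<lambda>s. B1 s \<omega>) (\<lambda>s. B2 s \<omega>) t))
    \<longlonglongrightarrow> iexp (u * B1 t \<omega> + v * B2 t \<omega> + w * lim (\<lambda>m. levy_area_approx T m (\<lambda>s. B1 s \<omega>) (\<lambda>s. B2 s \<omega>) t))"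
    using conv AE_space
  proof eventually_elim
    case (elim \<omega>)
    have "(\<lambda>m. u * dyad_approx T m (\<lambda>s. B1 s \<omega>) t + v * dyad_approx T m (\<lambda>s. B2 s \<omega>) t
      + w * levy_area_approx T m (\<lambda>s. B1 s \<omega>) (\<lambda>s. B2 s \<omega>) t)
      \<longlonglongrightarrow> u * B1 t \<omega> + v * B2 t \<omega> + w * lim (\<lambda>m. levy_area_approx T m (\<lambda>s. B1 s \<omega>) (\<lambda>s. B2 s \<omega>) t)"
      using elim cont by (intro tendsto_add tendsto_mult tendsto_const dyad_approx_tendsto[OF T t]) (auto simp: convergent_LIMSEQ_iff)
    then show ?case by (intro tendsto_exp tendsto_mult tendsto_const tendsto_of_real)
  qed
qed

text \<open>A coarse mesh \<delta> is fixed in terms of \<open>N\<close>. At every finer level the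
  half-blocks consist of \<open>l = 2^(m - m0)\<close> intervals, so that
  \<open>l * h = \<delta>\<close> and the product of the coercivity constant \<open>c * h\<close>
  with \<open>l\<close> is \<open>c * \<delta>\<close>. This gives the witness
  \<open>(c * \<delta>)\<^sup>2 / 8\<close> for \<open>a\<close>, independent of
  \<open>m\<close>.\<close>

lemma levy_char_le_area:
  assumes fbm: "fbm2 M H T B1 B2" and H: "0 < H" "H < 1/2" and T: "T > 0" and t: "t \<in> {0<..T}"
  shows "\<exists>a>0. \<forall>u v w. \<forall>\<^sub>F m in sequentially. cmod (levy_char M T B1 B2 t u v w m) \<le> 1 / sqrt (1 + a * w\<^sup>2) ^ N"
proof -
  have t': "t \<in> {0..T}" and t0: "t > 0" using t by auto
  define c where "c = 2 * H * T powr (2 * H - 1)"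
  have c: "c > 0" using H T by (simp add: c_def)
  \<comment> \<open>\<open>N\<close> blocks consist of \<open>2 * N\<close> half-blocks of length
    \<delta>. One more \<delta>, which is at least the fine mesh, makes room for the last and
    possibly incomplete interval.\<close>
  have "(\<lambda>m. real (2 * N + 1) * (T / 2^m)) \<longlonglongrightarrow> real (2 * N + 1) * 0"
    by (intro tendsto_mult tendsto_const dyad_mesh_tendsto_0)
  then have "\<forall>\<^sub>F m in sequentially. (2 * N + 1) * (T / 2^m) < t"
    using t0 by (intro order_tendstoD(2)[where y="0::real"]) auto
  then obtain m0 where m0: "(2 * N + 1) * (T / 2^m0) < t"
    by (auto simp: eventually_sequentially)
  define \<delta> where "\<delta> = T / 2^m0"
  have \<delta>: "\<delta> > 0" using T by (simp add: \<delta>_def)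
  have "cmod (levy_char M T B1 B2 t u v w m) \<le> 1 / sqrt (1 + (c * \<delta>)\<^sup>2 / 8 * w\<^sup>2) ^ N" if m: "m \<ge> m0" for u v w m
  proof -
    define h K where "h = T / 2^m" and "K = dyad_idx T m t"
    define l :: nat where "l = 2^(m - m0)"
    define \<theta> where "\<theta> = (t - real K * h) / h"
    have h: "h > 0" using T by (simp add: h_def)
    have l: "l > 0" by (simp add: l_def)
    have lh: "real l * h = \<delta>"
    proof -
      have "(2::real) ^ m = 2 ^ (m - m0) * 2 ^ m0" using m by (simp flip: power_add)
      then show ?thesis by (simp add: l_def h_def \<delta>_def)
    qed
    note b = dyad_idx_bounds[OF T t', of m, folded h_def K_def]
    have "1 * h \<le> real l * h" using l h by (intro mult_right_mono) auto
    then have "real (2 * N * l) * h + h < t"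
      using m0 unfolding \<delta>_def[symmetric] by (simp add: lh[symmetric] algebra_simps)
    then have "real (2 * N * l) * h < real K * h" using b(2) by (simp add: algebra_simps)
    then have "2 * N * l < K" using h by (simp only: mult_less_cancel_right_pos of_nat_less_iff)
    then have K: "2 * N * l \<le> K" by simp
    have KT: "real (Suc K) * h \<le> T" by (rule b(4))
    have "cmod (levy_char M T B1 B2 t u v w m) \<le> 1 / sqrt (1 + (c * h * w * real l)\<^sup>2 / 8) ^ N"
      unfolding levy_char_def
      using dyad_char_le[OF fbm H T t', of u m v w, folded h_def K_def, folded c_def \<theta>_def]
        levy_quadratic_le[OF fbm2_gaussian_pair[OF fbm H h KT] K l, of u \<theta> w, folded c_def]
      by (rule order_trans)
    moreover have "(c * h * w * real l)\<^sup>2 = (c * \<delta>)\<^sup>2 * w\<^sup>2"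
      unfolding lh[symmetric] by (simp add: power_mult_distrib ac_simps)
    ultimately show ?thesis by simp
  qed
  then have "\<forall>u v w. \<forall>\<^sub>F m in sequentially. cmod (levy_char M T B1 B2 t u v w m) \<le> 1 / sqrt (1 + (c * \<delta>)\<^sup>2 / 8 * w\<^sup>2) ^ N"
    unfolding eventually_sequentially by blast
  moreover have "(c * \<delta>)\<^sup>2 / 8 > 0" using c \<delta> by simp
  ultimately show ?thesis by blast
qed

text \<open>The length \<open>K * h\<close> of the complete intervals tends to \<open>t\<close> from
  below. In the numerator it is eventually bounded below by \<open>t / 2\<close>, in the denominator
  above by \<open>t\<close>, which removes the dependence on the level.\<close>

lemma levy_char_le_endpoint:
  assumes fbm: "fbm2 M H T B1 B2" and H: "0 < H" "H < 1/2" and T: "T > 0" and t: "t \<in> {0<..T}"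
  defines "c \<equiv> 2 * H * T powr (2 * H - 1)" and "V \<equiv> 72 * T powr (2 * H)"
  shows "\<forall>\<^sub>F m in sequentially. cmod (levy_char M T B1 B2 t u v w m) \<le> exp (- (c * t / 2 * u\<^sup>2) / (2 * (1 + c * t * V / 4 * w\<^sup>2)))"
proof -
  have t': "t \<in> {0..T}" and t0: "t > 0" using t by auto
  have c: "c > 0" using H T by (simp add: c_def)
  have V: "V > 0" using T by (simp add: V_def)
  have "\<forall>\<^sub>F m in sequentially. t / 2 < real (dyad_idx T m t) * (T / 2^m)"
    using t0 by (intro order_tendstoD(1)[OF dyad_idx_tendsto(1)[OF T t']]) auto
  then show ?thesis
  proof eventually_elim
    case (elim m)
    define h K where "h = T / 2^m" and "K = dyad_idx T m t"
    define \<theta> where "\<theta> = (t - real K * h) / h"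
    have h: "h > 0" using T by (simp add: h_def)
    note b = dyad_idx_bounds[OF T t', of m, folded h_def K_def]
    have hK: "t / 2 < real K * h" using elim by (simp only: h_def K_def)
    then have K: "K > 0" using t0 by (cases K) auto
    have KT: "real (Suc K) * h \<le> T" by (rule b(4))
    note \<theta> = dyad_weight_bounds[OF T t', of m, folded h_def K_def, folded \<theta>_def]
    have "cmod (levy_char M T B1 B2 t u v w m) \<le> exp (- (c * h * K * u\<^sup>2) / (2 * (1 + c * h * K * w\<^sup>2 * V / 4)))"
      unfolding levy_char_def
      using dyad_char_le[OF fbm H T t', of u m v w, folded h_def K_def, folded c_def \<theta>_def]
        levy_linear_le[OF fbm2_gaussian_pair[OF fbm H h KT] K levy_col_sum_variance_le[OF H(1) h KT \<theta>, folded V_def], of u w, folded c_def]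
      by (rule order_trans)
    also have "\<dots> \<le> exp (- (c * t / 2 * u\<^sup>2) / (2 * (1 + c * t * V / 4 * w\<^sup>2)))"
    proof -
      have "c * t / 2 * u\<^sup>2 / (2 * (1 + c * t * V / 4 * w\<^sup>2)) \<le> c * (real K * h) * u\<^sup>2 / (2 * (1 + c * (real K * h) * V / 4 * w\<^sup>2))"
      proof (rule frac_le)
        have "c * (t / 2) * u\<^sup>2 \<le> c * (real K * h) * u\<^sup>2"
          using c hK by (intro mult_right_mono mult_left_mono) auto
        then show "c * t / 2 * u\<^sup>2 \<le> c * (real K * h) * u\<^sup>2" by simp
        show "0 \<le> c * (real K * h) * u\<^sup>2" using c h by simp
        show "0 < 2 * (1 + c * (real K * h) * V / 4 * w\<^sup>2)" using c h V by (simp add: add_pos_nonneg)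
        have le: "c * (real K * h) * V / 4 * w\<^sup>2 \<le> c * t * V / 4 * w\<^sup>2"
          using c V b(1) by (intro mult_right_mono divide_right_mono mult_left_mono) auto
        show "2 * (1 + c * (real K * h) * V / 4 * w\<^sup>2) \<le> 2 * (1 + c * t * V / 4 * w\<^sup>2)"
          by (rule mult_left_mono[OF add_left_mono[OF le]]) simp
      qed
      then show ?thesis by (simp add: ac_simps)
    qed
    finally show ?case .
  qed
qed

subsection \<open>The density\<close>

text \<open>From \<open>(d * s - 1) * (1 + d * s) \<le> d\<^sup>2 * s\<^sup>2\<close> the fraction
  in the exponent is at least \<open>(b / d) * s - b / d\<^sup>2\<close>. This linear growth beats
  every power.\<close>

lemma power_mult_exp_bounded:
  fixes b d :: real
  assumes b: "b > 0" and d: "d > 0"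
  shows "\<exists>C. \<forall>s\<ge>0. (1 + s) ^ N * exp (- (b * s\<^sup>2) / (1 + d * s)) \<le> C"
proof (intro exI allI impI)
  fix s :: real assume s: "0 \<le> s"
  define q where "q = b / d"
  have q: "q > 0" using b d by (simp add: q_def)
  have "(d * s - 1) * (1 + d * s) \<le> d\<^sup>2 * s\<^sup>2" by (simp add: power2_eq_square algebra_simps)
  then have "b / d\<^sup>2 * ((d * s - 1) * (1 + d * s)) \<le> b / d\<^sup>2 * (d\<^sup>2 * s\<^sup>2)"
    using b by (intro mult_left_mono) auto
  then have "(q * s - b / d\<^sup>2) * (1 + d * s) \<le> b * s\<^sup>2"
    using d by (simp add: q_def power2_eq_square field_simps)
  then have "q * s - b / d\<^sup>2 \<le> b * s\<^sup>2 / (1 + d * s)"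
    using d s by (simp add: pos_le_divide_eq add_pos_nonneg)
  then have e: "exp (- (b * s\<^sup>2) / (1 + d * s)) \<le> exp (b / d\<^sup>2 - q * s)" by simp
  have p: "(1 + s) ^ N \<le> fact N * exp (q * (1 + s)) / q ^ N"
    using power_le_fact_exp[of "q * (1 + s)" N] q s by (simp add: power_mult_distrib pos_le_divide_eq mult.commute)
  have "(1 + s) ^ N * exp (- (b * s\<^sup>2) / (1 + d * s)) \<le> (fact N * exp (q * (1 + s)) / q ^ N) * exp (b / d\<^sup>2 - q * s)"
    using e p s q by (intro mult_mono) auto
  also have "\<dots> = fact N / q ^ N * exp (q + b / d\<^sup>2)"
    by (simp add: exp_add[symmetric] algebra_simps)
  finally show "(1 + s) ^ N * exp (- (b * s\<^sup>2) / (1 + d * s)) \<le> fact N / q ^ N * exp (q + b / d\<^sup>2)" .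
qed

text \<open>Let \<open>s\<close> be the larger of \<open>\<bar>u\<bar>\<close> and
  \<open>\<bar>v\<bar>\<close>. If \<open>s \<le> w\<^sup>2\<close>, the polynomial base is of order
  \<open>1 + a * w\<^sup>2\<close> and the first bound compensates it exactly. Otherwise
  \<open>w\<^sup>2\<close> may be replaced by \<open>s\<close> in the denominator of the exponential
  bound, which leaves a function of \<open>s\<close> alone.\<close>

lemma rapid_decay_of_bounds:
  fixes a b d :: real
  assumes a: "a > 0" and b: "b > 0" and d: "d > 0"
  shows "\<exists>C. \<forall>x u v w. x \<le> 1 / sqrt (1 + a * w\<^sup>2) ^ (2 * N) \<longrightarrow> x \<le> exp (- (b * u\<^sup>2) / (1 + d * w\<^sup>2))
    \<longrightarrow> x \<le> exp (- (b * v\<^sup>2) / (1 + d * w\<^sup>2)) \<longrightarrow> 0 \<le> x \<longrightarrow> (1 + (\<bar>u\<bar> + (\<bar>v\<bar> + \<bar>w\<bar>))) ^ N * x \<le> C"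
proof -
  \<comment> \<open>Chosen so that \<open>1 + w\<^sup>2\<close> is controlled by
    \<open>1 + a * w\<^sup>2\<close> both for small and for large \<open>a\<close>.\<close>
  define A where "A = max 1 (1 / a)"
  have A: "1 + w\<^sup>2 \<le> A * (1 + a * w\<^sup>2)" for w
  proof -
    have "1 \<le> A" "1 \<le> A * a" using a by (auto simp: A_def max_def field_simps)
    then have "1 + 1 * w\<^sup>2 \<le> A + A * a * w\<^sup>2" by (intro add_mono mult_right_mono) auto
    then show ?thesis by (simp add: algebra_simps)
  qed
  obtain D where D: "\<And>s. 0 \<le> s \<Longrightarrow> (1 + s) ^ N * exp (- (b * s\<^sup>2) / (1 + d * s)) \<le> D"
    using power_mult_exp_bounded[OF b d] by blast
  have "(1 + (\<bar>u\<bar> + (\<bar>v\<bar> + \<bar>w\<bar>))) ^ N * x \<le> max ((3 * A) ^ N) (3 ^ N * D)"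
    if x: "x \<le> 1 / sqrt (1 + a * w\<^sup>2) ^ (2 * N)" "0 \<le> x"
      and xu: "x \<le> exp (- (b * u\<^sup>2) / (1 + d * w\<^sup>2))" and xv: "x \<le> exp (- (b * v\<^sup>2) / (1 + d * w\<^sup>2))" for x u v w
  proof -
    define s where "s = max \<bar>u\<bar> \<bar>v\<bar>"
    have s: "0 \<le> s" "\<bar>u\<bar> \<le> s" "\<bar>v\<bar> \<le> s" by (auto simp: s_def)
    have w1: "2 * \<bar>w\<bar> \<le> 1 + w\<^sup>2"
      using zero_le_power2[of "\<bar>w\<bar> - 1"] by (simp add: power2_diff)
    have xs: "x \<le> exp (- (b * s\<^sup>2) / (1 + d * w\<^sup>2))" using xu xv by (auto simp: s_def max_def)
    have pos: "0 \<le> 1 + (\<bar>u\<bar> + (\<bar>v\<bar> + \<bar>w\<bar>))" by simp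
    show ?thesis
    proof (cases "s \<le> w\<^sup>2")
      case True
      have "1 + (\<bar>u\<bar> + (\<bar>v\<bar> + \<bar>w\<bar>)) \<le> 3 * (A * (1 + a * w\<^sup>2))"
        using s True w1 A[of w] zero_le_power2[of w] by linarith
      then have "(1 + (\<bar>u\<bar> + (\<bar>v\<bar> + \<bar>w\<bar>))) ^ N \<le> (3 * A * (1 + a * w\<^sup>2)) ^ N"
        using pos by (intro power_mono) (auto simp: mult.assoc)
      moreover have "x \<le> 1 / (1 + a * w\<^sup>2) ^ N"
        using x a by (simp add: power_mult)
      ultimately have "(1 + (\<bar>u\<bar> + (\<bar>v\<bar> + \<bar>w\<bar>))) ^ N * x \<le> (3 * A * (1 + a * w\<^sup>2)) ^ N * (1 / (1 + a * w\<^sup>2) ^ N)"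
      proof (rule mult_mono)
        have "0 \<le> 3 * A * (1 + a * w\<^sup>2)" using a by (simp add: A_def)
        then show "0 \<le> (3 * A * (1 + a * w\<^sup>2)) ^ N" by (rule zero_le_power)
      qed (rule x(2))
      also have "\<dots> = (3 * A) ^ N"
      proof -
        have "1 + a * w\<^sup>2 > 0" using a by (simp add: add_pos_nonneg)
        then show ?thesis by (simp add: power_mult_distrib)
      qed
      finally show ?thesis by simp
    next
      case False
      have "w\<^sup>2 \<le> s" using False by simp
      then have "2 * \<bar>w\<bar> \<le> 2 * (1 + s)" using w1 s(1) by simp
      then have "\<bar>w\<bar> \<le> 1 + s" by simp
      then have "1 + (\<bar>u\<bar> + (\<bar>v\<bar> + \<bar>w\<bar>)) \<le> 1 + (s + (s + (1 + s)))"
        using s by (intro add_mono) auto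
      also have "\<dots> \<le> 3 * (1 + s)" by simp
      finally have "1 + (\<bar>u\<bar> + (\<bar>v\<bar> + \<bar>w\<bar>)) \<le> 3 * (1 + s)" .
      then have "(1 + (\<bar>u\<bar> + (\<bar>v\<bar> + \<bar>w\<bar>))) ^ N \<le> (3 * (1 + s)) ^ N"
        using pos by (intro power_mono)
      moreover have "x \<le> exp (- (b * s\<^sup>2) / (1 + d * s))"
      proof -
        have "b * s\<^sup>2 / (1 + d * s) \<le> b * s\<^sup>2 / (1 + d * w\<^sup>2)"
          using b d s False by (intro divide_left_mono mult_pos_pos) (auto simp: add_pos_nonneg)
        then show ?thesis using xs by (elim order_trans) simp
      qed
      ultimately have "(1 + (\<bar>u\<bar> + (\<bar>v\<bar> + \<bar>w\<bar>))) ^ N * x \<le> (3 * (1 + s)) ^ N * exp (- (b * s\<^sup>2) / (1 + d * s))"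
        using x s by (intro mult_mono) auto
      also have "\<dots> = 3 ^ N * ((1 + s) ^ N * exp (- (b * s\<^sup>2) / (1 + d * s)))" unfolding power_mult_distrib by (rule mult.assoc)
      also have "\<dots> \<le> 3 ^ N * D" using D[OF s(1)] by (intro mult_left_mono) auto
      finally show ?thesis by simp
    qed
  qed
  then show ?thesis by blast
qed

theorem theorem1p1:
  fixes M :: "'a measure" and H T :: real
    and B1 B2 :: "real \<Rightarrow> 'a \<Rightarrow> real"
  assumes H: "1/3 < H" "H < 1/2"
    and T: "T > 0"
    and fbm: "fbm2 M H T B1 B2"
    and lim_exists: "\<And>t. t \<in> {0<..T} \<Longrightarrow>
           AE \<omega> in M. convergent (\<lambda>m. levy_area_approx T m (\<lambda>s. B1 s \<omega>) (\<lambda>s. B2 s \<omega>) t)"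
    and t: "t \<in> {0<..T}"
  shows "\<exists>p :: real \<times> real \<times> real \<Rightarrow> real.
           (\<forall>x. 0 \<le> p x) \<and> smooth_fun p \<and>
           distributed M lborel
             (\<lambda>\<omega>. (B1 t \<omega>, B2 t \<omega>,
                    lim (\<lambda>m. levy_area_approx T m (\<lambda>s. B1 s \<omega>) (\<lambda>s. B2 s \<omega>) t)))
             (\<lambda>x. ennreal (p x))"
proof (rule smooth_density_of_rapidly_decreasing_char)
  have H0: "0 < H" using H by simp
  have t': "t \<in> {0..T}" and t0: "t > 0" using t by auto
  show "prob_space M" using fbm by (simp add: fbm2_def)
  then interpret prob_space M .
  define L where "L \<omega> = lim (\<lambda>m. levy_area_approx T m (\<lambda>s. B1 s \<omega>) (\<lambda>s. B2 s \<omega>) t)" for \<omega>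
  note [measurable] = levy_area_approx_measurable[OF fbm T t'] fbm2_measurable[OF fbm t'] fbm2_measurable[OF fbm2_swap[OF fbm] t']
  have [measurable]: "L \<in> borel_measurable M" unfolding L_def by measurable
  show "(\<lambda>\<omega>. (B1 t \<omega>, B2 t \<omega>, lim (\<lambda>m. levy_area_approx T m (\<lambda>s. B1 s \<omega>) (\<lambda>s. B2 s \<omega>) t))) \<in> borel_measurable M"
    unfolding L_def[symmetric] by measurable
  define \<phi> where "\<phi> \<xi> = (CLINT \<omega>|M. iexp (\<xi> \<bullet> (B1 t \<omega>, B2 t \<omega>, L \<omega>)))" for \<xi>
  have \<phi>: "\<phi> (u, v, w) = (CLINT \<omega>|M. iexp (u * B1 t \<omega> + v * B2 t \<omega> + w * L \<omega>))" for u v w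
    by (simp add: \<phi>_def add.assoc)
  have lim: "levy_char M T B1 B2 t u v w \<longlonglongrightarrow> \<phi> (u, v, w)" for u v w
    unfolding \<phi> L_def by (rule levy_char_tendsto[OF fbm T t' lim_exists[OF t]])
  define c V where "c = 2 * H * T powr (2 * H - 1)" and "V = 72 * T powr (2 * H)"
  have c: "c > 0" "V > 0" using H T by (auto simp: c_def V_def)
  have le: "cmod (\<phi> (u, v, w)) \<le> B" if "\<forall>\<^sub>F m in sequentially. cmod (levy_char M T B1 B2 t u v w m) \<le> B" for u v w B
    using that by (intro tendsto_upperbound[OF tendsto_norm[OF lim]]) auto
  \<comment> \<open>Absorbs the factor 2 in the denominator of the endpoint bound, which turns
    \<open>c * t / 2\<close> into the constant \<open>c * t / 4\<close> used below.\<close>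
  have cancel: "- (x / 2 * y) / (2 * z) = - (x / 4 * y) / z" for x y z :: real by simp
  have le_u: "cmod (\<phi> (u, v, w)) \<le> exp (- (c * t / 4 * u\<^sup>2) / (1 + c * t * V / 4 * w\<^sup>2))" for u v w
    using le[OF levy_char_le_endpoint[OF fbm H0 H(2) T t, of u v w]] unfolding cancel c_def V_def .
  \<comment> \<open>Exchanging the components turns \<open>(u, v, w)\<close> into
    \<open>(v, u, - w)\<close>, since the area changes sign; the bound depends on \<open>w\<close>
    only through its square.\<close>
  have le_v: "cmod (\<phi> (u, v, w)) \<le> exp (- (c * t / 4 * v\<^sup>2) / (1 + c * t * V / 4 * w\<^sup>2))" for u v w
    using le[OF levy_char_le_endpoint[OF fbm2_swap[OF fbm] H0 H(2) T t, of v u "- w", unfolded levy_char_swap]] unfolding cancel c_def V_def power2_minus .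
  show "rapidly_decreasing (\<lambda>\<xi>. CLINT \<omega>|M. iexp (\<xi> \<bullet> (B1 t \<omega>, B2 t \<omega>, lim (\<lambda>m. levy_area_approx T m (\<lambda>s. B1 s \<omega>) (\<lambda>s. B2 s \<omega>) t))))"
    unfolding L_def[symmetric] \<phi>_def[symmetric] rapidly_decreasing_def
  proof (intro conjI allI)
    show "\<phi> \<in> borel_measurable borel" unfolding \<phi>_def by measurable
    fix N :: nat
    \<comment> \<open>\<open>2 * N\<close> blocks, because each block contributes only an inverse
      square root. The constant \<open>a\<close> is chosen after \<open>N\<close>.\<close>
    obtain a where a: "a > 0" "\<And>u v w. \<forall>\<^sub>F m in sequentially. cmod (levy_char M T B1 B2 t u v w m) \<le> 1 / sqrt (1 + a * w\<^sup>2) ^ (2 * N)"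
      using levy_char_le_area[OF fbm H0 H(2) T t, of "2 * N"] by blast
    have "c * t / 4 > 0" "c * t * V / 4 > 0" using c t0 by auto
    from rapid_decay_of_bounds[OF a(1) this, of N] obtain C where
      C: "\<And>x u v w. x \<le> 1 / sqrt (1 + a * w\<^sup>2) ^ (2 * N) \<Longrightarrow> x \<le> exp (- (c * t / 4 * u\<^sup>2) / (1 + c * t * V / 4 * w\<^sup>2))
        \<Longrightarrow> x \<le> exp (- (c * t / 4 * v\<^sup>2) / (1 + c * t * V / 4 * w\<^sup>2)) \<Longrightarrow> 0 \<le> x \<Longrightarrow> (1 + (\<bar>u\<bar> + (\<bar>v\<bar> + \<bar>w\<bar>))) ^ N * x \<le> C"
      by blast
    have "(1 + norm \<xi>) ^ N * cmod (\<phi> \<xi>) \<le> C" for \<xi>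
    proof (cases \<xi>)
      case (fields u v w)
      have "norm \<xi> \<le> \<bar>u\<bar> + (\<bar>v\<bar> + \<bar>w\<bar>)"
        using norm_Pair_le[of u "(v, w)"] norm_Pair_le[of v w] unfolding fields by simp
      then have "(1 + norm \<xi>) ^ N * cmod (\<phi> \<xi>) \<le> (1 + (\<bar>u\<bar> + (\<bar>v\<bar> + \<bar>w\<bar>))) ^ N * cmod (\<phi> \<xi>)"
        by (intro mult_right_mono power_mono) auto
      also have "\<dots> \<le> C"
        unfolding fields by (intro C le[OF a(2)] le_u le_v) auto
      finally show ?thesis .
    qed
    then show "\<exists>C. \<forall>\<xi>. (1 + norm \<xi>) ^ N * cmod (\<phi> \<xi>) \<le> C" by blast
  qed
qed

end
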